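(* The process $\Lambda$ weakly preserves composition of spans: for all spans of essentially finite groupoids $A_1\xleftarrow{s}X\xrightarrow{t}A_2$ and $A_2\xleftarrow{s'}X'\xrightarrow{t'}A_3$, there is a natural isomorphism $$\beta_{X',X}:\Lambda(X'\circ X)\to\Lambda(X')\circ\Lambda(X)$$ of functors $[A_1,\mathrm{Vect}]\to[A_3,\mathrm{Vect}]$, i.e. a natural isomorphism $(t'\circ T)_*\circ(s\circ S)^*\cong(t')_*\circ(s')^*\circ t_*\circ s^*$.
   Context: Vect is the category of finite-dimensional complex vector spaces. A groupoid is essentially finite if it is equivalent to a finite groupoid. $[A,\mathrm{Vect}]$ is the category of functors $A\to\mathrm{Vect}$ and natural transformations. For a functor $f:B\to A$ of essentially finite groupoids, $f^*:[A,\mathrm{Vect}]\to[B,\mathrm{Vect}]$ is $F\mapsto F\circ f$, and $f_*:[B,\mathrm{Vect}]\to[A,\mathrm{Vect}]$ is its two-sided adjoint, given by $(f_*G)(a)=\mathrm{colim}\,G$ over the comma category $(f\downarrow a)$ (whose objects are pairs of $b\in B$ and a morphism $f(b)\to a$). For a span $A_1\xleftarrow{s}X\xrightarrow{t}A_2$, $\Lambda(X)=t_*\circ s^*:[A_1,\mathrm{Vect}]\to[A_2,\mathrm{Vect}]$. The composite span is $A_1\xleftarrow{s\circ S}X'\circ X\xrightarrow{t'\circ T}A_3$, where $X'\circ X$ is the weak pullback: its objects are triples $(x,g,x')$ with $x\in X$, $x'\in X'$ and $g:t(x)\to s'(x')$ a morphism of $A_2$; its morphisms $(x_1,g_1,x_1')\to(x_2,g_2,x_2')$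 are pairs $(h:x_1\to x_2,\ k:x_1'\to x_2')$ with $s'(k)\,g_1=g_2\,t(h)$; and $S:X'\circ X\to X$, $T:X'\circ X\to X'$ are the projections. *)

theory Defs
  imports "Jordan_Normal_Form.VS_Connect" "HOL-Library.FuncSet"
begin

section \<open>Categories, functors, natural transformations\<close>

text \<open>Composition is written in the usual order: \<open>Cmp C g f\<close> is \<open>g\<close> after \<open>f\<close>.\<close>

record ('o, 'm) category =
  Obj :: "'o set"
  Arr :: "'m set"
  Dom :: "'m \<Rightarrow> 'o"
  Cod :: "'m \<Rightarrow> 'o"
  Ide :: "'o \<Rightarrow> 'm"
  Cmp :: "'m \<Rightarrow> 'm \<Rightarrow> 'm"

locale category =
  fixes C :: "('o, 'm) category"
  assumes dom_in: "f \<in> Arr C \<Longrightarrow> Dom C f \<in> Obj C"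
    and cod_in: "f \<in> Arr C \<Longrightarrow> Cod C f \<in> Obj C"
    and ide_in: "x \<in> Obj C \<Longrightarrow> Ide C x \<in> Arr C"
    and dom_ide: "x \<in> Obj C \<Longrightarrow> Dom C (Ide C x) = x"
    and cod_ide: "x \<in> Obj C \<Longrightarrow> Cod C (Ide C x) = x"
    and cmp_in: "\<lbrakk>f \<in> Arr C; g \<in> Arr C; Cod C f = Dom C g\<rbrakk> \<Longrightarrow> Cmp C g f \<in> Arr C"
    and dom_cmp: "\<lbrakk>f \<in> Arr C; g \<in> Arr C; Cod C f = Dom C g\<rbrakk> \<Longrightarrow> Dom C (Cmp C g f) = Dom C f"
    and cod_cmp: "\<lbrakk>f \<in> Arr C; g \<in> Arr C; Cod C f = Dom C g\<rbrakk> \<Longrightarrow> Cod C (Cmp C g f) = Cod C g"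
    and cmp_ide_left: "f \<in> Arr C \<Longrightarrow> Cmp C (Ide C (Cod C f)) f = f"
    and cmp_ide_right: "f \<in> Arr C \<Longrightarrow> Cmp C f (Ide C (Dom C f)) = f"
    and cmp_assoc: "\<lbrakk>f \<in> Arr C; g \<in> Arr C; h \<in> Arr C; Cod C f = Dom C g; Cod C g = Dom C h\<rbrakk>
      \<Longrightarrow> Cmp C h (Cmp C g f) = Cmp C (Cmp C h g) f"

definition in_hom :: "('o, 'm) category \<Rightarrow> 'm \<Rightarrow> 'o \<Rightarrow> 'o \<Rightarrow> bool" where
  "in_hom C f x y \<longleftrightarrow> f \<in> Arr C \<and> Dom C f = x \<and> Cod C f = y"

definition is_iso :: "('o, 'm) category \<Rightarrow> 'm \<Rightarrow> bool" where
  "is_iso C f \<longleftrightarrow> f \<in> Arr C \<and>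
     (\<exists>g. in_hom C g (Cod C f) (Dom C f) \<and>
          Cmp C g f = Ide C (Dom C f) \<and> Cmp C f g = Ide C (Cod C f))"

record ('o, 'm, 'p, 'n) functor_data =
  FObj :: "'o \<Rightarrow> 'p"
  FArr :: "'m \<Rightarrow> 'n"

locale cat_functor = C: category C + D: category D
  for C :: "('o, 'm) category" and D :: "('p, 'n) category" +
  fixes F :: "('o, 'm, 'p, 'n) functor_data"
  assumes fobj_in: "x \<in> Obj C \<Longrightarrow> FObj F x \<in> Obj D"
    and farr_in: "f \<in> Arr C \<Longrightarrow> FArr F f \<in> Arr D"
    and dom_farr: "f \<in> Arr C \<Longrightarrow> Dom D (FArr F f) = FObj F (Dom C f)"
    and cod_farr: "f \<in> Arr C \<Longrightarrow> Cod D (FArr F f) = FObj F (Cod C f)"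
    and farr_ide: "x \<in> Obj C \<Longrightarrow> FArr F (Ide C x) = Ide D (FObj F x)"
    and farr_cmp: "\<lbrakk>f \<in> Arr C; g \<in> Arr C; Cod C f = Dom C g\<rbrakk>
      \<Longrightarrow> FArr F (Cmp C g f) = Cmp D (FArr F g) (FArr F f)"

definition functor_id :: "('o, 'm, 'o, 'm) functor_data" where
  "functor_id = \<lparr>FObj = (\<lambda>x. x), FArr = (\<lambda>f. f)\<rparr>"

definition functor_comp ::
  "('p, 'n, 'q, 'k) functor_data \<Rightarrow> ('o, 'm, 'p, 'n) functor_data \<Rightarrow> ('o, 'm, 'q, 'k) functor_data" where
  "functor_comp G F = \<lparr>FObj = FObj G \<circ> FObj F, FArr = FArr G \<circ> FArr F\<rparr>"

locale nat_trans = F: cat_functor C D F + G: cat_functor C D G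
  for C :: "('o, 'm) category" and D :: "('p, 'n) category" and F G +
  fixes \<tau> :: "'o \<Rightarrow> 'n"
  assumes component: "x \<in> Obj C \<Longrightarrow> in_hom D (\<tau> x) (FObj F x) (FObj G x)"
    and naturality: "f \<in> Arr C \<Longrightarrow>
      Cmp D (\<tau> (Cod C f)) (FArr F f) = Cmp D (FArr G f) (\<tau> (Dom C f))"

locale nat_iso = nat_trans +
  assumes component_iso: "x \<in> Obj C \<Longrightarrow> is_iso D (\<tau> x)"

definition equivalent_categories :: "('o, 'm) category \<Rightarrow> ('p, 'n) category \<Rightarrow> bool" where
  "equivalent_categories C D \<longleftrightarrow>
     (\<exists>F G \<eta> \<epsilon>. cat_functor C D F \<and> cat_functor D C G \<and>
        nat_iso C C functor_id (functor_comp G F) \<eta> \<and>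
        nat_iso D D (functor_comp F G) functor_id \<epsilon>)"

text \<open>Objects of the functor category are made extensional, so that two functors which agree on
  the category are equal; likewise for natural transformations. An arrow carries its source and
  target functor.\<close>

definition functor_category :: "('o, 'm) category \<Rightarrow> ('p, 'n) category \<Rightarrow>
    (('o, 'm, 'p, 'n) functor_data,
     ('o, 'm, 'p, 'n) functor_data \<times> ('o \<Rightarrow> 'n) \<times> ('o, 'm, 'p, 'n) functor_data) category" where
  "functor_category C D =
    (let Fun = {F. cat_functor C D F \<and> FObj F \<in> extensional (Obj C) \<and> FArr F \<in> extensional (Arr C)}
     in \<lparr>Obj = Fun,
         Arr = {(F, \<tau>, G). F \<in> Fun \<and> G \<in> Fun \<and> nat_trans C D F G \<tau> \<and> \<tau> \<in> extensional (Obj C)},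
         Dom = (\<lambda>(F, \<tau>, G). F),
         Cod = (\<lambda>(F, \<tau>, G). G),
         Ide = (\<lambda>F. (F, \<lambda>x\<in>Obj C. Ide D (FObj F x), F)),
         Cmp = (\<lambda>(G', \<sigma>, H) (F, \<tau>, G). (F, \<lambda>x\<in>Obj C. Cmp D (\<sigma> x) (\<tau> x), H))\<rparr>)"


section \<open>Groupoids and spans\<close>

locale groupoid = category C for C :: "('o, 'm) category" +
  assumes all_iso: "f \<in> Arr C \<Longrightarrow> is_iso C f"

text \<open>Every finite groupoid is isomorphic to one whose objects and arrows are natural numbers, so
  it is no restriction to look for the equivalent finite groupoid among those.\<close>

definition essentially_finite_groupoid :: "('o, 'm) category \<Rightarrow> bool" where
  "essentially_finite_groupoid A \<longleftrightarrow> groupoid A \<and>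
     (\<exists>H :: (nat, nat) category. groupoid H \<and> finite (Obj H) \<and> finite (Arr H) \<and>
        equivalent_categories A H)"

definition groupoid_span ::
  "('o1, 'm1) category \<Rightarrow> ('x, 'y) category \<Rightarrow> ('o2, 'm2) category \<Rightarrow>
   ('x, 'y, 'o1, 'm1) functor_data \<Rightarrow> ('x, 'y, 'o2, 'm2) functor_data \<Rightarrow> bool" where
  "groupoid_span A1 X A2 s t \<longleftrightarrow>
     essentially_finite_groupoid A1 \<and> essentially_finite_groupoid X \<and>
     essentially_finite_groupoid A2 \<and> cat_functor X A1 s \<and> cat_functor X A2 t"

definition weak_pullback_obj ::
  "('x, 'y) category \<Rightarrow> ('o, 'm) category \<Rightarrow> ('u, 'v) category \<Rightarrow>
   ('x, 'y, 'o, 'm) functor_data \<Rightarrow> ('u, 'v, 'o, 'm) functor_data \<Rightarrow> ('x \<times> 'm \<times> 'u) set" where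
  "weak_pullback_obj X A X' t s' =
     {(x, g, x'). x \<in> Obj X \<and> x' \<in> Obj X' \<and> in_hom A g (FObj t x) (FObj s' x')}"

definition weak_pullback ::
  "('x, 'y) category \<Rightarrow> ('o, 'm) category \<Rightarrow> ('u, 'v) category \<Rightarrow>
   ('x, 'y, 'o, 'm) functor_data \<Rightarrow> ('u, 'v, 'o, 'm) functor_data \<Rightarrow>
   ('x \<times> 'm \<times> 'u, ('x \<times> 'm \<times> 'u) \<times> ('y \<times> 'v) \<times> ('x \<times> 'm \<times> 'u)) category" where
  "weak_pullback X A X' t s' =
    \<lparr>Obj = weak_pullback_obj X A X' t s',
     Arr = {((x1, g1, x1'), (h, k), (x2, g2, x2')) | x1 g1 x1' h k x2 g2 x2'.
              (x1, g1, x1') \<in> weak_pullback_obj X A X' t s' \<and>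
              (x2, g2, x2') \<in> weak_pullback_obj X A X' t s' \<and>
              in_hom X h x1 x2 \<and> in_hom X' k x1' x2' \<and>
              Cmp A (FArr s' k) g1 = Cmp A g2 (FArr t h)},
     Dom = (\<lambda>(p, hk, q). p),
     Cod = (\<lambda>(p, hk, q). q),
     Ide = (\<lambda>(x, g, x'). ((x, g, x'), (Ide X x, Ide X' x'), (x, g, x'))),
     Cmp = (\<lambda>(q', (h', k'), r) (p, (h, k), q). (p, (Cmp X h' h, Cmp X' k' k), r))\<rparr>"

definition weak_pullback_fst ::
  "('x \<times> 'm \<times> 'u, ('x \<times> 'm \<times> 'u) \<times> ('y \<times> 'v) \<times> ('x \<times> 'm \<times> 'u), 'x, 'y) functor_data" where
  "weak_pullback_fst = \<lparr>FObj = (\<lambda>(x, g, x'). x), FArr = (\<lambda>(p, (h, k), q). h)\<rparr>"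

definition weak_pullback_snd ::
  "('x \<times> 'm \<times> 'u, ('x \<times> 'm \<times> 'u) \<times> ('y \<times> 'v) \<times> ('x \<times> 'm \<times> 'u), 'u, 'v) functor_data" where
  "weak_pullback_snd = \<lparr>FObj = (\<lambda>(x, g, x'). x'), FArr = (\<lambda>(p, (h, k), q). k)\<rparr>"


section \<open>Colimits\<close>

definition is_cocone :: "('j, 'i) category \<Rightarrow> ('p, 'n) category \<Rightarrow> ('j, 'i, 'p, 'n) functor_data \<Rightarrow>
    'p \<Rightarrow> ('j \<Rightarrow> 'n) \<Rightarrow> bool" where
  "is_cocone J D G L \<iota> \<longleftrightarrow> cat_functor J D G \<and> L \<in> Obj D \<and>
     (\<forall>j\<in>Obj J. in_hom D (\<iota> j) (FObj G j) L) \<and>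
     (\<forall>m\<in>Arr J. Cmp D (\<iota> (Cod J m)) (FArr G m) = \<iota> (Dom J m))"

definition is_mediating :: "('j, 'i) category \<Rightarrow> ('p, 'n) category \<Rightarrow>
    'p \<Rightarrow> ('j \<Rightarrow> 'n) \<Rightarrow> 'p \<Rightarrow> ('j \<Rightarrow> 'n) \<Rightarrow> 'n \<Rightarrow> bool" where
  "is_mediating J D L \<iota> M \<kappa> u \<longleftrightarrow> in_hom D u L M \<and> (\<forall>j\<in>Obj J. Cmp D u (\<iota> j) = \<kappa> j)"

definition is_colimit :: "('j, 'i) category \<Rightarrow> ('p, 'n) category \<Rightarrow> ('j, 'i, 'p, 'n) functor_data \<Rightarrow>
    'p \<Rightarrow> ('j \<Rightarrow> 'n) \<Rightarrow> bool" where
  "is_colimit J D G L \<iota> \<longleftrightarrow> is_cocone J D G L \<iota> \<and>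
     (\<forall>M \<kappa>. is_cocone J D G M \<kappa> \<longrightarrow> (\<exists>!u. is_mediating J D L \<iota> M \<kappa> u))"

text \<open>A chosen colimit of each diagram that has one, with its legs, and the arrow out of it that a
  cocone induces.\<close>

definition colim :: "('j, 'i) category \<Rightarrow> ('p, 'n) category \<Rightarrow> ('j, 'i, 'p, 'n) functor_data \<Rightarrow>
    'p \<times> ('j \<Rightarrow> 'n)" where
  "colim J D G = (SOME (L, \<iota>). is_colimit J D G L \<iota>)"

definition colim_obj where "colim_obj J D G = fst (colim J D G)"

definition colim_leg where "colim_leg J D G = snd (colim J D G)"

definition colim_map :: "('j, 'i) category \<Rightarrow> ('p, 'n) category \<Rightarrow> ('j, 'i, 'p, 'n) functor_data \<Rightarrow>
    'p \<Rightarrow> ('j \<Rightarrow> 'n) \<Rightarrow> 'n" where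
  "colim_map J D G M \<kappa> =
     (THE u. is_mediating J D (colim_obj J D G) (colim_leg J D G) M \<kappa> u)"


section \<open>Restriction and pushforward along a functor\<close>

definition precomp :: "('u, 'v) category \<Rightarrow> ('u, 'v, 'o, 'm) functor_data \<Rightarrow>
    ('o, 'm, 'p, 'n) functor_data \<Rightarrow> ('u, 'v, 'p, 'n) functor_data" where
  "precomp B f F =
    \<lparr>FObj = restrict (FObj (functor_comp F f)) (Obj B),
     FArr = restrict (FArr (functor_comp F f)) (Arr B)\<rparr>"

text \<open>The functor \<open>f\<^sup>*\<close> from \<open>functor_category A D\<close> to \<open>functor_category B D\<close>, for \<open>f : B \<rightarrow> A\<close>.\<close>

definition pullback_functor where
  "pullback_functor B f =
    \<lparr>FObj = precomp B f,
     FArr = (\<lambda>(F, \<tau>, G). (precomp B f F, \<lambda>b\<in>Obj B. \<tau> (FObj f b), precomp B f G))\<rparr>"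

definition comma_obj :: "('u, 'v) category \<Rightarrow> ('o, 'm) category \<Rightarrow> ('u, 'v, 'o, 'm) functor_data \<Rightarrow>
    'o \<Rightarrow> ('u \<times> 'm) set" where
  "comma_obj B A f a = {(b, g). b \<in> Obj B \<and> in_hom A g (FObj f b) a}"

definition comma_category :: "('u, 'v) category \<Rightarrow> ('o, 'm) category \<Rightarrow>
    ('u, 'v, 'o, 'm) functor_data \<Rightarrow> 'o \<Rightarrow>
    ('u \<times> 'm, ('u \<times> 'm) \<times> 'v \<times> ('u \<times> 'm)) category" where
  "comma_category B A f a =
    \<lparr>Obj = comma_obj B A f a,
     Arr = {((b, g), h, (b', g')) | b g h b' g'.
              (b, g) \<in> comma_obj B A f a \<and> (b', g') \<in> comma_obj B A f a \<and>
              in_hom B h b b' \<and> Cmp A g' (FArr f h) = g},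
     Dom = (\<lambda>(p, h, q). p),
     Cod = (\<lambda>(p, h, q). q),
     Ide = (\<lambda>(b, g). ((b, g), Ide B b, (b, g))),
     Cmp = (\<lambda>(q', h', r) (p, h, q). (p, Cmp B h' h, r))\<rparr>"

definition comma_proj :: "('u \<times> 'm, ('u \<times> 'm) \<times> 'v \<times> ('u \<times> 'm), 'u, 'v) functor_data" where
  "comma_proj = \<lparr>FObj = (\<lambda>(b, g). b), FArr = (\<lambda>(p, h, q). h)\<rparr>"

text \<open>The functor \<open>f\<^sub>* G\<close>: an arrow \<open>m : a \<rightarrow> a'\<close> induces the map of colimits which takes the leg at
  \<open>(b, g)\<close> to the leg at \<open>(b, m \<circ> g)\<close>.\<close>

definition pushforward_obj where
  "pushforward_obj B A D f G =
    (let K = (\<lambda>a. comma_category B A f a); P = functor_comp G comma_proj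
     in \<lparr>FObj = (\<lambda>a\<in>Obj A. colim_obj (K a) D P),
         FArr = (\<lambda>m\<in>Arr A. colim_map (K (Dom A m)) D P (colim_obj (K (Cod A m)) D P)
                   (\<lambda>(b, g). colim_leg (K (Cod A m)) D P (b, Cmp A m g)))\<rparr>)"

text \<open>The functor \<open>f\<^sub>*\<close> from \<open>functor_category B D\<close> to \<open>functor_category A D\<close>, for \<open>f : B \<rightarrow> A\<close>.\<close>

definition pushforward_functor where
  "pushforward_functor B A D f =
    \<lparr>FObj = pushforward_obj B A D f,
     FArr = (\<lambda>(G, \<tau>, H). (pushforward_obj B A D f G,
       \<lambda>a\<in>Obj A. colim_map (comma_category B A f a) D (functor_comp G comma_proj)
         (colim_obj (comma_category B A f a) D (functor_comp H comma_proj))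
         (\<lambda>(b, g). Cmp D (colim_leg (comma_category B A f a) D (functor_comp H comma_proj) (b, g)) (\<tau> b)),
       pushforward_obj B A D f H))\<rparr>"


section \<open>Finite-dimensional complex vector spaces\<close>

type_synonym 'v vspace = "(complex, 'v) module"
type_synonym 'v vect_category = "('v vspace, 'v vspace \<times> ('v \<Rightarrow> 'v) \<times> 'v vspace) category"

text \<open>The carriers are subsets of the type \<open>'v\<close>, which plays the role of the universe. If \<open>'v\<close> has at
  least the cardinality of the continuum, then every finite-dimensional complex vector space is
  isomorphic to an object of \<open>Vect\<close>. The fields \<open>mult\<close> and \<open>one\<close>, which the record \<open>module\<close> inherits
  from rings, are irrelevant.\<close>

definition Vect :: "'v vect_category" where
  "Vect =
    (let Sp = {V. vectorspace class_ring V \<and> vectorspace.fin_dim class_ring V}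
     in \<lparr>Obj = Sp,
         Arr = {(V, T, W). V \<in> Sp \<and> W \<in> Sp \<and> linear_map class_ring V W T \<and>
                  T \<in> extensional (carrier V)},
         Dom = (\<lambda>(V, T, W). V),
         Cod = (\<lambda>(V, T, W). W),
         Ide = (\<lambda>V. (V, \<lambda>v\<in>carrier V. v, V)),
         Cmp = (\<lambda>(W', S, U) (V, T, W). (V, compose (carrier V) S T, U))\<rparr>)"

definition Lambda ::
  "('x, 'y) category \<Rightarrow> ('o2, 'm2) category \<Rightarrow>
   ('x, 'y, 'o1, 'm1) functor_data \<Rightarrow> ('x, 'y, 'o2, 'm2) functor_data \<Rightarrow>
   (('o1, 'm1, 'v vspace, 'v vspace \<times> ('v \<Rightarrow> 'v) \<times> 'v vspace) functor_data, _,
    ('o2, 'm2, 'v vspace, 'v vspace \<times> ('v \<Rightarrow> 'v) \<times> 'v vspace) functor_data, _) functor_data" where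
  "Lambda X A2 s t = functor_comp (pushforward_functor X A2 Vect t) (pullback_functor X s)"

end

theory Submission
  imports Defs
begin

text \<open>The theorem is the base change isomorphism \<open>(t' T)\<^sub>* S\<^sup>* \<cong> t'\<^sub>* s'\<^sup>* t\<^sub>*\<close>, whiskered with \<open>s\<^sup>*\<close>. It holds in every
  category \<open>D\<close> in which the pointwise colimits exist. A cocone on \<open>G \<circ> S\<close> over \<open>(t' T \<down> a)\<close> is a family of
  maps \<open>\<kappa>((x, g, x'), m)\<close>; for fixed \<open>(x', m)\<close> it is a cocone over \<open>(t \<down> s' x')\<close> and so induces a map
  out of \<open>(t\<^sub>* G)(s' x')\<close>, and these maps form a cocone over \<open>(t' \<down> a)\<close>. So the iterated colimit is a
  colimit of the diagram over \<open>(t' T \<down> a)\<close>, and two colimits of one diagram are isomorphic.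

  The colimits exist in \<open>Vect\<close> because every object of these comma categories maps to one of finitely
  many objects: objects of \<open>X\<close>, \<open>X'\<close> and the weak pullback are retracts of finitely many ones, and
  hom sets are finite.\<close>

text \<open>Pointwise colimits are picked by \<open>SOME\<close>, so the values of a pushforward
  cannot be computed with. Equations between maps out of such a colimit are therefore checked on
  legs, which are jointly epimorphic, and the comparison map is built and inverted by universal
  properties alone. This keeps base change formal: beyond being a category, \<open>D\<close> only
  has to possess the colimits in question.

  In \<open>Vect\<close> their existence is the real obstacle. All carriers lie in one arbitrary
  type \<open>'v\<close>, whereas the usual quotient of a direct sum has its carrier in another
  type. So a colimit is not constructed but selected, as a cocone of largest dimension among those
  generated by their legs. A largest one exists because of a uniform bound: if every object of the
  diagram maps to one in a finite set \<open>S\<close>, the legs at \<open>S\<close> already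
  generate, and the dimension is at most the sum of the dimensions over \<open>S\<close>. Only the
  existence of such arrows matters here. This is why essential finiteness is replaced by two weaker
  properties, finitely many objects up to retracts and finite hom sets: the first passes directly
  from \<open>X\<close> and \<open>X'\<close> to the weak pullback once hom sets of
  \<open>A2\<close> are finite.\<close>

context category
begin

lemma cmp_hom:
  "\<lbrakk>in_hom C f x y; in_hom C g y z\<rbrakk> \<Longrightarrow> in_hom C (Cmp C g f) x z"
  by (auto simp: in_hom_def cmp_in dom_cmp cod_cmp)

lemma ide_hom: "x \<in> Obj C \<Longrightarrow> in_hom C (Ide C x) x x"
  by (auto simp: in_hom_def ide_in dom_ide cod_ide)

lemma hom_obj: "in_hom C f x y \<Longrightarrow> x \<in> Obj C \<and> y \<in> Obj C"
  by (auto simp: in_hom_def dom_in cod_in)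

lemma arr_hom: "f \<in> Arr C \<Longrightarrow> in_hom C f (Dom C f) (Cod C f)"
  by (simp add: in_hom_def)

text \<open>With \<open>in_hom\<close>, composability is settled by matching endpoints of typed
  arrows instead of computing \<open>Dom\<close> and \<open>Cod\<close>; the later diagram chases
  run on this form.\<close>

lemma assoc_hom:
  "\<lbrakk>in_hom C f w x; in_hom C g x y; in_hom C h y z\<rbrakk>
    \<Longrightarrow> Cmp C h (Cmp C g f) = Cmp C (Cmp C h g) f"
  by (auto simp: in_hom_def cmp_assoc)

lemma ide_left_hom: "in_hom C f x y \<Longrightarrow> Cmp C (Ide C y) f = f"
  and ide_right_hom: "in_hom C f x y \<Longrightarrow> Cmp C f (Ide C x) = f"
  by (auto simp: in_hom_def cmp_ide_left cmp_ide_right)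

lemma is_isoI:
  "\<lbrakk>in_hom C f x y; in_hom C g y x; Cmp C g f = Ide C x; Cmp C f g = Ide C y\<rbrakk> \<Longrightarrow> is_iso C f"
  by (auto simp: is_iso_def in_hom_def)

lemma is_isoE:
  assumes "is_iso C f" "in_hom C f x y"
  obtains g where "in_hom C g y x" "Cmp C g f = Ide C x" "Cmp C f g = Ide C y"
  using assms by (auto simp: is_iso_def in_hom_def)

end

context cat_functor
begin

lemma farr_hom: "in_hom C f x y \<Longrightarrow> in_hom D (FArr F f) (FObj F x) (FObj F y)"
  by (auto simp: in_hom_def farr_in dom_farr cod_farr)

lemma farr_cmp_hom:
  "\<lbrakk>in_hom C f x y; in_hom C g y z\<rbrakk> \<Longrightarrow> FArr F (Cmp C g f) = Cmp D (FArr F g) (FArr F f)"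
  by (auto simp: in_hom_def farr_cmp)

end

lemma (in nat_trans) naturality_hom:
  "in_hom C f x y \<Longrightarrow> Cmp D (\<tau> y) (FArr F f) = Cmp D (FArr G f) (\<tau> x)"
  using naturality by (auto simp: in_hom_def)

lemma cat_functorI:
  assumes "category C" "category D"
    and "\<And>x. x \<in> Obj C \<Longrightarrow> FObj F x \<in> Obj D"
    and "\<And>f x y. in_hom C f x y \<Longrightarrow> in_hom D (FArr F f) (FObj F x) (FObj F y)"
    and "\<And>x. x \<in> Obj C \<Longrightarrow> FArr F (Ide C x) = Ide D (FObj F x)"
    and "\<And>f g x y z. \<lbrakk>in_hom C f x y; in_hom C g y z\<rbrakk>
      \<Longrightarrow> FArr F (Cmp C g f) = Cmp D (FArr F g) (FArr F f)"
  shows "cat_functor C D F"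
  using assms by (simp add: cat_functor_def cat_functor_axioms_def in_hom_def)

lemma functor_comp_sel [simp]:
  "FObj (functor_comp G F) x = FObj G (FObj F x)"
  "FArr (functor_comp G F) f = FArr G (FArr F f)"
  by (simp_all add: functor_comp_def)

lemma cat_functor_comp:
  assumes "cat_functor C D F" "cat_functor D E G"
  shows "cat_functor C E (functor_comp G F)"
proof -
  interpret F: cat_functor C D F by fact
  interpret G: cat_functor D E G by fact
  show ?thesis
    by unfold_locales
      (simp_all add: F.fobj_in F.farr_in F.dom_farr F.cod_farr F.farr_ide F.farr_cmp
        G.fobj_in G.farr_in G.dom_farr G.cod_farr G.farr_ide G.farr_cmp)
qed

text \<open>Functoriality only tests values on objects and arrows of \<open>C\<close>, so altering a
  record elsewhere is harmless. This covers the \<open>restrict\<close> in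
  \<open>precomp\<close>.\<close>

lemma cat_functor_cong:
  assumes "cat_functor C D F"
    and "\<And>x. x \<in> Obj C \<Longrightarrow> FObj F' x = FObj F x"
    and "\<And>f. f \<in> Arr C \<Longrightarrow> FArr F' f = FArr F f"
  shows "cat_functor C D F'"
proof -
  interpret F: cat_functor C D F by fact
  show ?thesis
    by unfold_locales
      (simp_all add: assms(2,3) F.fobj_in F.farr_in F.dom_farr F.cod_farr F.farr_ide F.farr_cmp
        F.C.dom_in F.C.cod_in F.C.ide_in F.C.cmp_in)
qed

section \<open>Functor categories\<close>

lemma functor_category_obj:
  "F \<in> Obj (functor_category C D) \<longleftrightarrow>
    cat_functor C D F \<and> FObj F \<in> extensional (Obj C) \<and> FArr F \<in> extensional (Arr C)"
  by (simp add: functor_category_def)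

lemma functor_category_hom:
  "in_hom (functor_category C D) m F G \<longleftrightarrow>
    (\<exists>\<tau>. m = (F, \<tau>, G) \<and> F \<in> Obj (functor_category C D) \<and> G \<in> Obj (functor_category C D) \<and>
      nat_trans C D F G \<tau> \<and> \<tau> \<in> extensional (Obj C))"
  by (auto simp: functor_category_def in_hom_def)

lemma functor_category_arr:
  "m \<in> Arr (functor_category C D) \<longleftrightarrow>
    (\<exists>F \<tau> G. m = (F, \<tau>, G) \<and> F \<in> Obj (functor_category C D) \<and> G \<in> Obj (functor_category C D) \<and>
      nat_trans C D F G \<tau> \<and> \<tau> \<in> extensional (Obj C))"
  by (auto simp: functor_category_def)

lemma functor_category_sel [simp]:
  "Dom (functor_category C D) (F, \<tau>, G) = F"
  "Cod (functor_category C D) (F, \<tau>, G) = G"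
  "Ide (functor_category C D) F = (F, \<lambda>x\<in>Obj C. Ide D (FObj F x), F)"
  "Cmp (functor_category C D) (G', \<sigma>, H) (F, \<tau>, G) = (F, \<lambda>x\<in>Obj C. Cmp D (\<sigma> x) (\<tau> x), H)"
  by (simp_all add: functor_category_def)

lemma nat_transI:
  assumes "cat_functor C D F" "cat_functor C D G"
    and "\<And>x. x \<in> Obj C \<Longrightarrow> in_hom D (\<tau> x) (FObj F x) (FObj G x)"
    and "\<And>f x y. in_hom C f x y \<Longrightarrow> Cmp D (\<tau> y) (FArr F f) = Cmp D (FArr G f) (\<tau> x)"
  shows "nat_trans C D F G \<tau>"
  using assms by (simp add: nat_trans_def nat_trans_axioms_def in_hom_def)

lemma nat_trans_ide:
  assumes "cat_functor C D F"
  shows "nat_trans C D F F (\<lambda>x\<in>Obj C. Ide D (FObj F x))"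
proof -
  interpret F: cat_functor C D F by fact
  show ?thesis
  proof (rule nat_transI[OF assms assms])
    fix f x y assume f: "in_hom C f x y"
    then show "Cmp D ((\<lambda>x\<in>Obj C. Ide D (FObj F x)) y) (FArr F f)
        = Cmp D (FArr F f) ((\<lambda>x\<in>Obj C. Ide D (FObj F x)) x)"
      using F.C.hom_obj[OF f] F.D.ide_left_hom[OF F.farr_hom[OF f]]
        F.D.ide_right_hom[OF F.farr_hom[OF f]] by simp
  qed (simp add: F.D.ide_hom F.fobj_in)
qed

lemma nat_trans_cmp:
  assumes "nat_trans C D F G \<tau>" "nat_trans C D G H \<sigma>"
  shows "nat_trans C D F H (\<lambda>x\<in>Obj C. Cmp D (\<sigma> x) (\<tau> x))"
proof -
  interpret t: nat_trans C D F G \<tau> by fact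
  interpret s: nat_trans C D G H \<sigma> by fact
  show ?thesis
  proof (rule nat_transI)
    show "cat_functor C D F" "cat_functor C D H" by unfold_locales
    fix f x y assume f: "in_hom C f x y"
    note xy = t.F.C.hom_obj[OF f]
    have "Cmp D (Cmp D (\<sigma> y) (\<tau> y)) (FArr F f) = Cmp D (\<sigma> y) (Cmp D (\<tau> y) (FArr F f))"
      using xy by (metis t.component s.component t.F.D.assoc_hom t.F.farr_hom f)
    also have "\<dots> = Cmp D (\<sigma> y) (Cmp D (FArr G f) (\<tau> x))"
      by (simp add: t.naturality_hom[OF f])
    also have "\<dots> = Cmp D (Cmp D (\<sigma> y) (FArr G f)) (\<tau> x)"
      using xy by (metis t.component s.component t.F.D.assoc_hom t.G.farr_hom f)
    also have "\<dots> = Cmp D (Cmp D (FArr H f) (\<sigma> x)) (\<tau> x)"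
      by (simp add: s.naturality_hom[OF f])
    also have "\<dots> = Cmp D (FArr H f) (Cmp D (\<sigma> x) (\<tau> x))"
      using xy by (metis t.component s.component t.F.D.assoc_hom s.G.farr_hom f)
    finally show "Cmp D ((\<lambda>x\<in>Obj C. Cmp D (\<sigma> x) (\<tau> x)) y) (FArr F f)
        = Cmp D (FArr H f) ((\<lambda>x\<in>Obj C. Cmp D (\<sigma> x) (\<tau> x)) x)"
      using xy by simp
  next
    fix x assume "x \<in> Obj C"
    then show "in_hom D ((\<lambda>x\<in>Obj C. Cmp D (\<sigma> x) (\<tau> x)) x) (FObj F x) (FObj H x)"
      using t.F.D.cmp_hom[OF t.component s.component] by simp
  qed
qed

lemma category_functor_category:
  assumes "category D"
  shows "category (functor_category C D)"
proof -
  interpret D: category D by fact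
  show ?thesis
  proof
    fix f assume "f \<in> Arr (functor_category C D)"
    then obtain F \<tau> G where f: "f = (F, \<tau>, G)" and tau: "nat_trans C D F G \<tau>" "\<tau> \<in> extensional (Obj C)"
      and FG: "F \<in> Obj (functor_category C D)" "G \<in> Obj (functor_category C D)"
      by (auto simp: functor_category_arr)
    interpret nat_trans C D F G \<tau> by fact
    show "Dom (functor_category C D) f \<in> Obj (functor_category C D)"
      "Cod (functor_category C D) f \<in> Obj (functor_category C D)"
      using FG by (simp_all add: f)
    \<comment> \<open>Composition restricts components to \<open>Obj C\<close>, so the unit laws are
      equalities only because \<open>\<tau>\<close> is extensional.\<close>
    show "Cmp (functor_category C D) (Ide (functor_category C D) (Cod (functor_category C D) f)) f = f"
      using tau(2) by (auto simp: f fun_eq_iff extensional_def intro!: D.ide_left_hom component)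
    show "Cmp (functor_category C D) f (Ide (functor_category C D) (Dom (functor_category C D) f)) = f"
      using tau(2) by (auto simp: f fun_eq_iff extensional_def intro!: D.ide_right_hom component)
  next
    fix F assume "F \<in> Obj (functor_category C D)"
    then show "Ide (functor_category C D) F \<in> Arr (functor_category C D)"
      "Dom (functor_category C D) (Ide (functor_category C D) F) = F"
      "Cod (functor_category C D) (Ide (functor_category C D) F) = F"
      by (auto simp: functor_category_arr functor_category_obj nat_trans_ide)
  next
    fix f g
    assume "f \<in> Arr (functor_category C D)" "g \<in> Arr (functor_category C D)"
      "Cod (functor_category C D) f = Dom (functor_category C D) g"
    then show "Cmp (functor_category C D) g f \<in> Arr (functor_category C D)"
      "Dom (functor_category C D) (Cmp (functor_category C D) g f) = Dom (functor_category C D) f"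
      "Cod (functor_category C D) (Cmp (functor_category C D) g f) = Cod (functor_category C D) g"
      by (auto simp: functor_category_arr nat_trans_cmp)
  next
    fix f g h
    assume "f \<in> Arr (functor_category C D)" "g \<in> Arr (functor_category C D)" "h \<in> Arr (functor_category C D)"
      "Cod (functor_category C D) f = Dom (functor_category C D) g"
      "Cod (functor_category C D) g = Dom (functor_category C D) h"
    then show "Cmp (functor_category C D) h (Cmp (functor_category C D) g f) =
       Cmp (functor_category C D) (Cmp (functor_category C D) h g) f"
      by (auto simp: functor_category_arr fun_eq_iff intro!: D.assoc_hom nat_trans.component)
  qed
qed

text \<open>Pointwise inverses are automatically natural: insert \<open>\<tau> x\<close> after
  \<open>\<sigma> x\<close> at the source, move \<open>\<tau>\<close> across by its own naturality,
  and cancel it against \<open>\<sigma> y\<close>.\<close>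

lemma functor_category_iso:
  assumes tau: "in_hom (functor_category C D) (F, \<tau>, G) F G"
    and iso: "\<And>x. x \<in> Obj C \<Longrightarrow> is_iso D (\<tau> x)"
  shows "is_iso (functor_category C D) (F, \<tau>, G)"
proof -
  from tau have FG: "F \<in> Obj (functor_category C D)" "G \<in> Obj (functor_category C D)"
    and nt: "nat_trans C D F G \<tau>" by (auto simp: functor_category_hom)
  interpret nat_trans C D F G \<tau> by fact
  have "\<exists>g. in_hom D g (FObj G x) (FObj F x) \<and> Cmp D g (\<tau> x) = Ide D (FObj F x) \<and>
      Cmp D (\<tau> x) g = Ide D (FObj G x)" if "x \<in> Obj C" for x
    using F.D.is_isoE[OF iso component] that by metis
  then obtain \<sigma>0 where \<sigma>0: "\<And>x. x \<in> Obj C \<Longrightarrow> in_hom D (\<sigma>0 x) (FObj G x) (FObj F x) \<and>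
      Cmp D (\<sigma>0 x) (\<tau> x) = Ide D (FObj F x) \<and> Cmp D (\<tau> x) (\<sigma>0 x) = Ide D (FObj G x)"
    by metis
  \<comment> \<open>Choice says nothing outside \<open>Obj C\<close>; the restriction makes the
    family an arrow of the functor category.\<close>
  define \<sigma> where "\<sigma> = restrict \<sigma>0 (Obj C)"
  have \<sigma>: "in_hom D (\<sigma> x) (FObj G x) (FObj F x)" "Cmp D (\<sigma> x) (\<tau> x) = Ide D (FObj F x)"
    "Cmp D (\<tau> x) (\<sigma> x) = Ide D (FObj G x)" if "x \<in> Obj C" for x
    using \<sigma>0 that by (auto simp: \<sigma>_def)
  interpret FC: category "functor_category C D"
    by (rule category_functor_category) unfold_locales
  have "nat_trans C D G F \<sigma>"
  proof (rule nat_transI)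
    show "cat_functor C D F" "cat_functor C D G" by unfold_locales
    fix f x y assume f: "in_hom C f x y"
    have xy: "x \<in> Obj C" "y \<in> Obj C" using F.C.hom_obj[OF f] by auto
    note hs = \<sigma>(1)[OF xy(1)] \<sigma>(1)[OF xy(2)] component[OF xy(1)] component[OF xy(2)]
      F.farr_hom[OF f] G.farr_hom[OF f]
    have "Cmp D (\<sigma> y) (FArr G f) = Cmp D (\<sigma> y) (Cmp D (FArr G f) (Cmp D (\<tau> x) (\<sigma> x)))"
      using \<sigma>(3)[OF xy(1)] F.D.ide_right_hom[OF hs(6)] by simp
    also have "\<dots> = Cmp D (\<sigma> y) (Cmp D (Cmp D (FArr G f) (\<tau> x)) (\<sigma> x))"
      using F.D.assoc_hom hs by metis
    also have "\<dots> = Cmp D (\<sigma> y) (Cmp D (Cmp D (\<tau> y) (FArr F f)) (\<sigma> x))"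
      using naturality_hom[OF f] by simp
    also have "\<dots> = Cmp D (\<sigma> y) (Cmp D (\<tau> y) (Cmp D (FArr F f) (\<sigma> x)))"
      using F.D.assoc_hom hs by metis
    also have "\<dots> = Cmp D (Cmp D (\<sigma> y) (\<tau> y)) (Cmp D (FArr F f) (\<sigma> x))"
      using F.D.assoc_hom[OF F.D.cmp_hom[OF hs(1,5)] hs(4,2)] .
    also have "\<dots> = Cmp D (FArr F f) (\<sigma> x)"
      using \<sigma>(2)[OF xy(2)] F.D.ide_left_hom[OF F.D.cmp_hom[OF hs(1,5)]] by simp
    finally show "Cmp D (\<sigma> y) (FArr G f) = Cmp D (FArr F f) (\<sigma> x)" .
  qed (fact \<sigma>)
  then have inv: "in_hom (functor_category C D) (G, \<sigma>, F) G F"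
    using FG by (simp add: functor_category_hom \<sigma>_def)
  show ?thesis
    by (rule FC.is_isoI[OF tau inv]) (simp_all add: \<sigma> cong: restrict_cong)
qed

section \<open>Colimits\<close>

lemma is_coconeI:
  assumes "cat_functor J D G" "L \<in> Obj D"
    and "\<And>j. j \<in> Obj J \<Longrightarrow> in_hom D (\<iota> j) (FObj G j) L"
    and "\<And>m i j. in_hom J m i j \<Longrightarrow> Cmp D (\<iota> j) (FArr G m) = \<iota> i"
  shows "is_cocone J D G L \<iota>"
  using assms by (auto simp: is_cocone_def in_hom_def)

lemma is_coconeD:
  assumes "is_cocone J D G L \<iota>"
  shows "cat_functor J D G" "L \<in> Obj D"
    and "\<And>j. j \<in> Obj J \<Longrightarrow> in_hom D (\<iota> j) (FObj G j) L"
    and "\<And>m i j. in_hom J m i j \<Longrightarrow> Cmp D (\<iota> j) (FArr G m) = \<iota> i"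
  using assms by (auto simp: is_cocone_def in_hom_def)

lemma cocone_cmp:
  assumes c: "is_cocone J D G L \<iota>" and u: "in_hom D u L M"
  shows "is_cocone J D G M (\<lambda>j. Cmp D u (\<iota> j))"
proof -
  note cd = is_coconeD[OF c]
  interpret G: cat_functor J D G by (fact cd)
  show ?thesis
  proof (rule is_coconeI)
    show "cat_functor J D G" "M \<in> Obj D" using G.D.hom_obj[OF u] by (auto simp: cd)
    fix m i j assume m: "in_hom J m i j"
    then have "j \<in> Obj J" by (simp add: G.C.hom_obj)
    then have "Cmp D (Cmp D u (\<iota> j)) (FArr G m) = Cmp D u (Cmp D (\<iota> j) (FArr G m))"
      using G.D.assoc_hom[OF G.farr_hom[OF m] cd(3) u] by simp
    then show "Cmp D (Cmp D u (\<iota> j)) (FArr G m) = Cmp D u (\<iota> i)"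
      by (simp add: cd(4)[OF m])
  qed (use G.D.cmp_hom[OF cd(3) u] in auto)
qed

text \<open>The legs of a colimit are jointly epimorphic: both arrows mediate to the same cocone,
  that of the composites with \<open>v\<close>.\<close>

lemma colimit_ext:
  assumes "is_colimit J D G L \<iota>" "in_hom D u L M" "in_hom D v L M"
    and "\<And>j. j \<in> Obj J \<Longrightarrow> Cmp D u (\<iota> j) = Cmp D v (\<iota> j)"
  shows "u = v"
proof -
  have "is_cocone J D G M (\<lambda>j. Cmp D v (\<iota> j))"
    using assms cocone_cmp by (auto simp: is_colimit_def)
  then have "\<exists>!w. is_mediating J D L \<iota> M (\<lambda>j. Cmp D v (\<iota> j)) w"
    using assms(1) by (auto simp: is_colimit_def)
  moreover have "is_mediating J D L \<iota> M (\<lambda>j. Cmp D v (\<iota> j)) u"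
    "is_mediating J D L \<iota> M (\<lambda>j. Cmp D v (\<iota> j)) v"
    using assms(2-4) by (simp_all add: is_mediating_def)
  ultimately show ?thesis by blast
qed

text \<open>The inverse is the mediating arrow in the other direction; both composites fix all legs,
  hence are identities by joint epimorphy.\<close>

lemma colimit_mediating_iso:
  assumes L: "is_colimit J D G L \<iota>" and M: "is_colimit J D G M \<kappa>"
    and u: "is_mediating J D L \<iota> M \<kappa> u"
  shows "is_iso D u"
proof -
  have LC: "is_cocone J D G L \<iota>" and MC: "is_cocone J D G M \<kappa>"
    using L M by (auto simp: is_colimit_def)
  interpret G: cat_functor J D G using is_coconeD(1)[OF LC] .
  obtain v where v: "is_mediating J D M \<kappa> L \<iota> v"
    using M LC unfolding is_colimit_def by blast
  have uh: "in_hom D u L M" and vh: "in_hom D v M L"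
    and ul: "\<And>j. j \<in> Obj J \<Longrightarrow> Cmp D u (\<iota> j) = \<kappa> j"
    and vl: "\<And>j. j \<in> Obj J \<Longrightarrow> Cmp D v (\<kappa> j) = \<iota> j"
    using u v by (auto simp: is_mediating_def)
  have legs: "in_hom D (\<iota> j) (FObj G j) L" "in_hom D (\<kappa> j) (FObj G j) M" if "j \<in> Obj J" for j
    by (rule is_coconeD(3)[OF LC that], rule is_coconeD(3)[OF MC that])
  have "Cmp D v u = Ide D L"
  proof (rule colimit_ext[OF L])
    fix j assume j: "j \<in> Obj J"
    show "Cmp D (Cmp D v u) (\<iota> j) = Cmp D (Ide D L) (\<iota> j)"
      using G.D.assoc_hom[OF legs(1)[OF j] uh vh] G.D.ide_left_hom[OF legs(1)[OF j]] ul vl j by simp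
  qed (use G.D.cmp_hom[OF uh vh] G.D.hom_obj[OF uh] G.D.ide_hom in auto)
  moreover have "Cmp D u v = Ide D M"
  proof (rule colimit_ext[OF M])
    fix j assume j: "j \<in> Obj J"
    show "Cmp D (Cmp D u v) (\<kappa> j) = Cmp D (Ide D M) (\<kappa> j)"
      using G.D.assoc_hom[OF legs(2)[OF j] vh uh] G.D.ide_left_hom[OF legs(2)[OF j]] ul vl j by simp
  qed (use G.D.cmp_hom[OF vh uh] G.D.hom_obj[OF uh] G.D.ide_hom in auto)
  ultimately show ?thesis by (rule G.D.is_isoI[OF uh vh])
qed

text \<open>\<open>colim\<close> is an arbitrary value unless some colimit exists, which is why
  existence is carried as a premise from here on.\<close>

lemma is_colimit_colim:
  assumes "\<exists>L \<iota>. is_colimit J D G L \<iota>"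
  shows "is_colimit J D G (colim_obj J D G) (colim_leg J D G)"
proof -
  have "\<exists>p. case p of (L, \<iota>) \<Rightarrow> is_colimit J D G L \<iota>" using assms by auto
  from someI_ex[OF this] show ?thesis
    by (simp add: colim_def colim_obj_def colim_leg_def split: prod.splits)
qed

lemma is_mediating_colim_map:
  assumes "\<exists>L \<iota>. is_colimit J D G L \<iota>" "is_cocone J D G M \<kappa>"
  shows "is_mediating J D (colim_obj J D G) (colim_leg J D G) M \<kappa> (colim_map J D G M \<kappa>)"
  unfolding colim_map_def
  by (rule theI') (use is_colimit_colim[OF assms(1)] assms(2) in \<open>simp add: is_colimit_def\<close>)

section \<open>Restriction along a functor\<close>

lemma precomp_sel [simp]:
  "x \<in> Obj B \<Longrightarrow> FObj (precomp B f F) x = FObj F (FObj f x)"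
  "m \<in> Arr B \<Longrightarrow> FArr (precomp B f F) m = FArr F (FArr f m)"
  by (simp_all add: precomp_def)

lemma precomp_functor:
  assumes "cat_functor B A f" "cat_functor A D F"
  shows "cat_functor B D (precomp B f F)"
  by (rule cat_functor_cong[OF cat_functor_comp[OF assms]]) simp_all

lemma precomp_obj:
  assumes "cat_functor B A f" "F \<in> Obj (functor_category A D)"
  shows "precomp B f F \<in> Obj (functor_category B D)"
  using assms precomp_functor[of B A f D F]
  by (auto simp: functor_category_obj precomp_def)

lemma precomp_nat_trans:
  assumes f: "cat_functor B A f" and t: "nat_trans A D F G \<tau>"
  shows "nat_trans B D (precomp B f F) (precomp B f G) (\<lambda>b\<in>Obj B. \<tau> (FObj f b))"
proof -
  interpret f: cat_functor B A f by fact
  interpret t: nat_trans A D F G \<tau> by fact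
  show ?thesis
  proof (rule nat_transI)
    show "cat_functor B D (precomp B f F)" "cat_functor B D (precomp B f G)"
      by (intro precomp_functor[OF f] t.F.cat_functor_axioms t.G.cat_functor_axioms)+
    fix m x y assume m: "in_hom B m x y"
    then have "m \<in> Arr B" "x \<in> Obj B" "y \<in> Obj B" by (auto simp: in_hom_def f.C.dom_in f.C.cod_in)
    then show "Cmp D ((\<lambda>b\<in>Obj B. \<tau> (FObj f b)) y) (FArr (precomp B f F) m) =
        Cmp D (FArr (precomp B f G) m) ((\<lambda>b\<in>Obj B. \<tau> (FObj f b)) x)"
      using t.naturality_hom[OF f.farr_hom[OF m]] by simp
  qed (simp add: t.component f.fobj_in)
qed

lemma pullback_functor_sel [simp]:
  "FObj (pullback_functor B f) F = precomp B f F"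
  "FArr (pullback_functor B f) (F, \<tau>, G) = (precomp B f F, \<lambda>b\<in>Obj B. \<tau> (FObj f b), precomp B f G)"
  by (simp_all add: pullback_functor_def)

lemma pullback_functor_functor:
  assumes f: "cat_functor B A f" and D: "category D"
  shows "cat_functor (functor_category A D) (functor_category B D) (pullback_functor B f)"
proof -
  interpret f: cat_functor B A f by fact
  show ?thesis
  proof (rule cat_functorI)
    show "category (functor_category A D)" "category (functor_category B D)"
      by (rule category_functor_category[OF D])+
    fix F assume "F \<in> Obj (functor_category A D)"
    then show "FObj (pullback_functor B f) F \<in> Obj (functor_category B D)"
      by (simp add: precomp_obj[OF f])
    show "FArr (pullback_functor B f) (Ide (functor_category A D) F) =
       Ide (functor_category B D) (FObj (pullback_functor B f) F)"
      by (auto simp: f.fobj_in fun_eq_iff)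
  next
    fix m F G assume "in_hom (functor_category A D) m F G"
    then show "in_hom (functor_category B D) (FArr (pullback_functor B f) m)
        (FObj (pullback_functor B f) F) (FObj (pullback_functor B f) G)"
      by (auto simp: functor_category_hom precomp_obj[OF f] precomp_nat_trans[OF f])
  next
    fix m m' F G H
    assume "in_hom (functor_category A D) m F G" "in_hom (functor_category A D) m' G H"
    then show "FArr (pullback_functor B f) (Cmp (functor_category A D) m' m) =
       Cmp (functor_category B D) (FArr (pullback_functor B f) m') (FArr (pullback_functor B f) m)"
      by (auto simp: functor_category_hom f.fobj_in fun_eq_iff)
  qed
qed

section \<open>Comma categories\<close>

lemma comma_category_obj [simp]:
  "(b, g) \<in> Obj (comma_category B A f a) \<longleftrightarrow> b \<in> Obj B \<and> in_hom A g (FObj f b) a"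
  by (simp add: comma_category_def comma_obj_def)

lemma comma_category_hom:
  "in_hom (comma_category B A f a) m (b, g) (b', g') \<longleftrightarrow>
    (\<exists>h. m = ((b, g), h, (b', g')) \<and> in_hom A g (FObj f b) a \<and> in_hom A g' (FObj f b') a \<and>
      b \<in> Obj B \<and> b' \<in> Obj B \<and> in_hom B h b b' \<and> Cmp A g' (FArr f h) = g)"
  by (auto simp: comma_category_def comma_obj_def in_hom_def)

lemma comma_category_arr:
  "((b, g), h, (b', g')) \<in> Arr (comma_category B A f a) \<longleftrightarrow>
    in_hom A g (FObj f b) a \<and> in_hom A g' (FObj f b') a \<and>
    b \<in> Obj B \<and> b' \<in> Obj B \<and> in_hom B h b b' \<and> Cmp A g' (FArr f h) = g"
  by (auto simp: comma_category_def comma_obj_def)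

lemma comma_category_sel [simp]:
  "Dom (comma_category B A f a) (p, h, q) = p"
  "Cod (comma_category B A f a) (p, h, q) = q"
  "Ide (comma_category B A f a) (b, g) = ((b, g), Ide B b, (b, g))"
  "Cmp (comma_category B A f a) (q', h', r) (p, h, q) = (p, Cmp B h' h, r)"
  by (simp_all add: comma_category_def)

lemma category_comma_category:
  assumes "cat_functor B A f"
  shows "category (comma_category B A f a)"
proof -
  interpret f: cat_functor B A f by fact
  let ?K = "comma_category B A f a"
  show ?thesis
  proof
    fix m assume "m \<in> Arr ?K"
    moreover obtain b1 g1 h b2 g2 where m: "m = ((b1, g1), h, (b2, g2))" by (metis surj_pair)
    ultimately have h: "in_hom B h b1 b2"
      and g: "in_hom A g1 (FObj f b1) a" "in_hom A g2 (FObj f b2) a" "b1 \<in> Obj B" "b2 \<in> Obj B"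
      by (simp_all add: comma_category_arr)
    show "Dom ?K m \<in> Obj ?K" "Cod ?K m \<in> Obj ?K" using g by (simp_all add: m)
    show "Cmp ?K (Ide ?K (Cod ?K m)) m = m" by (simp add: m f.C.ide_left_hom[OF h])
    show "Cmp ?K m (Ide ?K (Dom ?K m)) = m" by (simp add: m f.C.ide_right_hom[OF h])
  next
    fix x assume "x \<in> Obj ?K"
    then obtain b g where x: "x = (b, g)" and b: "b \<in> Obj B" "in_hom A g (FObj f b) a"
      by (cases x) simp
    show "Ide ?K x \<in> Arr ?K"
      using b by (simp add: x comma_category_arr f.C.ide_hom f.farr_ide f.D.ide_right_hom[OF b(2)])
    show "Dom ?K (Ide ?K x) = x" "Cod ?K (Ide ?K x) = x" by (simp_all add: x)
  next
    fix m n assume "m \<in> Arr ?K" "n \<in> Arr ?K" "Cod ?K m = Dom ?K n"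
    moreover from this obtain b1 g1 h b2 g2 k b3 g3 where *: "m = ((b1, g1), h, (b2, g2))" "n = ((b2, g2), k, (b3, g3))"
      by (metis surj_pair comma_category_sel(1,2))
    ultimately have h: "in_hom A g1 (FObj f b1) a" "in_hom A g3 (FObj f b3) a" "b1 \<in> Obj B" "b3 \<in> Obj B"
        "in_hom B h b1 b2" "in_hom B k b2 b3" "Cmp A g2 (FArr f h) = g1" "Cmp A g3 (FArr f k) = g2"
      by (simp_all add: comma_category_arr)
    have "Cmp A g3 (FArr f (Cmp B k h)) = g1"
      using f.D.assoc_hom[OF f.farr_hom[OF h(5)] f.farr_hom[OF h(6)] h(2)] h(7,8)
      by (simp add: f.farr_cmp_hom[OF h(5,6)])
    then show "Cmp ?K n m \<in> Arr ?K"
      using h(1-4) f.C.cmp_hom[OF h(5,6)] by (simp add: * comma_category_arr)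
    show "Dom ?K (Cmp ?K n m) = Dom ?K m" "Cod ?K (Cmp ?K n m) = Cod ?K n"
      by (simp_all add: *)
  next
    fix m n l assume "m \<in> Arr ?K" "n \<in> Arr ?K" "l \<in> Arr ?K" "Cod ?K m = Dom ?K n" "Cod ?K n = Dom ?K l"
    moreover from this obtain b1 g1 h b2 g2 k b3 g3 j b4 g4 where
      *: "m = ((b1, g1), h, (b2, g2))" "n = ((b2, g2), k, (b3, g3))" "l = ((b3, g3), j, (b4, g4))"
      by (metis surj_pair comma_category_sel(1,2))
    ultimately have "in_hom B h b1 b2" "in_hom B k b2 b3" "in_hom B j b3 b4"
      by (simp_all add: comma_category_arr)
    with * show "Cmp ?K l (Cmp ?K n m) = Cmp ?K (Cmp ?K l n) m"
      using f.C.assoc_hom by simp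
  qed
qed

lemma comma_proj_sel [simp]:
  "FObj comma_proj (b, g) = b" "FArr comma_proj (p, h, q) = h"
  by (simp_all add: comma_proj_def)

lemma comma_proj_functor:
  assumes "cat_functor B A f"
  shows "cat_functor (comma_category B A f a) B comma_proj"
proof -
  interpret f: cat_functor B A f by fact
  interpret K: category "comma_category B A f a" by (rule category_comma_category[OF assms])
  show ?thesis
    by unfold_locales (clarsimp simp: comma_category_arr in_hom_def)+
qed

section \<open>Pushforward along a functor\<close>

text \<open>Isolates what pushforward needs from the target category. \<open>Vect\<close> and
  finiteness enter only when the locale is instantiated.\<close>

locale pushforward = f: cat_functor B A f + D: category D
  for B :: "('u, 'v) category" and A :: "('o, 'm) category" and f and D :: "('p, 'n) category" +
  assumes colimits: "\<lbrakk>cat_functor B D G; a \<in> Obj A\<rbrakk>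
    \<Longrightarrow> \<exists>L \<iota>. is_colimit (comma_category B A f a) D (functor_comp G comma_proj) L \<iota>"
begin

abbreviation colim_at where
  "colim_at G a \<equiv> colim_obj (comma_category B A f a) D (functor_comp G comma_proj)"

abbreviation leg where
  "leg G a b g \<equiv> colim_leg (comma_category B A f a) D (functor_comp G comma_proj) (b, g)"

abbreviation push where "push G \<equiv> pushforward_obj B A D f G"

lemma is_colimit_at:
  assumes "cat_functor B D G" "a \<in> Obj A"
  shows "is_colimit (comma_category B A f a) D (functor_comp G comma_proj) (colim_at G a)
    (colim_leg (comma_category B A f a) D (functor_comp G comma_proj))"
  by (rule is_colimit_colim[OF colimits[OF assms]])

text \<open>\<open>leg_cmp\<close> is the cocone law without arrows of the comma category: an arrow
  into \<open>(b', g')\<close> is determined by \<open>h\<close>, since its source must carry the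
  composite of \<open>g'\<close> with the image of \<open>h\<close>. \<open>comma_coconeI\<close>
  below is the converse translation.\<close>

lemma
  assumes "cat_functor B D G" "a \<in> Obj A"
  shows colim_at_obj: "colim_at G a \<in> Obj D"
    and leg_hom: "\<lbrakk>b \<in> Obj B; in_hom A g (FObj f b) a\<rbrakk> \<Longrightarrow> in_hom D (leg G a b g) (FObj G b) (colim_at G a)"
    and leg_cmp: "\<lbrakk>in_hom B h b b'; in_hom A g' (FObj f b') a\<rbrakk> \<Longrightarrow>
      Cmp D (leg G a b' g') (FArr G h) = leg G a b (Cmp A g' (FArr f h))"
proof -
  note c = is_coconeD[OF is_colimit_at[OF assms, unfolded is_colimit_def, THEN conjunct1]]
  show "colim_at G a \<in> Obj D" by fact
  show "in_hom D (leg G a b g) (FObj G b) (colim_at G a)"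
    if "b \<in> Obj B" "in_hom A g (FObj f b) a" using c(3)[of "(b, g)"] that by simp
  assume h: "in_hom B h b b'" and g': "in_hom A g' (FObj f b') a"
  have "in_hom (comma_category B A f a) ((b, Cmp A g' (FArr f h)), h, (b', g'))
      (b, Cmp A g' (FArr f h)) (b', g')"
    using h g' f.D.cmp_hom[OF f.farr_hom[OF h] g'] f.C.hom_obj[OF h] by (simp add: comma_category_hom)
  from c(4)[OF this] show "Cmp D (leg G a b' g') (FArr G h) = leg G a b (Cmp A g' (FArr f h))"
    by simp
qed

lemma colim_at_ext:
  assumes "cat_functor B D G" "a \<in> Obj A"
    and "in_hom D u (colim_at G a) M" "in_hom D v (colim_at G a) M"
    and "\<And>b g. \<lbrakk>b \<in> Obj B; in_hom A g (FObj f b) a\<rbrakk> \<Longrightarrow> Cmp D u (leg G a b g) = Cmp D v (leg G a b g)"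
  shows "u = v"
proof (rule colimit_ext[OF is_colimit_at[OF assms(1,2)] assms(3,4)])
  fix j assume "j \<in> Obj (comma_category B A f a)"
  then show "Cmp D u (colim_leg (comma_category B A f a) D (functor_comp G comma_proj) j) =
    Cmp D v (colim_leg (comma_category B A f a) D (functor_comp G comma_proj) j)"
    by (cases j) (simp add: assms(5))
qed

lemma comma_coconeI:
  assumes G: "cat_functor B D G" and "M \<in> Obj D"
    and hom: "\<And>b g. \<lbrakk>b \<in> Obj B; in_hom A g (FObj f b) a\<rbrakk> \<Longrightarrow> in_hom D (\<kappa> (b, g)) (FObj G b) M"
    and cmp: "\<And>b b' h g'. \<lbrakk>in_hom B h b b'; in_hom A g' (FObj f b') a\<rbrakk>
      \<Longrightarrow> Cmp D (\<kappa> (b', g')) (FArr G h) = \<kappa> (b, Cmp A g' (FArr f h))"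
  shows "is_cocone (comma_category B A f a) D (functor_comp G comma_proj) M \<kappa>"
proof (rule is_coconeI)
  show "cat_functor (comma_category B A f a) D (functor_comp G comma_proj)"
    by (rule cat_functor_comp[OF comma_proj_functor[OF f.cat_functor_axioms] G])
  show "in_hom D (\<kappa> j) (FObj (functor_comp G comma_proj) j) M"
    if "j \<in> Obj (comma_category B A f a)" for j
    using that hom by (cases j) simp
  show "Cmp D (\<kappa> j) (FArr (functor_comp G comma_proj) m) = \<kappa> i"
    if "in_hom (comma_category B A f a) m i j" for m i j
    using that cmp by (cases i, cases j) (auto simp: comma_category_hom)
qed fact

lemma
  assumes "cat_functor B D G" "a \<in> Obj A"
    and "is_cocone (comma_category B A f a) D (functor_comp G comma_proj) M \<kappa>"
  shows colim_map_hom: "in_hom D (colim_map (comma_category B A f a) D (functor_comp G comma_proj) M \<kappa>)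
      (colim_at G a) M"
    and colim_map_leg: "\<lbrakk>b \<in> Obj B; in_hom A g (FObj f b) a\<rbrakk> \<Longrightarrow>
      Cmp D (colim_map (comma_category B A f a) D (functor_comp G comma_proj) M \<kappa>) (leg G a b g) = \<kappa> (b, g)"
  using is_mediating_colim_map[OF colimits[OF assms(1,2)] assms(3)] by (auto simp: is_mediating_def)

lemma push_obj_sel: "a \<in> Obj A \<Longrightarrow> FObj (push G) a = colim_at G a"
  by (simp add: pushforward_obj_def Let_def)

lemma push_extensional: "FObj (push G) \<in> extensional (Obj A)" "FArr (push G) \<in> extensional (Arr A)"
  by (simp_all add: pushforward_obj_def Let_def)

text \<open>The reindexed legs form a cocone because postcomposing with \<open>m\<close> commutes,
  by associativity, with precomposing with an arrow in the image of \<open>f\<close>.\<close>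

lemma
  assumes G: "cat_functor B D G" and m: "in_hom A m a a'"
  shows push_arr_hom: "in_hom D (FArr (push G) m) (colim_at G a) (colim_at G a')"
    and push_arr_leg: "\<lbrakk>b \<in> Obj B; in_hom A g (FObj f b) a\<rbrakk> \<Longrightarrow>
      Cmp D (FArr (push G) m) (leg G a b g) = leg G a' b (Cmp A m g)"
proof -
  have aa: "a \<in> Obj A" "a' \<in> Obj A" using f.D.hom_obj[OF m] by auto
  have c: "is_cocone (comma_category B A f a) D (functor_comp G comma_proj) (colim_at G a')
      (\<lambda>(b, g). leg G a' b (Cmp A m g))"
  proof (rule comma_coconeI[OF G colim_at_obj[OF G aa(2)]])
    fix b b' h g' assume h: "in_hom B h b b'" and g': "in_hom A g' (FObj f b') a"
    then show "Cmp D ((\<lambda>(b, g). leg G a' b (Cmp A m g)) (b', g')) (FArr G h) =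
       (\<lambda>(b, g). leg G a' b (Cmp A m g)) (b, Cmp A g' (FArr f h))"
      using leg_cmp[OF G aa(2) h f.D.cmp_hom[OF g' m]] f.D.assoc_hom[OF f.farr_hom[OF h] g' m] by simp
  qed (use leg_hom[OF G aa(2)] f.D.cmp_hom[OF _ m] in auto)
  have m_eq: "FArr (push G) m = colim_map (comma_category B A f a) D (functor_comp G comma_proj)
      (colim_at G a') (\<lambda>(b, g). leg G a' b (Cmp A m g))"
    using m by (simp add: pushforward_obj_def in_hom_def Let_def)
  show "in_hom D (FArr (push G) m) (colim_at G a) (colim_at G a')"
    unfolding m_eq by (rule colim_map_hom[OF G aa(1) c])
  show "Cmp D (FArr (push G) m) (leg G a b g) = leg G a' b (Cmp A m g)"
    if "b \<in> Obj B" "in_hom A g (FObj f b) a"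
    using colim_map_leg[OF G aa(1) c that] by (simp add: m_eq)
qed

text \<open>The colimits at different objects are chosen independently, so the functor laws are not
  built in. On legs they reduce to the unit and associativity laws of \<open>A\<close>.\<close>

lemma push_functor:
  assumes G: "cat_functor B D G"
  shows "cat_functor A D (push G)"
proof (rule cat_functorI)
  show "category A" "category D" by unfold_locales
  fix a assume a: "a \<in> Obj A"
  show "FObj (push G) a \<in> Obj D" by (simp add: push_obj_sel a colim_at_obj[OF G])
  have i: "in_hom A (Ide A a) a a" by (rule f.D.ide_hom[OF a])
  show "FArr (push G) (Ide A a) = Ide D (FObj (push G) a)"
    unfolding push_obj_sel[OF a]
  proof (rule colim_at_ext[OF G a push_arr_hom[OF G i]])
    fix b g assume b: "b \<in> Obj B" "in_hom A g (FObj f b) a"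
    then show "Cmp D (FArr (push G) (Ide A a)) (leg G a b g) = Cmp D (Ide D (colim_at G a)) (leg G a b g)"
      by (simp add: push_arr_leg[OF G i b] f.D.ide_left_hom D.ide_left_hom[OF leg_hom[OF G a b]])
  qed (simp add: D.ide_hom colim_at_obj[OF G a])
next
  fix m a a' assume m: "in_hom A m a a'"
  then show "in_hom D (FArr (push G) m) (FObj (push G) a) (FObj (push G) a')"
    using push_arr_hom[OF G m] f.D.hom_obj[OF m] by (simp add: push_obj_sel)
next
  fix m n a1 a2 a3 assume m: "in_hom A m a1 a2" and n: "in_hom A n a2 a3"
  note nm = f.D.cmp_hom[OF m n]
  have a1: "a1 \<in> Obj A" using f.D.hom_obj[OF m] by simp
  show "FArr (push G) (Cmp A n m) = Cmp D (FArr (push G) n) (FArr (push G) m)"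
  proof (rule colim_at_ext[OF G a1 push_arr_hom[OF G nm] D.cmp_hom[OF push_arr_hom[OF G m] push_arr_hom[OF G n]]])
    fix b g assume b: "b \<in> Obj B" "in_hom A g (FObj f b) a1"
    show "Cmp D (FArr (push G) (Cmp A n m)) (leg G a1 b g) =
       Cmp D (Cmp D (FArr (push G) n) (FArr (push G) m)) (leg G a1 b g)"
      using D.assoc_hom[OF leg_hom[OF G a1 b] push_arr_hom[OF G m] push_arr_hom[OF G n]]
        f.D.assoc_hom[OF b(2) m n]
      by (simp add: push_arr_leg[OF G nm b] push_arr_leg[OF G m b]
          push_arr_leg[OF G n b(1) f.D.cmp_hom[OF b(2) m]])
  qed
qed

abbreviation push_trans where
  "push_trans G H \<tau> \<equiv> \<lambda>a\<in>Obj A. colim_map (comma_category B A f a) D (functor_comp G comma_proj)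
     (colim_at H a) (\<lambda>(b, g). Cmp D (leg H a b g) (\<tau> b))"

text \<open>Naturality of \<open>\<tau>\<close> turns an arrow of the diagram \<open>G\<close> into
  one of the diagram \<open>H\<close>, where the cocone law of the legs of \<open>H\<close> absorbs
  it.\<close>

lemma
  assumes t: "nat_trans B D G H \<tau>" and a: "a \<in> Obj A"
  shows push_trans_hom: "in_hom D (push_trans G H \<tau> a) (colim_at G a) (colim_at H a)"
    and push_trans_leg: "\<lbrakk>b \<in> Obj B; in_hom A g (FObj f b) a\<rbrakk> \<Longrightarrow>
      Cmp D (push_trans G H \<tau> a) (leg G a b g) = Cmp D (leg H a b g) (\<tau> b)"
proof -
  interpret t: nat_trans B D G H \<tau> by fact
  note G = t.F.cat_functor_axioms and H = t.G.cat_functor_axioms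
  have c: "is_cocone (comma_category B A f a) D (functor_comp G comma_proj) (colim_at H a)
      (\<lambda>(b, g). Cmp D (leg H a b g) (\<tau> b))"
  proof (rule comma_coconeI[OF G colim_at_obj[OF H a]])
    fix b b' h g' assume h: "in_hom B h b b'" and g': "in_hom A g' (FObj f b') a"
    have b: "b \<in> Obj B" "b' \<in> Obj B" using f.C.hom_obj[OF h] by auto
    have "Cmp D (Cmp D (leg H a b' g') (\<tau> b')) (FArr G h) = Cmp D (leg H a b' g') (Cmp D (\<tau> b') (FArr G h))"
      using D.assoc_hom[OF t.F.farr_hom[OF h] t.component[OF b(2)] leg_hom[OF H a b(2) g']] by simp
    also have "\<dots> = Cmp D (leg H a b' g') (Cmp D (FArr H h) (\<tau> b))"
      by (simp add: t.naturality_hom[OF h])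
    also have "\<dots> = Cmp D (Cmp D (leg H a b' g') (FArr H h)) (\<tau> b)"
      using D.assoc_hom[OF t.component[OF b(1)] t.G.farr_hom[OF h] leg_hom[OF H a b(2) g']] by simp
    finally show "Cmp D ((\<lambda>(b, g). Cmp D (leg H a b g) (\<tau> b)) (b', g')) (FArr G h) =
       (\<lambda>(b, g). Cmp D (leg H a b g) (\<tau> b)) (b, Cmp A g' (FArr f h))"
      by (simp add: leg_cmp[OF H a h g'])
  qed (use D.cmp_hom[OF t.component leg_hom[OF H a]] in auto)
  show "in_hom D (push_trans G H \<tau> a) (colim_at G a) (colim_at H a)"
    using colim_map_hom[OF G a c] a by simp
  show "Cmp D (push_trans G H \<tau> a) (leg G a b g) = Cmp D (leg H a b g) (\<tau> b)"
    if "b \<in> Obj B" "in_hom A g (FObj f b) a"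
    using colim_map_leg[OF G a c that] a by simp
qed

text \<open>Both composites send the leg at \<open>(b, g)\<close> to \<open>\<tau> b\<close>
  followed by the leg of \<open>H\<close> at \<open>(b, Cmp A m g)\<close>.\<close>

lemma push_trans_nat_trans:
  assumes t: "nat_trans B D G H \<tau>"
  shows "nat_trans A D (push G) (push H) (push_trans G H \<tau>)"
proof -
  interpret t: nat_trans B D G H \<tau> by fact
  note G = t.F.cat_functor_axioms and H = t.G.cat_functor_axioms
  show ?thesis
  proof (rule nat_transI[OF push_functor[OF G] push_functor[OF H]])
    show "in_hom D (push_trans G H \<tau> a) (FObj (push G) a) (FObj (push H) a)" if "a \<in> Obj A" for a
      using push_trans_hom[OF t that] that by (simp add: push_obj_sel)
    fix m a a' assume m: "in_hom A m a a'"
    have a: "a \<in> Obj A" "a' \<in> Obj A" using f.D.hom_obj[OF m] by auto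
    note hs = push_trans_hom[OF t a(1)] push_trans_hom[OF t a(2)] push_arr_hom[OF G m] push_arr_hom[OF H m]
    show "Cmp D (push_trans G H \<tau> a') (FArr (push G) m) = Cmp D (FArr (push H) m) (push_trans G H \<tau> a)"
    proof (rule colim_at_ext[OF G a(1) D.cmp_hom[OF hs(3,2)] D.cmp_hom[OF hs(1,4)]])
      fix b g assume b: "b \<in> Obj B" "in_hom A g (FObj f b) a"
      note mg = f.D.cmp_hom[OF b(2) m]
      have "Cmp D (Cmp D (push_trans G H \<tau> a') (FArr (push G) m)) (leg G a b g)
          = Cmp D (push_trans G H \<tau> a') (leg G a' b (Cmp A m g))"
        using D.assoc_hom[OF leg_hom[OF G a(1) b] hs(3,2)] push_arr_leg[OF G m b] by metis
      also have "\<dots> = Cmp D (Cmp D (FArr (push H) m) (leg H a b g)) (\<tau> b)"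
        using push_trans_leg[OF t a(2) b(1) mg] push_arr_leg[OF H m b] by metis
      also have "\<dots> = Cmp D (FArr (push H) m) (Cmp D (push_trans G H \<tau> a) (leg G a b g))"
        using D.assoc_hom[OF t.component[OF b(1)] leg_hom[OF H a(1) b] hs(4)]
          push_trans_leg[OF t a(1) b] by metis
      also have "\<dots> = Cmp D (Cmp D (FArr (push H) m) (push_trans G H \<tau> a)) (leg G a b g)"
        by (rule D.assoc_hom[OF leg_hom[OF G a(1) b] hs(1,4)])
      finally show "Cmp D (Cmp D (push_trans G H \<tau> a') (FArr (push G) m)) (leg G a b g)
          = Cmp D (Cmp D (FArr (push H) m) (push_trans G H \<tau> a)) (leg G a b g)" .
    qed
  qed
qed

lemma pushforward_functor_sel [simp]:
  "FObj (pushforward_functor B A D f) G = push G"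
  "FArr (pushforward_functor B A D f) (G, \<tau>, H) = (push G, push_trans G H \<tau>, push H)"
  by (simp_all add: pushforward_functor_def)

lemma push_obj: "G \<in> Obj (functor_category B D) \<Longrightarrow> push G \<in> Obj (functor_category A D)"
  by (simp add: functor_category_obj push_functor push_extensional)

lemma pushforward_functor_functor:
  "cat_functor (functor_category B D) (functor_category A D) (pushforward_functor B A D f)"
proof (rule cat_functorI)
  have D: "category D" by unfold_locales
  show "category (functor_category B D)" "category (functor_category A D)"
    by (rule category_functor_category[OF D])+
  fix G assume obj: "G \<in> Obj (functor_category B D)"
  then have G: "cat_functor B D G" by (simp add: functor_category_obj)
  interpret G: cat_functor B D G by fact
  show "FObj (pushforward_functor B A D f) G \<in> Obj (functor_category A D)"
    using obj by (simp add: push_obj)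
  have t: "nat_trans B D G G (\<lambda>b\<in>Obj B. Ide D (FObj G b))" by (rule nat_trans_ide[OF G])
  have "push_trans G G (\<lambda>b\<in>Obj B. Ide D (FObj G b)) a = Ide D (colim_at G a)" if a: "a \<in> Obj A" for a
  proof (rule colim_at_ext[OF G a push_trans_hom[OF t a]])
    fix b g assume b: "b \<in> Obj B" "in_hom A g (FObj f b) a"
    show "Cmp D (push_trans G G (\<lambda>b\<in>Obj B. Ide D (FObj G b)) a) (leg G a b g) =
        Cmp D (Ide D (colim_at G a)) (leg G a b g)"
      using b D.ide_left_hom[OF leg_hom[OF G a b]] D.ide_right_hom[OF leg_hom[OF G a b]]
      by (simp only: push_trans_leg[OF t a b] restrict_apply' )
  qed (simp add: D.ide_hom colim_at_obj[OF G a])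
  then show "FArr (pushforward_functor B A D f) (Ide (functor_category B D) G) =
       Ide (functor_category A D) (FObj (pushforward_functor B A D f) G)"
    by (auto simp: fun_eq_iff push_obj_sel)
next
  fix m G H assume "in_hom (functor_category B D) m G H"
  then show "in_hom (functor_category A D) (FArr (pushforward_functor B A D f) m)
      (FObj (pushforward_functor B A D f) G) (FObj (pushforward_functor B A D f) H)"
    by (auto simp: functor_category_hom push_obj push_trans_nat_trans)
next
  fix m n G H I assume "in_hom (functor_category B D) m G H" "in_hom (functor_category B D) n H I"
  then obtain \<tau> \<sigma> where mn: "m = (G, \<tau>, H)" "n = (H, \<sigma>, I)"
    and t: "nat_trans B D G H \<tau>" and s: "nat_trans B D H I \<sigma>"
    by (auto simp: functor_category_hom)
  interpret t: nat_trans B D G H \<tau> by fact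
  interpret s: nat_trans B D H I \<sigma> by fact
  note G = t.F.cat_functor_axioms and H = t.G.cat_functor_axioms and I = s.G.cat_functor_axioms
  let ?st = "\<lambda>b\<in>Obj B. Cmp D (\<sigma> b) (\<tau> b)"
  have st: "nat_trans B D G I ?st" by (rule nat_trans_cmp[OF t s])
  have "push_trans G I ?st a = Cmp D (push_trans H I \<sigma> a) (push_trans G H \<tau> a)" if a: "a \<in> Obj A" for a
  proof (rule colim_at_ext[OF G a push_trans_hom[OF st a] D.cmp_hom[OF push_trans_hom[OF t a] push_trans_hom[OF s a]]])
    fix b g assume b: "b \<in> Obj B" "in_hom A g (FObj f b) a"
    have "Cmp D (push_trans G I ?st a) (leg G a b g) = Cmp D (leg I a b g) (Cmp D (\<sigma> b) (\<tau> b))"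
      using b by (simp only: push_trans_leg[OF st a b] restrict_apply')
    also have "\<dots> = Cmp D (Cmp D (push_trans H I \<sigma> a) (leg H a b g)) (\<tau> b)"
      using D.assoc_hom[OF t.component[OF b(1)] s.component[OF b(1)] leg_hom[OF I a b]]
      by (simp only: push_trans_leg[OF s a b])
    also have "\<dots> = Cmp D (push_trans H I \<sigma> a) (Cmp D (push_trans G H \<tau> a) (leg G a b g))"
      using D.assoc_hom[OF t.component[OF b(1)] leg_hom[OF H a b] push_trans_hom[OF s a]]
      by (simp only: push_trans_leg[OF t a b])
    also have "\<dots> = Cmp D (Cmp D (push_trans H I \<sigma> a) (push_trans G H \<tau> a)) (leg G a b g)"
      by (rule D.assoc_hom[OF leg_hom[OF G a b] push_trans_hom[OF t a] push_trans_hom[OF s a]])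
    finally show "Cmp D (push_trans G I ?st a) (leg G a b g) =
        Cmp D (Cmp D (push_trans H I \<sigma> a) (push_trans G H \<tau> a)) (leg G a b g)" .
  qed
  then show "FArr (pushforward_functor B A D f) (Cmp (functor_category B D) n m) =
       Cmp (functor_category A D) (FArr (pushforward_functor B A D f) n) (FArr (pushforward_functor B A D f) m)"
    by (auto simp: mn fun_eq_iff)
qed

end

section \<open>Weak pullbacks\<close>

lemma weak_pullback_obj_iff [simp]:
  "(x, g, x') \<in> Obj (weak_pullback X A X' t s') \<longleftrightarrow>
    x \<in> Obj X \<and> x' \<in> Obj X' \<and> in_hom A g (FObj t x) (FObj s' x')"
  by (simp add: weak_pullback_def weak_pullback_obj_def)

lemma weak_pullback_arr:
  "((x1, g1, x1'), (h, k), (x2, g2, x2')) \<in> Arr (weak_pullback X A X' t s') \<longleftrightarrow>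
    (x1, g1, x1') \<in> Obj (weak_pullback X A X' t s') \<and> (x2, g2, x2') \<in> Obj (weak_pullback X A X' t s') \<and>
    in_hom X h x1 x2 \<and> in_hom X' k x1' x2' \<and> Cmp A (FArr s' k) g1 = Cmp A g2 (FArr t h)"
  by (auto simp: weak_pullback_def)

lemma weak_pullback_sel [simp]:
  "Dom (weak_pullback X A X' t s') (p, hk, q) = p"
  "Cod (weak_pullback X A X' t s') (p, hk, q) = q"
  "Ide (weak_pullback X A X' t s') (x, g, x') = ((x, g, x'), (Ide X x, Ide X' x'), (x, g, x'))"
  "Cmp (weak_pullback X A X' t s') (q', (h', k'), r) (p, (h, k), q) = (p, (Cmp X h' h, Cmp X' k' k), r)"
  by (simp_all add: weak_pullback_def)

lemma weak_pullback_homI: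
  "\<lbrakk>(x1, g1, x1') \<in> Obj (weak_pullback X A X' t s'); (x2, g2, x2') \<in> Obj (weak_pullback X A X' t s');
    in_hom X h x1 x2; in_hom X' k x1' x2'; Cmp A (FArr s' k) g1 = Cmp A g2 (FArr t h)\<rbrakk>
    \<Longrightarrow> in_hom (weak_pullback X A X' t s') ((x1, g1, x1'), (h, k), (x2, g2, x2')) (x1, g1, x1') (x2, g2, x2')"
  by (simp add: in_hom_def[of "weak_pullback X A X' t s'"] weak_pullback_arr)

lemma weak_pullback_homE:
  assumes "in_hom (weak_pullback X A X' t s') m (x1, g1, x1') (x2, g2, x2')"
  obtains h k where "m = ((x1, g1, x1'), (h, k), (x2, g2, x2'))"
    "in_hom X h x1 x2" "in_hom X' k x1' x2'" "Cmp A (FArr s' k) g1 = Cmp A g2 (FArr t h)"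
proof -
  obtain p h k q where m: "m = (p, (h, k), q)" by (metis surj_pair)
  show thesis
    using assms that unfolding m in_hom_def[of "weak_pullback X A X' t s'"]
    by (auto simp: weak_pullback_arr)
qed

lemma weak_pullback_fst_sel [simp]:
  "FObj weak_pullback_fst (x, g, x') = x" "FArr weak_pullback_fst (p, (h, k), q) = h"
  by (simp_all add: weak_pullback_fst_def)

lemma weak_pullback_snd_sel [simp]:
  "FObj weak_pullback_snd (x, g, x') = x'" "FArr weak_pullback_snd (p, (h, k), q) = k"
  by (simp_all add: weak_pullback_snd_def)

locale cospan = t: cat_functor X A t + s': cat_functor X' A s'
  for X :: "('x, 'y) category" and A :: "('o, 'm) category" and X' :: "('u, 'v) category" and t s'
begin

abbreviation W where "W \<equiv> weak_pullback X A X' t s'"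

text \<open>Closure under composition is the pasting of two commuting squares in \<open>A\<close>;
  the remaining laws hold componentwise in \<open>X\<close> and \<open>X'\<close>.\<close>

lemma category_weak_pullback: "category W"
proof
  fix m assume "m \<in> Arr W"
  moreover obtain x1 g1 x1' h k x2 g2 x2' where m: "m = ((x1, g1, x1'), (h, k), (x2, g2, x2'))"
    by (metis surj_pair)
  ultimately have *: "(x1, g1, x1') \<in> Obj W" "(x2, g2, x2') \<in> Obj W"
      "in_hom X h x1 x2" "in_hom X' k x1' x2'"
    by (simp_all only: weak_pullback_arr)
  then show "Dom W m \<in> Obj W" "Cod W m \<in> Obj W"
    by (simp_all only: m weak_pullback_sel)
  show "Cmp W (Ide W (Cod W m)) m = m" "Cmp W m (Ide W (Dom W m)) = m"
    by (simp_all add: m t.C.ide_left_hom[OF *(3)] s'.C.ide_left_hom[OF *(4)]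
        t.C.ide_right_hom[OF *(3)] s'.C.ide_right_hom[OF *(4)])
next
  fix w assume "w \<in> Obj W"
  moreover obtain x g x' where w: "w = (x, g, x')" by (metis surj_pair)
  ultimately have *: "x \<in> Obj X" "x' \<in> Obj X'" "in_hom A g (FObj t x) (FObj s' x')" by simp_all
  then show "Ide W w \<in> Arr W"
    by (simp add: w weak_pullback_arr t.C.ide_hom s'.C.ide_hom t.farr_ide s'.farr_ide
        t.D.ide_left_hom[OF *(3)] t.D.ide_right_hom[OF *(3)])
  show "Dom W (Ide W w) = w" "Cod W (Ide W w) = w" by (simp_all add: w)
next
  fix m n assume "m \<in> Arr W" "n \<in> Arr W" "Cod W m = Dom W n"
  moreover from this obtain x1 g1 x1' h k x2 g2 x2' h' k' x3 g3 x3' where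
    mn: "m = ((x1, g1, x1'), (h, k), (x2, g2, x2'))" "n = ((x2, g2, x2'), (h', k'), (x3, g3, x3'))"
    by (metis surj_pair weak_pullback_sel(1,2))
  ultimately have o: "(x1, g1, x1') \<in> Obj W" "(x3, g3, x3') \<in> Obj W"
    and g: "in_hom A g1 (FObj t x1) (FObj s' x1')" "in_hom A g2 (FObj t x2) (FObj s' x2')"
      "in_hom A g3 (FObj t x3) (FObj s' x3')"
    and h: "in_hom X h x1 x2" "in_hom X h' x2 x3" and k: "in_hom X' k x1' x2'" "in_hom X' k' x2' x3'"
    and sq: "Cmp A (FArr s' k) g1 = Cmp A g2 (FArr t h)" "Cmp A (FArr s' k') g2 = Cmp A g3 (FArr t h')"
    by (simp_all add: weak_pullback_arr)
  have "Cmp A (FArr s' (Cmp X' k' k)) g1 = Cmp A (FArr s' k') (Cmp A (FArr s' k) g1)"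
    using t.D.assoc_hom[OF g(1) s'.farr_hom[OF k(1)] s'.farr_hom[OF k(2)]]
    by (simp add: s'.farr_cmp_hom[OF k])
  also have "\<dots> = Cmp A (Cmp A g3 (FArr t h')) (FArr t h)"
    using t.D.assoc_hom[OF t.farr_hom[OF h(1)] g(2) s'.farr_hom[OF k(2)]] by (simp add: sq)
  also have "\<dots> = Cmp A g3 (FArr t (Cmp X h' h))"
    using t.D.assoc_hom[OF t.farr_hom[OF h(1)] t.farr_hom[OF h(2)] g(3)]
    by (simp add: t.farr_cmp_hom[OF h])
  finally show "Cmp W n m \<in> Arr W"
    unfolding mn weak_pullback_sel weak_pullback_arr using o t.C.cmp_hom[OF h] s'.C.cmp_hom[OF k] by simp
  show "Dom W (Cmp W n m) = Dom W m" "Cod W (Cmp W n m) = Cod W n" by (simp_all add: mn)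
next
  fix m n l assume "m \<in> Arr W" "n \<in> Arr W" "l \<in> Arr W" "Cod W m = Dom W n" "Cod W n = Dom W l"
  moreover from this obtain x1 g1 x1' h k x2 g2 x2' h' k' x3 g3 x3' h'' k'' x4 g4 x4' where
    mnl: "m = ((x1, g1, x1'), (h, k), (x2, g2, x2'))" "n = ((x2, g2, x2'), (h', k'), (x3, g3, x3'))"
      "l = ((x3, g3, x3'), (h'', k''), (x4, g4, x4'))"
    by (metis surj_pair weak_pullback_sel(1,2))
  ultimately have "in_hom X h x1 x2" "in_hom X h' x2 x3" "in_hom X h'' x3 x4"
    "in_hom X' k x1' x2'" "in_hom X' k' x2' x3'" "in_hom X' k'' x3' x4'"
    by (simp_all add: weak_pullback_arr)
  then show "Cmp W l (Cmp W n m) = Cmp W (Cmp W l n) m"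
    by (simp add: mnl t.C.assoc_hom s'.C.assoc_hom)
qed

lemma weak_pullback_fst_functor: "cat_functor W X weak_pullback_fst"
  and weak_pullback_snd_functor: "cat_functor W X' weak_pullback_snd"
proof -
  interpret W: category W by (rule category_weak_pullback)
  show "cat_functor W X weak_pullback_fst"
    by unfold_locales (auto simp: weak_pullback_arr in_hom_def)
  show "cat_functor W X' weak_pullback_snd"
    by unfold_locales (auto simp: weak_pullback_arr in_hom_def)
qed

end

section \<open>Base change\<close>

text \<open>A strict equality of records: \<open>p\<close> lands in \<open>X\<close>, so the inner
  restriction is invisible after the outer one. It identifies restriction along a composite with the
  iterated restriction.\<close>

lemma precomp_functor_comp:
  assumes "cat_functor W X p"
  shows "precomp W (functor_comp s p) F = precomp W p (precomp X s F)"
proof -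
  interpret p: cat_functor W X p by fact
  show ?thesis
    by (auto simp: precomp_def p.fobj_in p.farr_in fun_eq_iff)
qed

locale base_change = cospan X A2 X' t s' + P: pushforward X A2 t D + P': pushforward X' A3 t' D +
  PW: pushforward "weak_pullback X A2 X' t s'" A3 "functor_comp t' weak_pullback_snd" D
  for X :: "('x, 'y) category" and A2 :: "('o2, 'm2) category" and X' :: "('u, 'v) category"
    and A3 :: "('o3, 'm3) category" and t s' t' and D :: "('p, 'n) category"
begin

text \<open>The two routes from \<open>X\<close> around the weak pullback square: \<open>Q G\<close>
  is \<open>s'\<^sup>* t\<^sub>* G\<close> on \<open>X'\<close>, and \<open>R G\<close> below is the
  restriction of \<open>G\<close> to the weak pullback.\<close>

abbreviation Q where "Q G \<equiv> precomp X' s' (P.push G)"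

text \<open>\<open>FObj weak_pullback_fst w\<close> on its own leaves the arrow types of the projection undetermined.\<close>

abbreviation fst_W :: "('x \<times> 'm2 \<times> 'u, ('x \<times> 'm2 \<times> 'u) \<times> ('y \<times> 'v) \<times> ('x \<times> 'm2 \<times> 'u), 'x, 'y) functor_data"
  where "fst_W \<equiv> weak_pullback_fst"

abbreviation R where "R G \<equiv> precomp W weak_pullback_fst G"

text \<open>An object of the comma category over the weak pullback is the same as an object
  \<open>(x', m)\<close> of the outer comma category together with an object \<open>(x, g)\<close>
  of the inner one over \<open>FObj s' x'\<close>. The two corresponding colimit inclusions are
  composed.\<close>

definition iterated_leg where
  "iterated_leg G a = (\<lambda>((x, g, x'), m). Cmp D (P'.leg (Q G) a x' m) (P.leg G (FObj s' x') x g))"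

lemma Q_functor: "cat_functor X D G \<Longrightarrow> cat_functor X' D (Q G)"
  by (rule precomp_functor[OF s'.cat_functor_axioms P.push_functor])

lemma R_functor: "cat_functor X D G \<Longrightarrow> cat_functor W D (R G)"
  by (rule precomp_functor[OF weak_pullback_fst_functor])

lemma Q_obj: "x' \<in> Obj X' \<Longrightarrow> FObj (Q G) x' = P.colim_at G (FObj s' x')"
  by (simp add: P.push_obj_sel s'.fobj_in)

lemma
  assumes G: "cat_functor X D G" and a: "a \<in> Obj A3"
    and x: "x \<in> Obj X" "x' \<in> Obj X'" "in_hom A2 g (FObj t x) (FObj s' x')"
    and m: "in_hom A3 m (FObj t' x') a"
  shows inner_leg_hom: "in_hom D (P.leg G (FObj s' x') x g) (FObj G x) (FObj (Q G) x')"
    and outer_leg_hom: "in_hom D (P'.leg (Q G) a x' m) (FObj (Q G) x') (P'.colim_at (Q G) a)"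
    and iterated_leg_hom: "in_hom D (iterated_leg G a ((x, g, x'), m)) (FObj G x) (P'.colim_at (Q G) a)"
proof -
  show 1: "in_hom D (P.leg G (FObj s' x') x g) (FObj G x) (FObj (Q G) x')"
    unfolding Q_obj[OF x(2)] by (rule P.leg_hom[OF G s'.fobj_in[OF x(2)] x(1,3)])
  show 2: "in_hom D (P'.leg (Q G) a x' m) (FObj (Q G) x') (P'.colim_at (Q G) a)"
    by (rule P'.leg_hom[OF Q_functor[OF G] a x(2) m])
  show "in_hom D (iterated_leg G a ((x, g, x'), m)) (FObj G x) (P'.colim_at (Q G) a)"
    using P.D.cmp_hom[OF 1 2] by (simp add: iterated_leg_def)
qed

text \<open>For an arrow \<open>(h, k)\<close>, the inner cocone law absorbs \<open>h\<close> and
  leaves the leg at \<open>Cmp A2 g2 (FArr t h)\<close>. The commuting square rewrites this index as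
  \<open>Cmp A2 (FArr s' k) g1\<close>, which is the action of \<open>FArr (Q G) k\<close> on the
  inner leg at \<open>g1\<close>; the outer cocone law then absorbs \<open>k\<close>.\<close>

lemma iterated_leg_cocone:
  assumes G: "cat_functor X D G" and a: "a \<in> Obj A3"
  shows "is_cocone (comma_category W A3 (functor_comp t' weak_pullback_snd) a) D
    (functor_comp (R G) comma_proj) (P'.colim_at (Q G) a) (iterated_leg G a)"
proof (rule PW.comma_coconeI[OF R_functor[OF G] P'.colim_at_obj[OF Q_functor[OF G] a]])
  fix w m assume w: "w \<in> Obj W" and m: "in_hom A3 m (FObj (functor_comp t' weak_pullback_snd) w) a"
  obtain x g x' where [simp]: "w = (x, g, x')" by (metis surj_pair)
  show "in_hom D (iterated_leg G a (w, m)) (FObj (R G) w) (P'.colim_at (Q G) a)"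
    using w m iterated_leg_hom[OF G a] by simp
next
  fix w1 w2 n m assume n: "in_hom W n w1 w2" and m: "in_hom A3 m (FObj (functor_comp t' weak_pullback_snd) w2) a"
  obtain x1 g1 x1' x2 g2 x2' where w [simp]: "w1 = (x1, g1, x1')" "w2 = (x2, g2, x2')"
    by (metis surj_pair)
  have n_arr: "n \<in> Arr W" using n by (simp add: in_hom_def[of W])
  have "w1 \<in> Obj W" "w2 \<in> Obj W" using PW.f.C.hom_obj[OF n] by auto
  then have x: "x1 \<in> Obj X" "x1' \<in> Obj X'" "in_hom A2 g1 (FObj t x1) (FObj s' x1')"
      "x2 \<in> Obj X" "x2' \<in> Obj X'" "in_hom A2 g2 (FObj t x2) (FObj s' x2')" by simp_all
  have m2: "in_hom A3 m (FObj t' x2') a" using m by simp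
  obtain h k where nhk: "n = ((x1, g1, x1'), (h, k), (x2, g2, x2'))"
    and h: "in_hom X h x1 x2" and k: "in_hom X' k x1' x2'"
    and sq: "Cmp A2 (FArr s' k) g1 = Cmp A2 g2 (FArr t h)"
    using n by (auto elim: weak_pullback_homE)
  have mk: "in_hom A3 (Cmp A3 m (FArr t' k)) (FObj t' x1') a"
    by (rule P'.f.D.cmp_hom[OF P'.f.farr_hom[OF k] m2])
  have QG: "cat_functor X' D (Q G)" by (rule Q_functor[OF G])
  interpret G: cat_functor X D G by fact
  interpret QG: cat_functor X' D "Q G" by fact
  note sk = s'.farr_hom[OF k]
  have k_arr: "k \<in> Arr X'" using k by (simp add: in_hom_def)
  have "Cmp D (Cmp D (P'.leg (Q G) a x2' m) (P.leg G (FObj s' x2') x2 g2)) (FArr G h)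
      = Cmp D (P'.leg (Q G) a x2' m) (Cmp D (P.leg G (FObj s' x2') x2 g2) (FArr G h))"
    using P.D.assoc_hom[OF G.farr_hom[OF h] inner_leg_hom[OF G a x(4-6) m2] outer_leg_hom[OF G a x(4-6) m2]]
    by simp
  also have "Cmp D (P.leg G (FObj s' x2') x2 g2) (FArr G h) = P.leg G (FObj s' x2') x1 (Cmp A2 (FArr s' k) g1)"
    by (simp only: P.leg_cmp[OF G s'.fobj_in[OF x(5)] h x(6)] sq)
  also have "\<dots> = Cmp D (FArr (Q G) k) (P.leg G (FObj s' x1') x1 g1)"
    using P.push_arr_leg[OF G sk x(1) x(3)] by (simp add: k_arr)
  also have "Cmp D (P'.leg (Q G) a x2' m) (Cmp D (FArr (Q G) k) (P.leg G (FObj s' x1') x1 g1))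
      = Cmp D (Cmp D (P'.leg (Q G) a x2' m) (FArr (Q G) k)) (P.leg G (FObj s' x1') x1 g1)"
    by (rule P.D.assoc_hom[OF inner_leg_hom[OF G a x(1-3) mk] QG.farr_hom[OF k] outer_leg_hom[OF G a x(4-6) m2]])
  also have "Cmp D (P'.leg (Q G) a x2' m) (FArr (Q G) k) = P'.leg (Q G) a x1' (Cmp A3 m (FArr t' k))"
    by (rule P'.leg_cmp[OF QG a k m2])
  finally show "Cmp D (iterated_leg G a (w2, m)) (FArr (R G) n) =
      iterated_leg G a (w1, Cmp A3 m (FArr (functor_comp t' weak_pullback_snd) n))"
    using n_arr by (simp add: iterated_leg_def nhk)
qed

lemma iterated_leg_colimit:
  assumes G: "cat_functor X D G" and a: "a \<in> Obj A3"
  shows "is_colimit (comma_category W A3 (functor_comp t' weak_pullback_snd) a) D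
    (functor_comp (R G) comma_proj) (P'.colim_at (Q G) a) (iterated_leg G a)"
  unfolding is_colimit_def
proof (intro conjI allI impI iterated_leg_cocone[OF G a])
  let ?K = "comma_category W A3 (functor_comp t' weak_pullback_snd) a"
  fix M \<kappa> assume c: "is_cocone ?K D (functor_comp (R G) comma_proj) M \<kappa>"
  note M = is_coconeD(2)[OF c]
  interpret G: cat_functor X D G by fact
  have QG: "cat_functor X' D (Q G)" by (rule Q_functor[OF G])
  interpret QG: cat_functor X' D "Q G" by fact
  have \<kappa>_hom: "in_hom D (\<kappa> ((x, g, x'), m)) (FObj G x) M"
    if "x \<in> Obj X" "x' \<in> Obj X'" "in_hom A2 g (FObj t x) (FObj s' x')" "in_hom A3 m (FObj t' x') a" for x g x' m
    using is_coconeD(3)[OF c, of "((x, g, x'), m)"] that by simp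
  \<comment> \<open>The cocone law of \<open>\<kappa>\<close> in terms of the underlying square.
    Every arrow of \<open>W\<close> factors as one of the form (identity, \<open>k\<close>) followed
    by one of the form (\<open>h\<close>, identity); these two kinds are the instances used below,
    for the outer and the inner cocone respectively.\<close>
  have \<kappa>_cmp: "Cmp D (\<kappa> ((x2, g2, x2'), m)) (FArr G h) = \<kappa> ((x1, g1, x1'), Cmp A3 m (FArr t' k))"
    if x: "in_hom X h x1 x2" "in_hom X' k x1' x2'" "in_hom A2 g1 (FObj t x1) (FObj s' x1')"
      "in_hom A2 g2 (FObj t x2) (FObj s' x2')" "in_hom A3 m (FObj t' x2') a"
      "Cmp A2 (FArr s' k) g1 = Cmp A2 g2 (FArr t h)" for x1 g1 x1' h k x2 g2 x2' m
  proof -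
    let ?w1 = "(x1, g1, x1')" and ?w2 = "(x2, g2, x2')"
    have n: "in_hom W (?w1, (h, k), ?w2) ?w1 ?w2"
      using x t.C.hom_obj[OF x(1)] s'.C.hom_obj[OF x(2)] by (intro weak_pullback_homI) simp_all
    then have n_arr: "(?w1, (h, k), ?w2) \<in> Arr W" by (simp add: in_hom_def[of W])
    have "in_hom A3 (Cmp A3 m (FArr t' k)) (FObj t' x1') a"
      by (rule P'.f.D.cmp_hom[OF P'.f.farr_hom[OF x(2)] x(5)])
    then have "in_hom ?K ((?w1, Cmp A3 m (FArr t' k)), (?w1, (h, k), ?w2), (?w2, m))
        (?w1, Cmp A3 m (FArr t' k)) (?w2, m)"
      using n PW.f.C.hom_obj[OF n] x(5) by (simp add: comma_category_hom)
    from is_coconeD(4)[OF c this] n_arr show ?thesis by simp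
  qed
  define u1 where "u1 x' m = colim_map (comma_category X A2 t (FObj s' x')) D (functor_comp G comma_proj) M
    (\<lambda>(x, g). \<kappa> ((x, g, x'), m))" for x' m
  have u1: "in_hom D (u1 x' m) (FObj (Q G) x') M"
    "\<And>x g. \<lbrakk>x \<in> Obj X; in_hom A2 g (FObj t x) (FObj s' x')\<rbrakk>
      \<Longrightarrow> Cmp D (u1 x' m) (P.leg G (FObj s' x') x g) = \<kappa> ((x, g, x'), m)"
    if x': "x' \<in> Obj X'" and m: "in_hom A3 m (FObj t' x') a" for x' m
  proof -
    \<comment> \<open>With \<open>x'\<close> and \<open>m\<close> held fixed, an arrow of the inner
      comma category becomes the arrow (\<open>h\<close>, identity) of \<open>W\<close>.\<close>
    note i = s'.C.ide_hom[OF x']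
    have "is_cocone (comma_category X A2 t (FObj s' x')) D (functor_comp G comma_proj) M
        (\<lambda>(x, g). \<kappa> ((x, g, x'), m))"
    proof (rule P.comma_coconeI[OF G M])
      fix x y h g assume h: "in_hom X h x y" and g: "in_hom A2 g (FObj t y) (FObj s' x')"
      note gh = t.D.cmp_hom[OF t.farr_hom[OF h] g]
      show "Cmp D ((\<lambda>(x, g). \<kappa> ((x, g, x'), m)) (y, g)) (FArr G h) =
          (\<lambda>(x, g). \<kappa> ((x, g, x'), m)) (x, Cmp A2 g (FArr t h))"
        using \<kappa>_cmp[OF h i gh g m] t.D.ide_left_hom[OF gh] P'.f.D.ide_right_hom[OF m]
        by (simp add: s'.farr_ide[OF x'] P'.f.farr_ide[OF x'])
    qed (use \<kappa>_hom x' m in auto)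
    note u = P.colim_map_hom[OF G s'.fobj_in[OF x'] this] P.colim_map_leg[OF G s'.fobj_in[OF x'] this]
    show "in_hom D (u1 x' m) (FObj (Q G) x') M" using u(1) by (simp only: u1_def Q_obj[OF x'])
    show "Cmp D (u1 x' m) (P.leg G (FObj s' x') x g) = \<kappa> ((x, g, x'), m)"
      if "x \<in> Obj X" "in_hom A2 g (FObj t x) (FObj s' x')" for x g
      using u(2)[OF that] by (simp add: u1_def)
  qed
  have c': "is_cocone (comma_category X' A3 t' a) D (functor_comp (Q G) comma_proj) M (\<lambda>(x', m). u1 x' m)"
  proof (rule P'.comma_coconeI[OF QG M])
    fix x' y' k m assume k: "in_hom X' k x' y'" and m: "in_hom A3 m (FObj t' y') a"
    have xy: "x' \<in> Obj X'" "y' \<in> Obj X'" using s'.C.hom_obj[OF k] by auto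
    note mk = P'.f.D.cmp_hom[OF P'.f.farr_hom[OF k] m]
    have k_arr: "k \<in> Arr X'" using k by (simp add: in_hom_def)
    have "Cmp D (u1 y' m) (FArr (Q G) k) = u1 x' (Cmp A3 m (FArr t' k))"
    proof (rule P.colim_at_ext[OF G s'.fobj_in[OF xy(1)]])
      show "in_hom D (Cmp D (u1 y' m) (FArr (Q G) k)) (P.colim_at G (FObj s' x')) M"
        using P.D.cmp_hom[OF QG.farr_hom[OF k] u1(1)[OF xy(2) m]] by (simp only: Q_obj[OF xy(1)])
      show "in_hom D (u1 x' (Cmp A3 m (FArr t' k))) (P.colim_at G (FObj s' x')) M"
        using u1(1)[OF xy(1) mk] by (simp only: Q_obj[OF xy(1)])
      fix x g assume x: "x \<in> Obj X" and g: "in_hom A2 g (FObj t x) (FObj s' x')"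
      note sg = t.D.cmp_hom[OF g s'.farr_hom[OF k]]
      have "Cmp D (Cmp D (u1 y' m) (FArr (Q G) k)) (P.leg G (FObj s' x') x g)
          = Cmp D (u1 y' m) (Cmp D (FArr (Q G) k) (P.leg G (FObj s' x') x g))"
        using P.D.assoc_hom[OF inner_leg_hom[OF G a x xy(1) g mk] QG.farr_hom[OF k] u1(1)[OF xy(2) m]] by simp
      also have "\<dots> = Cmp D (u1 y' m) (P.leg G (FObj s' y') x (Cmp A2 (FArr s' k) g))"
        using P.push_arr_leg[OF G s'.farr_hom[OF k] x g] by (simp add: k_arr)
      also have "\<dots> = \<kappa> ((x, Cmp A2 (FArr s' k) g, y'), m)"
        by (rule u1(2)[OF xy(2) m x sg])
      \<comment> \<open>This is the arrow (identity, \<open>k\<close>) of \<open>W\<close> out of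
        \<open>(x, g, x')\<close>; its target is chosen as \<open>Cmp A2 (FArr s' k) g\<close> so
        that the square commutes trivially.\<close>
      also have "\<dots> = \<kappa> ((x, g, x'), Cmp A3 m (FArr t' k))"
        using \<kappa>_cmp[OF t.C.ide_hom[OF x] k g sg m] t.D.ide_right_hom[OF sg]
          P.D.ide_right_hom[OF \<kappa>_hom[OF x xy(2) sg m]]
        by (simp add: t.farr_ide[OF x] G.farr_ide[OF x])
      finally show "Cmp D (Cmp D (u1 y' m) (FArr (Q G) k)) (P.leg G (FObj s' x') x g)
          = Cmp D (u1 x' (Cmp A3 m (FArr t' k))) (P.leg G (FObj s' x') x g)"
        by (simp only: u1(2)[OF xy(1) mk x g])
    qed
    then show "Cmp D ((\<lambda>(x', m). u1 x' m) (y', m)) (FArr (Q G) k) =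
        (\<lambda>(x', m). u1 x' m) (x', Cmp A3 m (FArr t' k))" by simp
  qed (use u1(1) in auto)
  let ?u = "colim_map (comma_category X' A3 t' a) D (functor_comp (Q G) comma_proj) M (\<lambda>(x', m). u1 x' m)"
  have u_hom: "in_hom D ?u (P'.colim_at (Q G) a) M" by (rule P'.colim_map_hom[OF QG a c'])
  have u_leg: "Cmp D ?u (P'.leg (Q G) a x' m) = u1 x' m" if "x' \<in> Obj X'" "in_hom A3 m (FObj t' x') a" for x' m
    using P'.colim_map_leg[OF QG a c' that] by simp
  \<comment> \<open>Reassociating puts \<open>v\<close> next to the outer leg alone, so that a
    mediating arrow can be tested one level of the colimit at a time.\<close>
  have med: "is_mediating ?K D (P'.colim_at (Q G) a) (iterated_leg G a) M \<kappa> v \<longleftrightarrow>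
      in_hom D v (P'.colim_at (Q G) a) M \<and> (\<forall>x g x' m. x \<in> Obj X \<and> x' \<in> Obj X' \<and>
        in_hom A2 g (FObj t x) (FObj s' x') \<and> in_hom A3 m (FObj t' x') a \<longrightarrow>
        Cmp D (Cmp D v (P'.leg (Q G) a x' m)) (P.leg G (FObj s' x') x g) = \<kappa> ((x, g, x'), m))" for v
  proof -
    have "(Cmp D v (iterated_leg G a ((x, g, x'), m)) = \<kappa> ((x, g, x'), m)) \<longleftrightarrow>
        (Cmp D (Cmp D v (P'.leg (Q G) a x' m)) (P.leg G (FObj s' x') x g) = \<kappa> ((x, g, x'), m))"
      if "in_hom D v (P'.colim_at (Q G) a) M" "x \<in> Obj X" "x' \<in> Obj X'"
        "in_hom A2 g (FObj t x) (FObj s' x')" "in_hom A3 m (FObj t' x') a" for x g x' m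
      using P.D.assoc_hom[OF inner_leg_hom[OF G a that(2-5)] outer_leg_hom[OF G a that(2-5)] that(1)]
      by (simp add: iterated_leg_def)
    then show ?thesis
      unfolding is_mediating_def Ball_def split_paired_All comma_category_obj weak_pullback_obj_iff
      by (auto simp del: precomp_sel)
  qed
  show "\<exists>!u. is_mediating ?K D (P'.colim_at (Q G) a) (iterated_leg G a) M \<kappa> u"
  proof (rule ex1I)
    show "is_mediating ?K D (P'.colim_at (Q G) a) (iterated_leg G a) M \<kappa> ?u"
      unfolding med using u_hom u_leg u1(2) by simp
    fix v assume "is_mediating ?K D (P'.colim_at (Q G) a) (iterated_leg G a) M \<kappa> v"
    then have v_hom: "in_hom D v (P'.colim_at (Q G) a) M"
      and v_leg: "\<And>x g x' m. \<lbrakk>x \<in> Obj X; x' \<in> Obj X'; in_hom A2 g (FObj t x) (FObj s' x');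
        in_hom A3 m (FObj t' x') a\<rbrakk>
        \<Longrightarrow> Cmp D (Cmp D v (P'.leg (Q G) a x' m)) (P.leg G (FObj s' x') x g) = \<kappa> ((x, g, x'), m)"
      by (auto simp only: med)
    show "v = ?u"
    \<comment> \<open>Joint epimorphy is applied twice: to the outer legs here, and to the inner
      legs for each fixed \<open>(x', m)\<close>.\<close>
    proof (rule P'.colim_at_ext[OF QG a v_hom u_hom])
      fix x' m assume x': "x' \<in> Obj X'" and m: "in_hom A3 m (FObj t' x') a"
      have "in_hom D (P'.leg (Q G) a x' m) (FObj (Q G) x') (P'.colim_at (Q G) a)"
        by (rule P'.leg_hom[OF QG a x' m])
      then have "in_hom D (Cmp D v (P'.leg (Q G) a x' m)) (P.colim_at G (FObj s' x')) M"
        using P.D.cmp_hom v_hom by (simp only: Q_obj[OF x'])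
      moreover have "in_hom D (u1 x' m) (P.colim_at G (FObj s' x')) M"
        using u1(1)[OF x' m] by (simp only: Q_obj[OF x'])
      ultimately have "Cmp D v (P'.leg (Q G) a x' m) = u1 x' m"
        by (rule P.colim_at_ext[OF G s'.fobj_in[OF x']]) (simp add: v_leg[OF _ x' _ m] u1(2)[OF x' m])
      then show "Cmp D v (P'.leg (Q G) a x' m) = Cmp D ?u (P'.leg (Q G) a x' m)"
        by (simp add: u_leg[OF x' m])
    qed
  qed
qed

section \<open>The comparison map: invertibility, naturality in the object of \<open>A3\<close> and
  in the functor\<close>

definition comparison where
  "comparison G = (\<lambda>a\<in>Obj A3. colim_map (comma_category W A3 (functor_comp t' weak_pullback_snd) a) D
     (functor_comp (R G) comma_proj) (P'.colim_at (Q G) a) (iterated_leg G a))"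

text \<open>That the iterated legs form a cocone gives the map and its values on legs; that they
  form a colimit makes it a mediating arrow between two colimits of one diagram, hence
  invertible.\<close>

lemma
  assumes G: "cat_functor X D G" and a: "a \<in> Obj A3"
  shows comparison_hom: "in_hom D (comparison G a) (PW.colim_at (R G) a) (P'.colim_at (Q G) a)"
    and comparison_leg: "\<lbrakk>x \<in> Obj X; x' \<in> Obj X'; in_hom A2 g (FObj t x) (FObj s' x');
      in_hom A3 m (FObj t' x') a\<rbrakk> \<Longrightarrow> Cmp D (comparison G a) (PW.leg (R G) a (x, g, x') m) =
        Cmp D (P'.leg (Q G) a x' m) (P.leg G (FObj s' x') x g)"
    and comparison_iso: "is_iso D (comparison G a)"
proof -
  have med: "is_mediating (comma_category W A3 (functor_comp t' weak_pullback_snd) a) D (PW.colim_at (R G) a)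
    (colim_leg (comma_category W A3 (functor_comp t' weak_pullback_snd) a) D (functor_comp (R G) comma_proj))
    (P'.colim_at (Q G) a) (iterated_leg G a) (comparison G a)"
    using is_mediating_colim_map[OF PW.colimits[OF R_functor[OF G] a] iterated_leg_cocone[OF G a]] a
    by (simp add: comparison_def)
  then show "in_hom D (comparison G a) (PW.colim_at (R G) a) (P'.colim_at (Q G) a)"
    by (simp add: is_mediating_def)
  show "Cmp D (comparison G a) (PW.leg (R G) a (x, g, x') m) =
        Cmp D (P'.leg (Q G) a x' m) (P.leg G (FObj s' x') x g)"
    if "x \<in> Obj X" "x' \<in> Obj X'" "in_hom A2 g (FObj t x) (FObj s' x')" "in_hom A3 m (FObj t' x') a"
    using med[unfolded is_mediating_def, THEN conjunct2, THEN bspec, of "((x, g, x'), m)"] that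
    by (simp add: iterated_leg_def)
  show "is_iso D (comparison G a)"
    by (rule colimit_mediating_iso[OF PW.is_colimit_at[OF R_functor[OF G] a] iterated_leg_colimit[OF G a] med])
qed

lemma R_colim_ext:
  assumes G: "cat_functor X D G" and a: "a \<in> Obj A3"
    and "in_hom D u (PW.colim_at (R G) a) M" "in_hom D v (PW.colim_at (R G) a) M"
    and "\<And>x g x' m. \<lbrakk>x \<in> Obj X; x' \<in> Obj X'; in_hom A2 g (FObj t x) (FObj s' x'); in_hom A3 m (FObj t' x') a\<rbrakk>
      \<Longrightarrow> Cmp D u (PW.leg (R G) a (x, g, x') m) = Cmp D v (PW.leg (R G) a (x, g, x') m)"
  shows "u = v"
proof (rule PW.colim_at_ext[OF R_functor[OF G] a assms(3,4)])
  fix w m assume "w \<in> Obj W" "in_hom A3 m (FObj (functor_comp t' weak_pullback_snd) w) a"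
  moreover obtain x g x' where "w = (x, g, x')" by (metis surj_pair)
  ultimately show "Cmp D u (PW.leg (R G) a w m) = Cmp D v (PW.leg (R G) a w m)"
    by (simp add: assms(5))
qed

lemma R_leg_hom:
  assumes G: "cat_functor X D G" and a: "a \<in> Obj A3"
    and x: "x \<in> Obj X" "x' \<in> Obj X'" "in_hom A2 g (FObj t x) (FObj s' x')" "in_hom A3 m (FObj t' x') a"
  shows "in_hom D (PW.leg (R G) a (x, g, x') m) (FObj G x) (PW.colim_at (R G) a)"
  using PW.leg_hom[OF R_functor[OF G] a, of "(x, g, x')" m] x by simp

text \<open>Naturality in the object of \<open>A3\<close>. On the leg at
  \<open>((x, g, x'), m)\<close> both sides become the inner leg at \<open>(x, g)\<close> followed
  by the outer leg at \<open>(x', Cmp A3 n m)\<close>.\<close>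

lemma comparison_nat_trans:
  assumes G: "cat_functor X D G"
  shows "nat_trans A3 D (PW.push (R G)) (P'.push (Q G)) (comparison G)"
proof (rule nat_transI[OF PW.push_functor[OF R_functor[OF G]] P'.push_functor[OF Q_functor[OF G]]])
  show "in_hom D (comparison G a) (FObj (PW.push (R G)) a) (FObj (P'.push (Q G)) a)" if "a \<in> Obj A3" for a
    using comparison_hom[OF G that] that by (simp add: PW.push_obj_sel P'.push_obj_sel)
  fix n a b assume n: "in_hom A3 n a b"
  have ab: "a \<in> Obj A3" "b \<in> Obj A3" using P'.f.D.hom_obj[OF n] by auto
  note RG = R_functor[OF G] and QG = Q_functor[OF G]
  note hs = PW.push_arr_hom[OF RG n] P'.push_arr_hom[OF QG n] comparison_hom[OF G ab(1)] comparison_hom[OF G ab(2)]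
  show "Cmp D (comparison G b) (FArr (PW.push (R G)) n) = Cmp D (FArr (P'.push (Q G)) n) (comparison G a)"
  proof (rule R_colim_ext[OF G ab(1) P.D.cmp_hom[OF hs(1,4)] P.D.cmp_hom[OF hs(3,2)]])
    fix x g x' m assume x: "x \<in> Obj X" "x' \<in> Obj X'" "in_hom A2 g (FObj t x) (FObj s' x')"
      and m: "in_hom A3 m (FObj t' x') a"
    note nm = P'.f.D.cmp_hom[OF m n]
    have "Cmp D (Cmp D (comparison G b) (FArr (PW.push (R G)) n)) (PW.leg (R G) a (x, g, x') m)
        = Cmp D (comparison G b) (Cmp D (FArr (PW.push (R G)) n) (PW.leg (R G) a (x, g, x') m))"
      using P.D.assoc_hom[OF R_leg_hom[OF G ab(1) x m] hs(1,4)] by simp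
    also have "Cmp D (FArr (PW.push (R G)) n) (PW.leg (R G) a (x, g, x') m) = PW.leg (R G) b (x, g, x') (Cmp A3 n m)"
      by (rule PW.push_arr_leg[OF RG n]) (use x m in simp_all)
    also have "Cmp D (comparison G b) (PW.leg (R G) b (x, g, x') (Cmp A3 n m))
        = Cmp D (P'.leg (Q G) b x' (Cmp A3 n m)) (P.leg G (FObj s' x') x g)"
      by (rule comparison_leg[OF G ab(2) x nm])
    also have "P'.leg (Q G) b x' (Cmp A3 n m) = Cmp D (FArr (P'.push (Q G)) n) (P'.leg (Q G) a x' m)"
      using P'.push_arr_leg[OF QG n x(2) m] by simp
    also have "Cmp D \<dots> (P.leg G (FObj s' x') x g) =
        Cmp D (FArr (P'.push (Q G)) n) (Cmp D (P'.leg (Q G) a x' m) (P.leg G (FObj s' x') x g))"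
      using P.D.assoc_hom[OF inner_leg_hom[OF G ab(1) x m] outer_leg_hom[OF G ab(1) x m] hs(2)] by simp
    also have "\<dots> = Cmp D (FArr (P'.push (Q G)) n) (Cmp D (comparison G a) (PW.leg (R G) a (x, g, x') m))"
      by (simp only: comparison_leg[OF G ab(1) x m])
    also have "\<dots> = Cmp D (Cmp D (FArr (P'.push (Q G)) n) (comparison G a)) (PW.leg (R G) a (x, g, x') m)"
      by (rule P.D.assoc_hom[OF R_leg_hom[OF G ab(1) x m] hs(3,2)])
    finally show "Cmp D (Cmp D (comparison G b) (FArr (PW.push (R G)) n)) (PW.leg (R G) a (x, g, x') m) =
      Cmp D (Cmp D (FArr (P'.push (Q G)) n) (comparison G a)) (PW.leg (R G) a (x, g, x') m)" .
  qed
qed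

text \<open>Naturality in the functor \<open>G\<close>. On the leg at \<open>((x, g, x'), m)\<close>
  both sides become \<open>\<tau> x\<close> followed by the inner and outer legs for
  \<open>H\<close>: on the right, \<open>\<tau>\<close> passes first through the outer colimit and
  then through the inner one.\<close>

lemma comparison_natural:
  assumes \<tau>: "nat_trans X D G H \<tau>" and a: "a \<in> Obj A3"
  shows "Cmp D (comparison H a) (PW.push_trans (R G) (R H) (\<lambda>w\<in>Obj W. \<tau> (FObj fst_W w)) a)
    = Cmp D (P'.push_trans (Q G) (Q H) (\<lambda>x'\<in>Obj X'. P.push_trans G H \<tau> (FObj s' x')) a) (comparison G a)"
proof -
  interpret \<tau>: nat_trans X D G H \<tau> by fact
  note G = \<tau>.F.cat_functor_axioms and H = \<tau>.G.cat_functor_axioms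
  let ?R = "\<lambda>w\<in>Obj W. \<tau> (FObj fst_W w)"
  let ?Q = "\<lambda>x'\<in>Obj X'. P.push_trans G H \<tau> (FObj s' x')"
  have R: "nat_trans W D (R G) (R H) ?R" by (rule precomp_nat_trans[OF weak_pullback_fst_functor \<tau>])
  have Q: "nat_trans X' D (Q G) (Q H) ?Q"
    by (rule precomp_nat_trans[OF s'.cat_functor_axioms P.push_trans_nat_trans[OF \<tau>]])
  note hs = PW.push_trans_hom[OF R a] P'.push_trans_hom[OF Q a] comparison_hom[OF G a] comparison_hom[OF H a]
  show ?thesis
  proof (rule R_colim_ext[OF G a P.D.cmp_hom[OF hs(1,4)] P.D.cmp_hom[OF hs(3,2)]])
    fix x g x' m assume x: "x \<in> Obj X" "x' \<in> Obj X'" "in_hom A2 g (FObj t x) (FObj s' x')"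
      and m: "in_hom A3 m (FObj t' x') a"
    have w: "(x, g, x') \<in> Obj W" using x by simp
    note inner = inner_leg_hom[OF _ a x m] and outer = outer_leg_hom[OF _ a x m] and sx = s'.fobj_in[OF x(2)]
    have Qh: "in_hom D (?Q x') (FObj (Q G) x') (FObj (Q H) x')"
      by (rule nat_trans.component[OF Q x(2)])
    have "Cmp D (Cmp D (comparison H a) (PW.push_trans (R G) (R H) ?R a)) (PW.leg (R G) a (x, g, x') m)
        = Cmp D (comparison H a) (Cmp D (PW.push_trans (R G) (R H) ?R a) (PW.leg (R G) a (x, g, x') m))"
      using P.D.assoc_hom[OF R_leg_hom[OF G a x m] hs(1,4)] by (simp only:)
    also have "Cmp D (PW.push_trans (R G) (R H) ?R a) (PW.leg (R G) a (x, g, x') m) =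
        Cmp D (PW.leg (R H) a (x, g, x') m) (?R (x, g, x'))"
      by (rule PW.push_trans_leg[OF R a w]) (use m in simp)
    also have "?R (x, g, x') = \<tau> x" using w by simp
    also have "Cmp D (comparison H a) (Cmp D (PW.leg (R H) a (x, g, x') m) (\<tau> x))
        = Cmp D (Cmp D (comparison H a) (PW.leg (R H) a (x, g, x') m)) (\<tau> x)"
      by (rule P.D.assoc_hom[OF \<tau>.component[OF x(1)] R_leg_hom[OF H a x m] hs(4)])
    also have "\<dots> = Cmp D (Cmp D (P'.leg (Q H) a x' m) (P.leg H (FObj s' x') x g)) (\<tau> x)"
      by (simp only: comparison_leg[OF H a x m])
    also have "\<dots> = Cmp D (P'.leg (Q H) a x' m) (Cmp D (P.leg H (FObj s' x') x g) (\<tau> x))"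
      using P.D.assoc_hom[OF \<tau>.component[OF x(1)] inner[OF H] outer[OF H]] by simp
    also have "Cmp D (P.leg H (FObj s' x') x g) (\<tau> x) = Cmp D (?Q x') (P.leg G (FObj s' x') x g)"
      using P.push_trans_leg[OF \<tau> sx x(1,3)] x(2) by (simp only: restrict_apply')
    also have "Cmp D (P'.leg (Q H) a x' m) (Cmp D (?Q x') (P.leg G (FObj s' x') x g))
        = Cmp D (Cmp D (P'.leg (Q H) a x' m) (?Q x')) (P.leg G (FObj s' x') x g)"
      by (rule P.D.assoc_hom[OF inner[OF G] Qh outer[OF H]])
    also have "Cmp D (P'.leg (Q H) a x' m) (?Q x') =
        Cmp D (P'.push_trans (Q G) (Q H) ?Q a) (P'.leg (Q G) a x' m)"
      by (rule P'.push_trans_leg[OF Q a x(2) m, symmetric])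
    also have "Cmp D \<dots> (P.leg G (FObj s' x') x g) = Cmp D (P'.push_trans (Q G) (Q H) ?Q a)
        (Cmp D (P'.leg (Q G) a x' m) (P.leg G (FObj s' x') x g))"
      by (rule P.D.assoc_hom[OF inner[OF G] outer[OF G] hs(2), symmetric])
    also have "\<dots> = Cmp D (P'.push_trans (Q G) (Q H) ?Q a) (Cmp D (comparison G a) (PW.leg (R G) a (x, g, x') m))"
      by (simp only: comparison_leg[OF G a x m])
    also have "\<dots> = Cmp D (Cmp D (P'.push_trans (Q G) (Q H) ?Q a) (comparison G a)) (PW.leg (R G) a (x, g, x') m)"
      by (rule P.D.assoc_hom[OF R_leg_hom[OF G a x m] hs(3,2)])
    finally show "Cmp D (Cmp D (comparison H a) (PW.push_trans (R G) (R H) ?R a)) (PW.leg (R G) a (x, g, x') m) =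
      Cmp D (Cmp D (P'.push_trans (Q G) (Q H) ?Q a) (comparison G a)) (PW.leg (R G) a (x, g, x') m)" .
  qed
qed

text \<open>Naturality in the object of \<open>A3\<close> makes each component an arrow of the
  functor category, naturality in \<open>G\<close> makes the family a transformation, and
  invertibility is checked pointwise.\<close>

theorem base_change_iso:
  "nat_iso (functor_category X D) (functor_category A3 D)
    (functor_comp (pushforward_functor W A3 D (functor_comp t' weak_pullback_snd))
      (pullback_functor W weak_pullback_fst))
    (functor_comp (functor_comp (pushforward_functor X' A3 D t') (pullback_functor X' s'))
      (pushforward_functor X A2 D t))
    (\<lambda>G. (PW.push (R G), comparison G, P'.push (Q G)))"
proof -
  have D: "category D" by unfold_locales
  have hom: "in_hom (functor_category A3 D) (PW.push (R G), comparison G, P'.push (Q G))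
      (PW.push (R G)) (P'.push (Q G))" if "G \<in> Obj (functor_category X D)" for G
  proof -
    from that have "cat_functor X D G" by (simp add: functor_category_obj)
    moreover from that have "PW.push (R G) \<in> Obj (functor_category A3 D)"
      "P'.push (Q G) \<in> Obj (functor_category A3 D)"
      by (auto intro!: PW.push_obj P'.push_obj P.push_obj precomp_obj weak_pullback_fst_functor
          s'.cat_functor_axioms)
    moreover have "comparison G \<in> extensional (Obj A3)" by (simp add: comparison_def)
    ultimately show ?thesis
      by (simp add: functor_category_hom comparison_nat_trans)
  qed
  show ?thesis
  proof (intro nat_iso.intro nat_transI nat_iso_axioms.intro)
    show "cat_functor (functor_category X D) (functor_category A3 D)
      (functor_comp (pushforward_functor W A3 D (functor_comp t' weak_pullback_snd))
        (pullback_functor W weak_pullback_fst))"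
      by (rule cat_functor_comp[OF pullback_functor_functor[OF weak_pullback_fst_functor D]
          PW.pushforward_functor_functor])
    show "cat_functor (functor_category X D) (functor_category A3 D)
      (functor_comp (functor_comp (pushforward_functor X' A3 D t') (pullback_functor X' s'))
        (pushforward_functor X A2 D t))"
      by (rule cat_functor_comp[OF P.pushforward_functor_functor
          cat_functor_comp[OF pullback_functor_functor[OF s'.cat_functor_axioms D]
            P'.pushforward_functor_functor]])
  next
    fix m G H assume "in_hom (functor_category X D) m G H"
    then obtain \<tau> where m: "m = (G, \<tau>, H)" and \<tau>: "nat_trans X D G H \<tau>"
      by (auto simp: functor_category_hom)
    show "Cmp (functor_category A3 D) (PW.push (R H), comparison H, P'.push (Q H))
        (FArr (functor_comp (pushforward_functor W A3 D (functor_comp t' weak_pullback_snd))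
          (pullback_functor W weak_pullback_fst)) m) =
      Cmp (functor_category A3 D)
        (FArr (functor_comp (functor_comp (pushforward_functor X' A3 D t') (pullback_functor X' s'))
          (pushforward_functor X A2 D t)) m) (PW.push (R G), comparison G, P'.push (Q G))"
      using comparison_natural[OF \<tau>] by (simp add: m cong: restrict_cong)
  next
    fix G assume G: "G \<in> Obj (functor_category X D)"
    then show "is_iso (functor_category A3 D) (PW.push (R G), comparison G, P'.push (Q G))"
      by (intro functor_category_iso hom) (simp_all add: comparison_iso functor_category_obj)
  qed (simp add: hom)
qed

end

section \<open>Whiskering and replacing functors in natural isomorphisms\<close>

lemma nat_iso_whisker:
  assumes K: "cat_functor C D K" and \<beta>: "nat_iso D E F G \<beta>"
  shows "nat_iso C E (functor_comp F K) (functor_comp G K) (\<beta> \<circ> FObj K)"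
proof -
  interpret K: cat_functor C D K by fact
  interpret \<beta>: nat_iso D E F G \<beta> by fact
  show ?thesis
    by (intro nat_iso.intro nat_transI nat_iso_axioms.intro cat_functor_comp[OF K]
        \<beta>.F.cat_functor_axioms \<beta>.G.cat_functor_axioms)
      (simp_all add: K.fobj_in \<beta>.component \<beta>.component_iso \<beta>.naturality_hom[OF K.farr_hom])
qed

lemma nat_iso_cong:
  assumes "nat_iso C D F G \<beta>"
    and "\<And>x. x \<in> Obj C \<Longrightarrow> FObj F' x = FObj F x" "\<And>m x y. in_hom C m x y \<Longrightarrow> FArr F' m = FArr F m"
  shows "nat_iso C D F' G \<beta>"
proof -
  interpret nat_iso C D F G \<beta> by fact
  have "cat_functor C D F'"
    by (rule cat_functor_cong[OF F.cat_functor_axioms assms(2)]) (use assms(3) F.C.arr_hom in blast)+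
  then show ?thesis
    by (intro nat_iso.intro nat_transI nat_iso_axioms.intro G.cat_functor_axioms)
      (simp_all add: assms(2,3) component component_iso naturality_hom)
qed

section \<open>Linear maps\<close>

lemma linear_mapI:
  assumes "vectorspace K V" "vectorspace K W"
    and "\<And>v. v \<in> carrier V \<Longrightarrow> T v \<in> carrier W"
    and "\<And>v w. \<lbrakk>v \<in> carrier V; w \<in> carrier V\<rbrakk> \<Longrightarrow> T (v \<oplus>\<^bsub>V\<^esub> w) = T v \<oplus>\<^bsub>W\<^esub> T w"
    and "\<And>c v. \<lbrakk>c \<in> carrier K; v \<in> carrier V\<rbrakk> \<Longrightarrow> T (c \<odot>\<^bsub>V\<^esub> v) = c \<odot>\<^bsub>W\<^esub> T v"
  shows "linear_map K V W T"
  using assms by (auto simp: linear_map_def mod_hom_def mod_hom_axioms_def LinearCombinations.module_hom_def vectorspace_def)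

lemma linear_mapD:
  assumes "linear_map K V W T"
  shows "vectorspace K V" "vectorspace K W"
    and "\<And>v. v \<in> carrier V \<Longrightarrow> T v \<in> carrier W"
    and "\<And>v w. \<lbrakk>v \<in> carrier V; w \<in> carrier V\<rbrakk> \<Longrightarrow> T (v \<oplus>\<^bsub>V\<^esub> w) = T v \<oplus>\<^bsub>W\<^esub> T w"
    and "\<And>c v. \<lbrakk>c \<in> carrier K; v \<in> carrier V\<rbrakk> \<Longrightarrow> T (c \<odot>\<^bsub>V\<^esub> v) = c \<odot>\<^bsub>W\<^esub> T v"
  using assms by (auto simp: linear_map_def mod_hom_def mod_hom_axioms_def LinearCombinations.module_hom_def)

lemma vectorspace_closed:
  assumes "vectorspace K V"
  shows "\<lbrakk>v \<in> carrier V; w \<in> carrier V\<rbrakk> \<Longrightarrow> v \<oplus>\<^bsub>V\<^esub> w \<in> carrier V"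
    and "\<lbrakk>c \<in> carrier K; v \<in> carrier V\<rbrakk> \<Longrightarrow> c \<odot>\<^bsub>V\<^esub> v \<in> carrier V"
    and "\<zero>\<^bsub>V\<^esub> \<in> carrier V"
proof -
  interpret vectorspace K V by fact
  show "\<lbrakk>v \<in> carrier V; w \<in> carrier V\<rbrakk> \<Longrightarrow> v \<oplus>\<^bsub>V\<^esub> w \<in> carrier V"
    "\<lbrakk>c \<in> carrier K; v \<in> carrier V\<rbrakk> \<Longrightarrow> c \<odot>\<^bsub>V\<^esub> v \<in> carrier V" "\<zero>\<^bsub>V\<^esub> \<in> carrier V"
    by auto
qed

lemma linear_map_compose:
  assumes "linear_map K U V T" "linear_map K V W S" and "\<And>v. v \<in> carrier U \<Longrightarrow> R v = S (T v)"
  shows "linear_map K U W R"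
  using linear_mapD[OF assms(1)] linear_mapD[OF assms(2)] assms(3)
  by (intro linear_mapI) (simp_all add: vectorspace_closed)

lemma linear_map_id:
  assumes "vectorspace K V" shows "linear_map K V V (\<lambda>v\<in>carrier V. v)"
  by (intro linear_mapI assms) (simp_all add: vectorspace_closed[OF assms])

lemma linear_map_inverse:
  assumes T: "linear_map K V W T" and bij: "bij_betw T (carrier V) (carrier W)"
  shows "linear_map K W V (the_inv_into (carrier V) T)"
proof (rule linear_mapI)
  note D = linear_mapD[OF T]
  have inj: "inj_on T (carrier V)" and surj: "T ` carrier V = carrier W"
    using bij by (auto simp: bij_betw_def)
  have inv: "the_inv_into (carrier V) T w \<in> carrier V" "T (the_inv_into (carrier V) T w) = w"
    if "w \<in> carrier W" for w
    using that surj by (auto intro!: the_inv_into_into[OF inj] f_the_inv_into_f[OF inj])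
  show "the_inv_into (carrier V) T w \<in> carrier V" if "w \<in> carrier W" for w by (fact inv(1)[OF that])
  show "the_inv_into (carrier V) T (v \<oplus>\<^bsub>W\<^esub> w) = the_inv_into (carrier V) T v \<oplus>\<^bsub>V\<^esub> the_inv_into (carrier V) T w"
    if "v \<in> carrier W" "w \<in> carrier W" for v w
    by (rule the_inv_into_f_eq[OF inj]) (simp_all add: that D inv vectorspace_closed[OF D(1)])
  show "the_inv_into (carrier V) T (c \<odot>\<^bsub>W\<^esub> w) = c \<odot>\<^bsub>V\<^esub> the_inv_into (carrier V) T w"
    if "c \<in> carrier K" "w \<in> carrier W" for c w
    by (rule the_inv_into_f_eq[OF inj]) (simp_all add: that D inv vectorspace_closed[OF D(1)])
qed (use linear_mapD[OF T] in auto)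

section \<open>Spans, dimension estimates and transport of vector spaces between types\<close>

abbreviation span_of where "span_of K V \<equiv> LinearCombinations.module.span K V"

lemma submodule_image:
  assumes T: "linear_map K V W T" and N: "submodule K N V"
  shows "submodule K (T ` N) W"
proof -
  interpret V: vectorspace K V using linear_mapD(1)[OF T] .
  interpret W: vectorspace K W using linear_mapD(2)[OF T] .
  interpret linear_map K V W T by fact
  interpret N: submodule K N V by fact
  show ?thesis
  proof
    show "\<zero>\<^bsub>W\<^esub> \<in> T ` N" using N.zero_closed T0_is_0 by (metis imageI)
    show "v \<oplus>\<^bsub>W\<^esub> w \<in> T ` N" if "v \<in> T ` N" "w \<in> T ` N" for v w
    proof -
      from that obtain a b where "a \<in> N" "b \<in> N" "v = T a" "w = T b" by auto
      moreover from this N.subset have "a \<in> carrier V" "b \<in> carrier V" by auto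
      ultimately have "v \<oplus>\<^bsub>W\<^esub> w = T (a \<oplus>\<^bsub>V\<^esub> b)" "a \<oplus>\<^bsub>V\<^esub> b \<in> N" by simp_all
      then show ?thesis by blast
    qed
    show "c \<odot>\<^bsub>W\<^esub> v \<in> T ` N" if "c \<in> carrier K" "v \<in> T ` N" for c v
    proof -
      from that obtain a where "a \<in> N" "v = T a" by auto
      moreover from this N.subset have "a \<in> carrier V" by auto
      ultimately have "c \<odot>\<^bsub>W\<^esub> v = T (c \<odot>\<^bsub>V\<^esub> a)" "c \<odot>\<^bsub>V\<^esub> a \<in> N" using that by simp_all
      then show ?thesis by blast
    qed
  qed (use N.subset in auto)
qed

lemma submodule_preimage:
  assumes T: "linear_map K V W T" and N: "submodule K N W"
  shows "submodule K {v \<in> carrier V. T v \<in> N} V"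
proof -
  interpret V: vectorspace K V using linear_mapD(1)[OF T] .
  interpret W: vectorspace K W using linear_mapD(2)[OF T] .
  interpret linear_map K V W T by fact
  interpret N: submodule K N W by fact
  show ?thesis by unfold_locales auto
qed

text \<open>Each inclusion is minimality of a span, applied to the image of a submodule in one
  direction and to the preimage of one in the other.\<close>

lemma span_image:
  assumes T: "linear_map K V W T" and E: "E \<subseteq> carrier V"
  shows "span_of K W (T ` E) = T ` span_of K V E"
proof -
  interpret V: vectorspace K V using linear_mapD(1)[OF T] .
  interpret W: vectorspace K W using linear_mapD(2)[OF T] .
  interpret linear_map K V W T by fact
  have TE: "T ` E \<subseteq> carrier W" using E by auto
  show ?thesis
  proof
    show "span_of K W (T ` E) \<subseteq> T ` span_of K V E"
      using E by (intro W.span_is_subset submodule_image[OF T] V.span_is_submodule)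
        (use V.in_own_span in blast)+
    have "span_of K V E \<subseteq> {v \<in> carrier V. T v \<in> span_of K W (T ` E)}"
      by (intro V.span_is_subset submodule_preimage[OF T] W.span_is_submodule TE)
        (use E W.in_own_span[OF TE] in auto)
    then show "T ` span_of K V E \<subseteq> span_of K W (T ` E)" by auto
  qed
qed

text \<open>The equalizer of two linear maps is a submodule, so it contains the span as soon as it
  contains \<open>E\<close>.\<close>

lemma linear_map_eq_on_span:
  assumes S: "linear_map K V W S" and T: "linear_map K V W T" and E: "E \<subseteq> carrier V"
    and eq: "\<And>v. v \<in> E \<Longrightarrow> S v = T v" and v: "v \<in> span_of K V E"
  shows "S v = T v"
proof -
  interpret V: vectorspace K V using linear_mapD(1)[OF T] .
  interpret S: linear_map K V W S by fact
  interpret T: linear_map K V W T by fact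
  have "submodule K {v \<in> carrier V. S v = T v} V"
    by unfold_locales auto
  then have "span_of K V E \<subseteq> {v \<in> carrier V. S v = T v}"
    by (rule V.span_is_subset[rotated]) (use E eq in auto)
  with v show ?thesis by auto
qed

text \<open>Steinitz exchange: a nonzero \<open>v\<close> in the kernel replaces a member of a
  basis, leaving a set \<open>C\<close> with fewer elements than the basis such that
  \<open>v\<close> and \<open>C\<close> generate \<open>V\<close>. As \<open>T\<close> kills
  \<open>v\<close>, the image of \<open>C\<close> alone generates \<open>W\<close>, so
  \<open>W\<close> would have smaller dimension than \<open>V\<close>.\<close>

lemma linear_map_inj_of_surj:
  assumes T: "linear_map K V W T" and fin: "vectorspace.fin_dim K V"
    and surj: "T ` carrier V = carrier W" and dim: "vectorspace.dim K V \<le> vectorspace.dim K W"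
  shows "inj_on T (carrier V)"
proof -
  interpret V: vectorspace K V using linear_mapD(1)[OF T] .
  interpret W: vectorspace K W using linear_mapD(2)[OF T] .
  interpret linear_map K V W T by fact
  obtain B where B: "finite B" "V.basis B" using V.finite_basis_exists[OF fin] by blast
  then have BV: "B \<subseteq> carrier V" and Bspan: "V.gen_set B" by (auto simp: V.basis_def)
  have card_B: "card B = V.dim" using V.dim_basis[OF B] by simp
  have "v = \<zero>\<^bsub>V\<^esub>" if v: "v \<in> carrier V" "T v = \<zero>\<^bsub>W\<^esub>" for v
  proof (rule ccontr)
    assume "v \<noteq> \<zero>\<^bsub>V\<^esub>"
    moreover have "V.lin_indpt {}" by (simp add: V.lin_dep_def)
    ultimately have "V.lin_indpt {v}"
      using V.lin_dep_iff_in_span[of "{}" v] v(1) V.span_empty by simp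
    then obtain C where C: "finite C" "C \<subseteq> carrier V" "int (card C) \<le> int (card B) - 1"
      "span_of K V ({v} \<union> C) = carrier V"
      using V.replacement[of "{v}" B] B(1) BV v(1) Bspan by auto
    have TC: "T ` C \<subseteq> carrier W" using C(2) by auto
    have "W.gen_set (T ` ({v} \<union> C))"
      using span_image[OF T, of "{v} \<union> C"] C(2,4) v(1) surj by simp
    then have "W.gen_set (T ` C \<union> {\<zero>\<^bsub>W\<^esub>})" using v(2) by simp
    then have "W.gen_set (T ` C)"
      using W.already_in_span[OF TC W.span_zero] by simp
    then have "W.dim \<le> card (T ` C)" using W.gen_ge_dim[OF finite_imageI[OF C(1)] TC] by simp
    also have "\<dots> \<le> card C" using C(1) by (rule card_image_le)
    finally show False using C(3) card_B dim by simp
  qed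
  then have "carrier (V.vs kerT) = {\<zero>\<^bsub>V\<^esub>}" by (auto simp: ker_def)
  then show ?thesis by (rule Ke0_imp_inj)
qed

text \<open>Bases of the finitely many spaces \<open>U i\<close> with \<open>i\<close> in
  \<open>S\<close> map to a generating set. The resulting bound does not mention \<open>W\<close>;
  this uniformity is what allows a generated cocone of largest dimension to be chosen.\<close>

lemma fin_dim_generated:
  assumes W: "vectorspace K W"
    and f: "\<And>j. j \<in> I \<Longrightarrow> linear_map K (U j) W (f j)"
    and fin: "\<And>j. j \<in> I \<Longrightarrow> vectorspace.fin_dim K (U j)"
    and S: "finite S" "S \<subseteq> I"
    and cofinal: "\<And>j. j \<in> I \<Longrightarrow> \<exists>i\<in>S. f j ` carrier (U j) \<subseteq> f i ` carrier (U i)"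
    and gen: "span_of K W (\<Union>j\<in>I. f j ` carrier (U j)) = carrier W"
  shows "vectorspace.fin_dim K W" and "vectorspace.dim K W \<le> (\<Sum>i\<in>S. vectorspace.dim K (U i))"
proof -
  interpret W: vectorspace K W by fact
  have "\<exists>B. finite B \<and> B \<subseteq> carrier (U i) \<and> span_of K (U i) B = carrier (U i) \<and>
      card B = vectorspace.dim K (U i)" if i: "i \<in> I" for i
  proof -
    interpret U: vectorspace K "U i" using linear_mapD(1)[OF f[OF i]] .
    obtain B where B: "finite B" "U.basis B" using U.finite_basis_exists[OF fin[OF i]] by blast
    then show ?thesis using U.dim_basis[OF B] by (auto simp: U.basis_def)
  qed
  then obtain B where B: "\<And>i. i \<in> I \<Longrightarrow> finite (B i) \<and> B i \<subseteq> carrier (U i) \<and>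
      span_of K (U i) (B i) = carrier (U i) \<and> card (B i) = vectorspace.dim K (U i)" by metis
  define E where "E = (\<Union>i\<in>S. f i ` B i)"
  have finE: "finite E" using S B by (auto simp: E_def)
  have "f i ` B i \<subseteq> carrier W" if "i \<in> I" for i
    using B[OF that] linear_mapD(3)[OF f[OF that]] by blast
  then have EW: "E \<subseteq> carrier W" using S(2) by (auto simp: E_def)
  have "f j ` carrier (U j) \<subseteq> span_of K W E" if j: "j \<in> I" for j
  proof -
    obtain i where i: "i \<in> S" "f j ` carrier (U j) \<subseteq> f i ` carrier (U i)" using cofinal[OF j] by auto
    then have iI: "i \<in> I" using S(2) by auto
    have "f i ` carrier (U i) = span_of K W (f i ` B i)"
      using span_image[OF f[OF iI], of "B i"] B[OF iI] by simp
    also have "\<dots> \<subseteq> span_of K W E"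
      using i(1) by (intro W.span_is_monotone) (auto simp: E_def)
    finally show ?thesis using i(2) by blast
  qed
  then have "span_of K W (\<Union>j\<in>I. f j ` carrier (U j)) \<subseteq> span_of K W E"
    by (intro W.span_is_subset W.span_is_submodule[OF EW]) blast
  then have EG: "W.gen_set E" using gen W.span_is_subset2[OF EW] by simp
  show "vectorspace.fin_dim K W" unfolding W.fin_dim_def using finE EW EG by blast
  have "W.dim \<le> card E" by (rule W.gen_ge_dim[OF finE EW EG])
  also have "\<dots> \<le> (\<Sum>i\<in>S. card (f i ` B i))"
    unfolding E_def by (rule card_UN_le[OF S(1)])
  also have "\<dots> \<le> (\<Sum>i\<in>S. vectorspace.dim K (U i))"
    using S(2) B by (intro sum_mono) (metis card_image_le subsetD)
  finally show "W.dim \<le> (\<Sum>i\<in>S. vectorspace.dim K (U i))" .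
qed

text \<open>Transport of structure along an injection. It brings a space built on pairs back into
  the universe \<open>'v\<close>. The ring fields \<open>mult\<close> and \<open>one\<close> carry
  no information in a module.\<close>

definition transport :: "('a \<Rightarrow> 'b) \<Rightarrow> ('k, 'a) module \<Rightarrow> ('k, 'b) module" where
  "transport \<phi> V = (let \<psi> = the_inv_into (carrier V) \<phi> in
    \<lparr>carrier = \<phi> ` carrier V, mult = undefined, one = undefined, zero = \<phi> \<zero>\<^bsub>V\<^esub>,
     add = \<lambda>v w. \<phi> (\<psi> v \<oplus>\<^bsub>V\<^esub> \<psi> w), smult = \<lambda>c v. \<phi> (c \<odot>\<^bsub>V\<^esub> \<psi> v)\<rparr>)"

lemma transport_sel:
  assumes "inj_on \<phi> (carrier V)"
  shows "carrier (transport \<phi> V) = \<phi> ` carrier V" "\<zero>\<^bsub>transport \<phi> V\<^esub> = \<phi> \<zero>\<^bsub>V\<^esub>"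
    "\<lbrakk>v \<in> carrier V; w \<in> carrier V\<rbrakk> \<Longrightarrow> \<phi> v \<oplus>\<^bsub>transport \<phi> V\<^esub> \<phi> w = \<phi> (v \<oplus>\<^bsub>V\<^esub> w)"
    "v \<in> carrier V \<Longrightarrow> c \<odot>\<^bsub>transport \<phi> V\<^esub> \<phi> v = \<phi> (c \<odot>\<^bsub>V\<^esub> v)"
  by (simp_all add: transport_def Let_def the_inv_into_f_f[OF assms])

lemma transport_vectorspace:
  assumes V: "vectorspace K V" and inj: "inj_on \<phi> (carrier V)"
  shows "vectorspace K (transport \<phi> V)"
proof -
  interpret V: vectorspace K V by fact
  note sel = transport_sel[OF inj]
  show ?thesis
  proof (rule vs_criteria)
    show "\<forall>v\<in>carrier (transport \<phi> V). \<exists>w\<in>carrier (transport \<phi> V). v \<oplus>\<^bsub>transport \<phi> V\<^esub> w = \<zero>\<^bsub>transport \<phi> V\<^esub>"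
    proof
      fix v assume "v \<in> carrier (transport \<phi> V)"
      then obtain x where x: "x \<in> carrier V" "v = \<phi> x" by (auto simp: sel)
      then have "v \<oplus>\<^bsub>transport \<phi> V\<^esub> \<phi> (\<ominus>\<^bsub>V\<^esub> x) = \<zero>\<^bsub>transport \<phi> V\<^esub>" by (simp add: sel V.M.r_neg)
      moreover have "\<phi> (\<ominus>\<^bsub>V\<^esub> x) \<in> carrier (transport \<phi> V)" using x by (simp add: sel)
      ultimately show "\<exists>w\<in>carrier (transport \<phi> V). v \<oplus>\<^bsub>transport \<phi> V\<^esub> w = \<zero>\<^bsub>transport \<phi> V\<^esub>" by blast
    qed
  qed (auto simp: sel V.M.a_ac V.smult_l_distr V.smult_r_distr V.smult_assoc1 V.field.field_axioms
      intro: V.field_axioms)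
qed

lemma transport_linear_map:
  assumes V: "vectorspace K V" and inj: "inj_on \<phi> (carrier V)"
  shows "linear_map K V (transport \<phi> V) \<phi>"
  by (intro linear_mapI V transport_vectorspace[OF assms]) (simp_all add: transport_sel[OF inj])

text \<open>\<open>P\<close> is the subspace of the direct sum spanned by all pairs
  \<open>(f j v, g j v)\<close>. If its first projection is bijective, it is the graph of a linear
  map carrying each \<open>f j\<close> to \<open>g j\<close>.\<close>

lemma joint_image_space:
  fixes M :: "('k, 'a) module" and N :: "('k, 'b) module"
  assumes M: "vectorspace K M" and N: "vectorspace K N"
    and f: "\<And>j. j \<in> I \<Longrightarrow> linear_map K (U j) M (f j)"
    and g: "\<And>j. j \<in> I \<Longrightarrow> linear_map K (U j) N (g j)"
  obtains P :: "('k, 'a \<times> 'b) module" where "vectorspace K P" "linear_map K P M fst" "linear_map K P N snd"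
    "carrier P \<subseteq> carrier M \<times> carrier N"
    "\<And>j. j \<in> I \<Longrightarrow> linear_map K (U j) P (\<lambda>v. (f j v, g j v))"
    "span_of K P (\<Union>j\<in>I. (\<lambda>v. (f j v, g j v)) ` carrier (U j)) = carrier P"
proof -
  define E where "E = (\<Union>j\<in>I. (\<lambda>v. (f j v, g j v)) ` carrier (U j))"
  let ?D = "direct_sum M N"
  let ?P = "?D\<lparr>carrier := span_of K ?D E\<rparr>"
  interpret D: vectorspace K ?D by (rule direct_sum_is_vs[OF M N])
  have sel: "carrier ?D = carrier M \<times> carrier N"
    "\<And>v w. v \<oplus>\<^bsub>?D\<^esub> w = (fst v \<oplus>\<^bsub>M\<^esub> fst w, snd v \<oplus>\<^bsub>N\<^esub> snd w)"
    "\<And>c v. c \<odot>\<^bsub>?D\<^esub> v = (c \<odot>\<^bsub>M\<^esub> fst v, c \<odot>\<^bsub>N\<^esub> snd v)"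
    by (simp_all add: direct_sum_def)
  have ED: "E \<subseteq> carrier ?D"
    using linear_mapD(3)[OF f] linear_mapD(3)[OF g] by (auto simp: E_def sel)
  have sub: "submodule K (span_of K ?D E) ?D" by (rule D.span_is_submodule[OF ED])
  have PD: "span_of K ?D E \<subseteq> carrier M \<times> carrier N"
    using D.span_is_subset2[OF ED] by (simp add: sel)
  have P: "vectorspace K ?P" by (rule D.subspace_is_vs[OF D.span_is_subspace[OF ED]])
  show thesis
  proof (rule that[OF P])
    show "linear_map K ?P M fst" "linear_map K ?P N snd"
      using PD by (auto intro!: linear_mapI P M N simp: sel)
    show "carrier ?P \<subseteq> carrier M \<times> carrier N" using PD by simp
    show "linear_map K (U j) ?P (\<lambda>v. (f j v, g j v))" if j: "j \<in> I" for j
    proof (rule linear_mapI[OF linear_mapD(1)[OF f[OF j]] P])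
      show "(f j v, g j v) \<in> carrier ?P" if "v \<in> carrier (U j)" for v
        using D.in_own_span[OF ED] that j by (auto simp: E_def)
    qed (simp_all add: sel linear_mapD(4,5)[OF f[OF j]] linear_mapD(4,5)[OF g[OF j]])
    \<comment> \<open>The span of the pairs is the same whether computed in the direct sum or in the
      subspace \<open>?P\<close>.\<close>
    show "span_of K ?P (\<Union>j\<in>I. (\<lambda>v. (f j v, g j v)) ` carrier (U j)) = carrier ?P"
      using D.span_li_not_depend(1)[OF D.in_own_span[OF ED] sub] by (simp add: E_def)
  qed
qed

section \<open>The category of finite-dimensional vector spaces\<close>

abbreviation map_of_arr where "map_of_arr a \<equiv> fst (snd a)"

lemma Vect_obj: "V \<in> Obj Vect \<longleftrightarrow> vectorspace class_ring V \<and> vectorspace.fin_dim class_ring V"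
  by (simp add: Vect_def)

lemma Vect_hom: "in_hom Vect a V W \<longleftrightarrow> (\<exists>T. a = (V, T, W) \<and> V \<in> Obj Vect \<and> W \<in> Obj Vect \<and>
    linear_map class_ring V W T \<and> T \<in> extensional (carrier V))"
  by (auto simp: Vect_def Let_def in_hom_def)

lemma Vect_arr: "(V, T, W) \<in> Arr Vect \<longleftrightarrow> V \<in> Obj Vect \<and> W \<in> Obj Vect \<and>
    linear_map class_ring V W T \<and> T \<in> extensional (carrier V)"
  by (auto simp: Vect_def Let_def)

lemma Vect_sel [simp]:
  "Dom Vect (V, T, W) = V" "Cod Vect (V, T, W) = W" "Ide Vect V = (V, \<lambda>v\<in>carrier V. v, V)"
  "Cmp Vect (W', S, U) (V, T, W) = (V, compose (carrier V) S T, U)"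
  by (simp_all add: Vect_def Let_def)

lemma Vect_homI:
  assumes "linear_map class_ring V W T" "V \<in> Obj Vect" "W \<in> Obj Vect"
  shows "in_hom Vect (V, restrict T (carrier V), W) V W"
proof -
  have "linear_map class_ring V W (restrict T (carrier V))"
    using linear_map_compose[OF linear_map_id assms(1)] linear_mapD(1)[OF assms(1)] by simp
  then show ?thesis using assms by (simp add: Vect_hom)
qed

lemma category_Vect: "category (Vect :: 'v vect_category)"
proof
  fix a :: "'v vspace \<times> ('v \<Rightarrow> 'v) \<times> 'v vspace"
  assume "a \<in> Arr Vect"
  moreover obtain V T W where a: "a = (V, T, W)" by (metis surj_pair)
  ultimately have *: "V \<in> Obj Vect" "W \<in> Obj Vect" "linear_map class_ring V W T" "T \<in> extensional (carrier V)"
    by (simp_all add: Vect_arr)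
  then show "Dom Vect a \<in> Obj Vect" "Cod Vect a \<in> Obj Vect" by (simp_all add: a)
  show "Cmp Vect (Ide Vect (Cod Vect a)) a = a" "Cmp Vect a (Ide Vect (Dom Vect a)) = a"
    using *(4) linear_mapD(3)[OF *(3)]
    by (auto simp: a compose_def fun_eq_iff extensional_def)
next
  fix V :: "'v vspace" assume V: "V \<in> Obj Vect"
  then have "in_hom Vect (V, \<lambda>v\<in>carrier V. v, V) V V"
    using Vect_homI[OF linear_map_id, of V] by (simp add: Vect_obj)
  then show "Ide Vect V \<in> Arr Vect" "Dom Vect (Ide Vect V) = V" "Cod Vect (Ide Vect V) = V"
    by (simp_all add: in_hom_def)
next
  fix a b :: "'v vspace \<times> ('v \<Rightarrow> 'v) \<times> 'v vspace"
  assume "a \<in> Arr Vect" "b \<in> Arr Vect" "Cod Vect a = Dom Vect b"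
  moreover from this obtain V T W S U where ab: "a = (V, T, W)" "b = (W, S, U)"
    by (metis surj_pair Vect_sel(1,2))
  ultimately have *: "V \<in> Obj Vect" "U \<in> Obj Vect" "linear_map class_ring V W T" "linear_map class_ring W U S"
    by (simp_all add: Vect_arr)
  have "linear_map class_ring V U (compose (carrier V) S T)"
    by (rule linear_map_compose[OF *(3,4)]) (simp add: compose_eq)
  then show "Cmp Vect b a \<in> Arr Vect" using * by (simp add: ab Vect_arr)
  show "Dom Vect (Cmp Vect b a) = Dom Vect a" "Cod Vect (Cmp Vect b a) = Cod Vect b"
    by (simp_all add: ab)
next
  fix a b c :: "'v vspace \<times> ('v \<Rightarrow> 'v) \<times> 'v vspace"
  assume "a \<in> Arr Vect" "b \<in> Arr Vect" "c \<in> Arr Vect" "Cod Vect a = Dom Vect b" "Cod Vect b = Dom Vect c"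
  moreover from this obtain V T W S U R Z where abc: "a = (V, T, W)" "b = (W, S, U)" "c = (U, R, Z)"
    by (metis surj_pair Vect_sel(1,2))
  ultimately have "linear_map class_ring V W T" by (simp add: Vect_arr)
  from linear_mapD(3)[OF this]
  show "Cmp Vect c (Cmp Vect b a) = Cmp Vect (Cmp Vect c b) a"
    by (auto simp: abc compose_def fun_eq_iff)
qed

text \<open>A nonzero vector would give an injection from the complex numbers into the type, sending
  a scalar to the corresponding multiple.\<close>

lemma finite_type_trivial_space:
  fixes V :: "'v vspace"
  assumes V: "vectorspace class_ring V" and fin: "finite (UNIV :: 'v set)"
  shows "carrier V = {\<zero>\<^bsub>V\<^esub>}"
proof -
  interpret V: vectorspace class_ring V by fact
  have "v = \<zero>\<^bsub>V\<^esub>" if v: "v \<in> carrier V" for v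
  proof (rule ccontr)
    assume nz: "v \<noteq> \<zero>\<^bsub>V\<^esub>"
    have "inj (\<lambda>c :: complex. c \<odot>\<^bsub>V\<^esub> v)"
    proof (rule injI, rule ccontr)
      fix a b :: complex assume eq: "a \<odot>\<^bsub>V\<^esub> v = b \<odot>\<^bsub>V\<^esub> v" and "a \<noteq> b"
      have "(b + (a - b)) \<odot>\<^bsub>V\<^esub> v = b \<odot>\<^bsub>V\<^esub> v \<oplus>\<^bsub>V\<^esub> (a - b) \<odot>\<^bsub>V\<^esub> v"
        using V.smult_l_distr[of b "a - b" v] v by simp
      then have "(a - b) \<odot>\<^bsub>V\<^esub> v = \<zero>\<^bsub>V\<^esub>"
        using eq v V.smult_closed by simp
      then have "v = (inverse (a - b) * (a - b)) \<odot>\<^bsub>V\<^esub> v \<and> (inverse (a - b) * (a - b)) \<odot>\<^bsub>V\<^esub> v = \<zero>\<^bsub>V\<^esub>"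
        using V.smult_assoc1[of "inverse (a - b)" "a - b" v] V.smult_one[OF v] v \<open>a \<noteq> b\<close>
        by (simp del: V.smult_one)
      with nz show False by metis
    qed
    then have "finite (UNIV :: complex set)"
      using finite_subset[OF subset_UNIV fin] by (metis finite_imageD)
    then show False using infinite_UNIV_char_0 by blast
  qed
  then show ?thesis by auto
qed

text \<open>If the universe \<open>'v\<close> is infinite it absorbs its own square; if it is finite, every complex vector
  space in it is trivial.\<close>

lemma carrier_pair_embedding:
  fixes V W :: "'v vspace"
  assumes "vectorspace class_ring V" "vectorspace class_ring W"
  obtains \<phi> :: "'v \<times> 'v \<Rightarrow> 'v" where "inj_on \<phi> (carrier V \<times> carrier W)"
proof (cases "finite (UNIV :: 'v set)")
  case True
  show thesis
    by (rule that[of fst])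
      (simp add: finite_type_trivial_space[OF assms(1) True] finite_type_trivial_space[OF assms(2) True])
next
  case False
  then obtain \<phi> :: "'v \<times> 'v \<Rightarrow> 'v" where "bij_betw \<phi> (UNIV \<times> UNIV) UNIV"
    using card_of_Times_same_infinite[OF False] card_of_ordIso by blast
  then have "inj_on \<phi> (UNIV \<times> UNIV)" by (simp add: bij_betw_def)
  then have "inj_on \<phi> (carrier V \<times> carrier W)" by (rule inj_on_subset) simp
  then show thesis by (rule that)
qed

text \<open>The zero space, available over every type because \<open>undefined\<close> always
  inhabits it. It provides a first generated cocone.\<close>

definition point_space :: "('k, 'a) module" where
  "point_space = \<lparr>carrier = {undefined}, mult = undefined, one = undefined, zero = undefined,
     add = \<lambda>_ _. undefined, smult = \<lambda>_ _. undefined\<rparr>"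

lemma point_space_Vect: "(point_space :: 'v vspace) \<in> Obj Vect"
proof -
  have "vectorspace class_ring (point_space :: 'v vspace)"
    by (rule vs_criteria) (simp_all add: point_space_def class_field)
  then interpret P: vectorspace class_ring "point_space :: 'v vspace" .
  have "P.gen_set {}" by (simp add: P.span_empty) (simp add: point_space_def)
  then have "vectorspace.fin_dim class_ring (point_space :: 'v vspace)" unfolding P.fin_dim_def by blast
  then show ?thesis by (simp add: Vect_obj P.vectorspace_axioms)
qed

section \<open>Colimits of vector spaces\<close>

text \<open>Translates families of plain linear maps into cocones. The restriction is forced by the
  extensionality of arrows of \<open>Vect\<close>; \<open>Vect_coconeD\<close> is the reverse
  direction.\<close>

lemma Vect_coconeI:
  assumes G: "cat_functor J Vect G" and M: "M \<in> Obj Vect"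
    and f: "\<And>j. j \<in> Obj J \<Longrightarrow> linear_map class_ring (FObj G j) M (f j)"
    and cmp: "\<And>m i j v. \<lbrakk>in_hom J m i j; v \<in> carrier (FObj G i)\<rbrakk>
      \<Longrightarrow> f j (map_of_arr (FArr G m) v) = f i v"
  shows "is_cocone J Vect G M (\<lambda>j. (FObj G j, restrict (f j) (carrier (FObj G j)), M))"
proof (rule is_coconeI[OF G M])
  interpret G: cat_functor J Vect G by fact
  show "in_hom Vect (FObj G j, restrict (f j) (carrier (FObj G j)), M) (FObj G j) M" if "j \<in> Obj J" for j
    using that by (intro Vect_homI f M G.fobj_in)
  fix m i j assume m: "in_hom J m i j"
  obtain T where T: "FArr G m = (FObj G i, T, FObj G j)" "linear_map class_ring (FObj G i) (FObj G j) T"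
    using G.farr_hom[OF m] by (auto simp: Vect_hom)
  have "compose (carrier (FObj G i)) (restrict (f j) (carrier (FObj G j))) T
      = restrict (f i) (carrier (FObj G i))"
    using cmp[OF m] linear_mapD(3)[OF T(2)] by (auto simp: T(1) compose_def fun_eq_iff)
  then show "Cmp Vect (FObj G j, restrict (f j) (carrier (FObj G j)), M) (FArr G m)
      = (FObj G i, restrict (f i) (carrier (FObj G i)), M)"
    by (simp add: T(1))
qed

lemma Vect_coconeD:
  assumes c: "is_cocone J Vect G M \<kappa>"
  shows "M \<in> Obj Vect"
    and "j \<in> Obj J \<Longrightarrow> \<kappa> j = (FObj G j, map_of_arr (\<kappa> j), M)"
    and "j \<in> Obj J \<Longrightarrow> linear_map class_ring (FObj G j) M (map_of_arr (\<kappa> j))"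
    and "j \<in> Obj J \<Longrightarrow> map_of_arr (\<kappa> j) \<in> extensional (carrier (FObj G j))"
    and "\<lbrakk>in_hom J m i j; v \<in> carrier (FObj G i)\<rbrakk>
      \<Longrightarrow> map_of_arr (\<kappa> j) (map_of_arr (FArr G m) v) = map_of_arr (\<kappa> i) v"
proof -
  note cd = is_coconeD[OF c]
  interpret G: cat_functor J Vect G by (fact cd(1))
  show "M \<in> Obj Vect" by fact
  have *: "\<kappa> j = (FObj G j, map_of_arr (\<kappa> j), M) \<and> linear_map class_ring (FObj G j) M (map_of_arr (\<kappa> j))
      \<and> map_of_arr (\<kappa> j) \<in> extensional (carrier (FObj G j))" if "j \<in> Obj J" for j
    using cd(3)[OF that] by (auto simp: Vect_hom)
  then show "j \<in> Obj J \<Longrightarrow> \<kappa> j = (FObj G j, map_of_arr (\<kappa> j), M)"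
    "j \<in> Obj J \<Longrightarrow> linear_map class_ring (FObj G j) M (map_of_arr (\<kappa> j))"
    "j \<in> Obj J \<Longrightarrow> map_of_arr (\<kappa> j) \<in> extensional (carrier (FObj G j))"
    by blast+
  assume m: "in_hom J m i j" and v: "v \<in> carrier (FObj G i)"
  have ij: "i \<in> Obj J" "j \<in> Obj J" using G.C.hom_obj[OF m] by auto
  obtain T where T: "FArr G m = (FObj G i, T, FObj G j)" using G.farr_hom[OF m] by (auto simp: Vect_hom)
  have "\<kappa> j = (FObj G j, map_of_arr (\<kappa> j), M)" using * ij by blast
  then have "Cmp Vect (\<kappa> j) (FArr G m) = (FObj G i, compose (carrier (FObj G i)) (map_of_arr (\<kappa> j)) T, M)"
    by (metis T Vect_sel(4))
  with cd(4)[OF m] have "map_of_arr (\<kappa> i) = compose (carrier (FObj G i)) (map_of_arr (\<kappa> j)) T"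
    by (metis fst_conv snd_conv)
  then show "map_of_arr (\<kappa> j) (map_of_arr (FArr G m) v) = map_of_arr (\<kappa> i) v"
    using v by (simp add: T compose_eq)
qed

text \<open>Among the cocones that are generated by the images of their legs the dimension is bounded, and
  one of maximal dimension is a colimit: given another cocone \<open>N\<close>, the subspace of \<open>M \<times> N\<close> generated
  by the pairs of legs projects isomorphically onto \<open>M\<close>, so it is the graph of a linear map.\<close>

lemma Vect_colimit:
  fixes G :: "('j, 'i, 'v vspace, 'v vspace \<times> ('v \<Rightarrow> 'v) \<times> 'v vspace) functor_data"
  assumes G: "cat_functor J Vect G" and S: "finite S" "S \<subseteq> Obj J"
    and final: "\<And>j. j \<in> Obj J \<Longrightarrow> \<exists>i\<in>S. \<exists>m. in_hom J m j i"
  shows "\<exists>L \<iota>. is_colimit J Vect G L \<iota>"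
proof -
  interpret G: cat_functor J Vect G by fact
  let ?K = "class_ring :: complex ring" and ?U = "FObj G"
  have U: "vectorspace ?K (?U j)" "vectorspace.fin_dim ?K (?U j)" if "j \<in> Obj J" for j
    using G.fobj_in[OF that] by (simp_all add: Vect_obj)
  \<comment> \<open>The type \<open>'w\<close> is kept general because this is applied both to
    spaces in \<open>'v\<close> and to a space of pairs in \<open>'v \<times> 'v\<close>.\<close>
  have generated: "vectorspace.fin_dim ?K W"
      "vectorspace.dim ?K W \<le> (\<Sum>i\<in>S. vectorspace.dim ?K (?U i))"
    if W: "vectorspace ?K W" and f: "\<And>j. j \<in> Obj J \<Longrightarrow> linear_map ?K (?U j) W (f j)"
      and cmp: "\<And>m i j v. \<lbrakk>in_hom J m i j; v \<in> carrier (?U i)\<rbrakk> \<Longrightarrow> f j (map_of_arr (FArr G m) v) = f i v"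
      and gen: "span_of ?K W (\<Union>j\<in>Obj J. f j ` carrier (?U j)) = carrier W"
    for W :: "(complex, 'w) module" and f
  proof -
    \<comment> \<open>An arrow from \<open>j\<close> to \<open>i\<close> factors the leg at
      \<open>j\<close> through the leg at \<open>i\<close>, so the image can only grow.\<close>
    have "\<exists>i\<in>S. f j ` carrier (?U j) \<subseteq> f i ` carrier (?U i)" if j: "j \<in> Obj J" for j
    proof -
      obtain i m where i: "i \<in> S" and m: "in_hom J m j i" using final[OF j] by blast
      obtain T where T: "FArr G m = (?U j, T, ?U i)" "linear_map ?K (?U j) (?U i) T"
        using G.farr_hom[OF m] by (auto simp: Vect_hom)
      have "f j ` carrier (?U j) \<subseteq> f i ` carrier (?U i)"
      proof
        fix w assume "w \<in> f j ` carrier (?U j)"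
        then obtain v where "v \<in> carrier (?U j)" "w = f j v" by auto
        then show "w \<in> f i ` carrier (?U i)"
          using cmp[OF m, of v] linear_mapD(3)[OF T(2), of v]
          by (metis T(1) fst_conv snd_conv imageI)
      qed
      with i show ?thesis by blast
    qed
    from fin_dim_generated[OF W f U(2) S this gen] show "vectorspace.fin_dim ?K W"
      "vectorspace.dim ?K W \<le> (\<Sum>i\<in>S. vectorspace.dim ?K (?U i))" by auto
  qed
  define gen where "gen M \<kappa> \<longleftrightarrow> is_cocone J Vect G M \<kappa> \<and>
    span_of ?K M (\<Union>j\<in>Obj J. map_of_arr (\<kappa> j) ` carrier (?U j)) = carrier M" for M \<kappa>
  have bound: "vectorspace.dim ?K M \<le> (\<Sum>i\<in>S. vectorspace.dim ?K (?U i))" if "gen M \<kappa>" for M \<kappa>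
  proof -
    from that have c: "is_cocone J Vect G M \<kappa>"
      and s: "span_of ?K M (\<Union>j\<in>Obj J. map_of_arr (\<kappa> j) ` carrier (?U j)) = carrier M"
      by (auto simp: gen_def)
    show ?thesis
      by (rule generated(2)[OF _ Vect_coconeD(3)[OF c] Vect_coconeD(5)[OF c] s])
        (use Vect_coconeD(1)[OF c] in \<open>simp_all add: Vect_obj\<close>)
  qed
  have genI: "gen M (\<lambda>j. (?U j, restrict (f j) (carrier (?U j)), M))"
    if "M \<in> Obj Vect" "\<And>j. j \<in> Obj J \<Longrightarrow> linear_map ?K (?U j) M (f j)"
      "\<And>m i j v. \<lbrakk>in_hom J m i j; v \<in> carrier (?U i)\<rbrakk> \<Longrightarrow> f j (map_of_arr (FArr G m) v) = f i v"
      "span_of ?K M (\<Union>j\<in>Obj J. f j ` carrier (?U j)) = carrier M" for M f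
    unfolding gen_def using Vect_coconeI[OF G that(1-3)] that(4) by simp
  \<comment> \<open>The maximum has to range over a nonempty set. The zero space is generated even
    by an empty family, since every span contains zero.\<close>
  have "\<exists>M \<kappa>. gen M \<kappa>"
  proof -
    let ?P = "point_space :: 'v vspace"
    have pv: "vectorspace ?K ?P" 
      by (rule Vect_obj[THEN iffD1, OF point_space_Vect, THEN conjunct1])
    interpret P: vectorspace ?K ?P by (rule pv)
    let ?E = "\<Union>j\<in>Obj J. (\<lambda>_ :: 'v. undefined :: 'v) ` carrier (?U j)"
    have E: "?E \<subseteq> carrier ?P" by (auto simp: point_space_def)
    have "P.span ?E \<subseteq> carrier ?P" by (rule P.span_is_subset2[OF E])
    moreover have "carrier ?P \<subseteq> P.span ?E"
      using P.span_zero[of ?E] by (simp add: point_space_def)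
    ultimately have "P.gen_set ?E" by blast
    then show ?thesis
      using genI[OF point_space_Vect, of "\<lambda>_ _. undefined"]
      by (fastforce intro: linear_mapI[OF U(1) pv] simp: point_space_def)
  qed
  then obtain M0 \<kappa>0 where "gen M0 \<kappa>0" by blast
  \<comment> \<open>\<open>Suc\<close> makes the uniform dimension bound strict.\<close>
  then have "\<exists>M. (\<exists>\<kappa>. gen M \<kappa>) \<and> (\<forall>P. (\<exists>\<mu>. gen P \<mu>) \<longrightarrow> vectorspace.dim ?K P \<le> vectorspace.dim ?K M)"
    using bound by (intro ex_has_greatest_nat[of "\<lambda>M. \<exists>\<kappa>. gen M \<kappa>" M0 "vectorspace.dim ?K"
        "Suc (\<Sum>i\<in>S. vectorspace.dim ?K (?U i))"]) (auto simp: less_Suc_eq_le)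
  then obtain M \<kappa> where M: "gen M \<kappa>"
    and max: "\<And>P \<mu>. gen P \<mu> \<Longrightarrow> vectorspace.dim ?K P \<le> vectorspace.dim ?K M"
    by blast
  have c: "is_cocone J Vect G M \<kappa>"
    and span: "span_of ?K M (\<Union>j\<in>Obj J. map_of_arr (\<kappa> j) ` carrier (?U j)) = carrier M"
    using M by (auto simp: gen_def)
  note cd = Vect_coconeD[OF c]
  have Mv: "vectorspace ?K M" using cd(1) by (simp add: Vect_obj)
  let ?f = "\<lambda>j. map_of_arr (\<kappa> j)"
  have EM: "(\<Union>j\<in>Obj J. ?f j ` carrier (?U j)) \<subseteq> carrier M"
    using linear_mapD(3)[OF cd(3)] by blast
  have "\<exists>!u. is_mediating J Vect M \<kappa> N \<mu> u" if c': "is_cocone J Vect G N \<mu>" for N \<mu>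
  proof -
    note cd' = Vect_coconeD[OF c']
    have Nv: "vectorspace ?K N" using cd'(1) by (simp add: Vect_obj)
    let ?g = "\<lambda>j. map_of_arr (\<mu> j)"
    obtain P :: "(complex, 'v \<times> 'v) module" where P: "vectorspace ?K P" "linear_map ?K P M fst" "linear_map ?K P N snd"
      "carrier P \<subseteq> carrier M \<times> carrier N"
      "\<And>j. j \<in> Obj J \<Longrightarrow> linear_map ?K (?U j) P (\<lambda>v. (?f j v, ?g j v))"
      "span_of ?K P (\<Union>j\<in>Obj J. (\<lambda>v. (?f j v, ?g j v)) ` carrier (?U j)) = carrier P"
      by (rule joint_image_space[OF Mv Nv, of "Obj J" ?U ?f ?g]) (erule cd(3), erule cd'(3), rule that)
    let ?E = "\<Union>j\<in>Obj J. (\<lambda>v. (?f j v, ?g j v)) ` carrier (?U j)"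
    have EP: "?E \<subseteq> carrier P" using linear_mapD(3)[OF P(5)] by blast
    have P_fin: "vectorspace.fin_dim ?K P"
      by (rule generated(1)[OF P(1,5) _ P(6)]) (simp_all add: cd(5) cd'(5))
    \<comment> \<open>To be compared with \<open>M\<close> by maximality, \<open>P\<close> must
      become an object of \<open>Vect\<close> over \<open>'v\<close>, hence the embedding of pairs
      into \<open>'v\<close>.\<close>
    obtain \<phi> :: "'v \<times> 'v \<Rightarrow> 'v" where "inj_on \<phi> (carrier M \<times> carrier N)"
      using carrier_pair_embedding[OF Mv Nv] .
    then have \<phi>: "inj_on \<phi> (carrier P)" using P(4) by (rule inj_on_subset)
    let ?P' = "transport \<phi> P"
    have \<phi>_lin: "linear_map ?K P ?P' \<phi>" by (rule transport_linear_map[OF P(1) \<phi>])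
    have \<phi>_surj: "\<phi> ` carrier P = carrier ?P'" by (simp add: transport_sel[OF \<phi>])
    have P'_fin: "vectorspace.fin_dim ?K ?P'" by (rule linear_map.surj_fin_dim[OF \<phi>_lin P_fin \<phi>_surj])
    have "gen ?P' (\<lambda>j. (?U j, restrict (\<lambda>v. \<phi> (?f j v, ?g j v)) (carrier (?U j)), ?P'))"
    proof (rule genI)
      show "?P' \<in> Obj Vect" using P'_fin linear_mapD(2)[OF \<phi>_lin] by (simp add: Vect_obj)
      show "linear_map ?K (?U j) ?P' (\<lambda>v. \<phi> (?f j v, ?g j v))" if "j \<in> Obj J" for j
        by (rule linear_map_compose[OF P(5)[OF that] \<phi>_lin refl])
      have "(\<Union>j\<in>Obj J. (\<lambda>v. \<phi> (?f j v, ?g j v)) ` carrier (?U j)) = \<phi> ` ?E"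
        by (simp add: image_UN image_image)
      then show "span_of ?K ?P' (\<Union>j\<in>Obj J. (\<lambda>v. \<phi> (?f j v, ?g j v)) ` carrier (?U j)) = carrier ?P'"
        using span_image[OF \<phi>_lin EP] P(6) \<phi>_surj by simp
    qed (simp add: cd(5) cd'(5))
    \<comment> \<open>Maximality is used here: the copy of \<open>P\<close> is again generated by
      its legs, so \<open>P\<close> is no larger than \<open>M\<close>. As the first projection maps
      \<open>P\<close> onto \<open>M\<close>, it must be bijective.\<close>
    from max[OF this] have "vectorspace.dim ?K P \<le> vectorspace.dim ?K M"
      using linear_map.dim_eq[OF \<phi>_lin P_fin \<phi> \<phi>_surj] by simp
    moreover have fst_E: "fst ` ?E = (\<Union>j\<in>Obj J. ?f j ` carrier (?U j))"
      by (simp add: image_UN image_image)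
    have fst_surj: "fst ` carrier P = carrier M"
      using span_image[OF P(2) EP] P(6) span by (simp only: fst_E)
    ultimately have fst_inj: "inj_on fst (carrier P)"
      using linear_map_inj_of_surj[OF P(2) P_fin] by blast
    let ?u = "\<lambda>w. snd (the_inv_into (carrier P) fst w)"
    have u_lin: "linear_map ?K M N ?u"
      by (rule linear_map_compose[OF linear_map_inverse[OF P(2)] P(3) refl])
        (simp add: bij_betw_def fst_inj fst_surj)
    have u_leg: "?u (?f j v) = ?g j v" if "j \<in> Obj J" "v \<in> carrier (?U j)" for j v
      using the_inv_into_f_f[OF fst_inj, of "(?f j v, ?g j v)"] linear_mapD(3)[OF P(5)[OF that(1)] that(2)]
      by simp
    have med: "is_mediating J Vect M \<kappa> N \<mu> (M, T, N) \<longleftrightarrow> in_hom Vect (M, T, N) M N \<and>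
        (\<forall>j\<in>Obj J. \<forall>v\<in>carrier (?U j). T (?f j v) = ?g j v)" for T
    proof -
      have "Cmp Vect (M, T, N) (\<kappa> j) = \<mu> j \<longleftrightarrow> (\<forall>v\<in>carrier (?U j). T (?f j v) = ?g j v)" if j: "j \<in> Obj J" for j
      proof -
        have "Cmp Vect (M, T, N) (\<kappa> j) = (?U j, compose (carrier (?U j)) T (?f j), N)"
          by (metis cd(2)[OF j] Vect_sel(4))
        then have "Cmp Vect (M, T, N) (\<kappa> j) = \<mu> j \<longleftrightarrow> compose (carrier (?U j)) T (?f j) = ?g j"
          by (metis cd'(2)[OF j] fst_conv snd_conv)
        also have "\<dots> \<longleftrightarrow> (\<forall>v\<in>carrier (?U j). T (?f j v) = ?g j v)"
          using cd'(4)[OF j] by (auto simp: compose_def fun_eq_iff extensional_def)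
        finally show ?thesis .
      qed
      then show ?thesis by (simp add: is_mediating_def)
    qed
    show ?thesis
    proof (rule ex1I)
      show "is_mediating J Vect M \<kappa> N \<mu> (M, restrict ?u (carrier M), N)"
        unfolding med using Vect_homI[OF u_lin cd(1) cd'(1)] EM u_leg by (auto simp del: split_paired_All)
      fix a assume a: "is_mediating J Vect M \<kappa> N \<mu> a"
      then obtain T where T: "a = (M, T, N)" "linear_map ?K M N T" "T \<in> extensional (carrier M)"
        by (auto simp: is_mediating_def Vect_hom)
      then have leg: "T (?f j v) = ?g j v" if "j \<in> Obj J" "v \<in> carrier (?U j)" for j v
        using a that med by blast
      \<comment> \<open>Uniqueness comes from generation: two linear maps that agree on the images
        of the legs agree on their span, which is all of \<open>M\<close>.\<close>
      have "T w = ?u w" if "w \<in> carrier M" for w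
        by (rule linear_map_eq_on_span[OF T(2) u_lin EM]) (use span that leg u_leg in auto)
      then have "T = restrict ?u (carrier M)" using T(3) by (auto simp: fun_eq_iff extensional_def)
      then show "a = (M, restrict ?u (carrier M), N)" by (simp add: T(1))
    qed
  qed
  then show ?thesis using c unfolding is_colimit_def by blast
qed

section \<open>Essential finiteness\<close>

text \<open>One-sided inverses are what the comma category argument consumes, and they lift to the
  weak pullback without exhibiting a finite groupoid equivalent to it.\<close>

definition retract_finite :: "('o, 'm) category \<Rightarrow> bool" where
  "retract_finite C \<longleftrightarrow> (\<exists>S. finite S \<and> S \<subseteq> Obj C \<and>
     (\<forall>x\<in>Obj C. \<exists>y\<in>S. \<exists>h k. in_hom C h x y \<and> in_hom C k y x \<and> Cmp C k h = Ide C x))"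

lemma retract_finiteE:
  assumes "retract_finite C"
  obtains S where "finite S" "S \<subseteq> Obj C"
    "\<And>x. x \<in> Obj C \<Longrightarrow> \<exists>y\<in>S. \<exists>h k. in_hom C h x y \<and> in_hom C k y x \<and> Cmp C k h = Ide C x"
  using assms unfolding retract_finite_def by (elim exE conjE) (rule that, assumption+, erule bspec)

definition locally_finite :: "('o, 'm) category \<Rightarrow> bool" where
  "locally_finite C \<longleftrightarrow> (\<forall>x\<in>Obj C. \<forall>y\<in>Obj C. finite {f. in_hom C f x y})"

text \<open>The unit of the equivalence exhibits each \<open>x\<close> as a retract of its image
  under \<open>G\<close> after \<open>F\<close>, and these images come from the finitely many
  objects of \<open>H\<close>. An arrow \<open>f\<close> is recovered from \<open>FArr F f\<close>
  by conjugating with the unit, so \<open>F\<close> is injective on hom sets and embeds them in the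
  finite set \<open>Arr H\<close>.\<close>

lemma
  assumes "essentially_finite_groupoid A"
  shows essentially_finite_retract_finite: "retract_finite A"
    and essentially_finite_locally_finite: "locally_finite A"
proof -
  interpret groupoid A using assms by (simp add: essentially_finite_groupoid_def)
  obtain H :: "(nat, nat) category" and F G \<eta> where H: "finite (Obj H)" "finite (Arr H)"
    and F: "cat_functor A H F" and G: "cat_functor H A G"
    and \<eta>: "nat_iso A A functor_id (functor_comp G F) \<eta>"
    using assms unfolding essentially_finite_groupoid_def equivalent_categories_def by blast
  interpret F: cat_functor A H F by fact
  interpret G: cat_functor H A G by fact
  interpret \<eta>: nat_iso A A functor_id "functor_comp G F" \<eta> by fact
  have \<eta>_hom: "in_hom A (\<eta> x) x (FObj G (FObj F x))" if "x \<in> Obj A" for x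
    using \<eta>.component[OF that] by (simp add: functor_id_def)
  have inv: "\<exists>k. in_hom A k (FObj G (FObj F x)) x \<and> Cmp A k (\<eta> x) = Ide A x" if "x \<in> Obj A" for x
    using is_isoE[OF \<eta>.component_iso[OF that] \<eta>_hom[OF that]] by metis
  show "retract_finite A"
    unfolding retract_finite_def
  proof (intro exI[of _ "FObj G ` Obj H"] conjI ballI)
    show "\<exists>y\<in>FObj G ` Obj H. \<exists>h k. in_hom A h x y \<and> in_hom A k y x \<and> Cmp A k h = Ide A x"
      if "x \<in> Obj A" for x
      using \<eta>_hom[OF that] inv[OF that] F.fobj_in[OF that] by blast
  qed (use H G.fobj_in in auto)
  show "locally_finite A"
    unfolding locally_finite_def
  proof (intro ballI)
    fix x y assume x: "x \<in> Obj A" and y: "y \<in> Obj A"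
    obtain k where k: "in_hom A k (FObj G (FObj F y)) y" "Cmp A k (\<eta> y) = Ide A y" using inv[OF y] by blast
    have "f = Cmp A k (Cmp A (FArr G (FArr F f)) (\<eta> x))" if f: "in_hom A f x y" for f
      using \<eta>.naturality_hom[OF f] assoc_hom[OF f \<eta>_hom[OF y] k(1)] k(2) ide_left_hom[OF f]
      by (simp add: functor_id_def)
    then have "inj_on (FArr F) {f. in_hom A f x y}" by (intro inj_onI) (metis mem_Collect_eq)
    moreover have "FArr F ` {f. in_hom A f x y} \<subseteq> Arr H" using F.farr_in by (auto simp: in_hom_def)
    ultimately show "finite {f. in_hom A f x y}" using H(2) by (meson finite_subset inj_on_finite)
  qed
qed

text \<open>Retractions of \<open>x\<close> onto \<open>y\<close> and of \<open>x'\<close> onto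
  \<open>y'\<close> lift to the weak pullback once \<open>g\<close> is conjugated by them. The
  triples over the finite sets \<open>S\<close> and \<open>S'\<close> are finite in number because
  hom sets of \<open>A\<close> are.\<close>

lemma (in cospan) weak_pullback_retract_finite:
  assumes X: "retract_finite X" and X': "retract_finite X'" and A: "locally_finite A"
  shows "retract_finite W"
proof -
  obtain S where S: "finite S" "S \<subseteq> Obj X"
    "\<And>x. x \<in> Obj X \<Longrightarrow> \<exists>y\<in>S. \<exists>h k. in_hom X h x y \<and> in_hom X k y x \<and> Cmp X k h = Ide X x"
    by (rule retract_finiteE[OF X]) (rule that)
  obtain S' where S': "finite S'" "S' \<subseteq> Obj X'"
    "\<And>x. x \<in> Obj X' \<Longrightarrow> \<exists>y\<in>S'. \<exists>h k. in_hom X' h x y \<and> in_hom X' k y x \<and> Cmp X' k h = Ide X' x"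
    by (rule retract_finiteE[OF X']) (rule that)
  define T where "T = (\<Union>x\<in>S. \<Union>x'\<in>S'. (\<lambda>g. (x, g, x')) ` {g. in_hom A g (FObj t x) (FObj s' x')})"
  show ?thesis
    unfolding retract_finite_def
  proof (intro exI[of _ T] conjI ballI)
    have "finite {g. in_hom A g (FObj t x) (FObj s' x')}" if "x \<in> S" "x' \<in> S'" for x x'
      using that A S(2) S'(2) t.fobj_in s'.fobj_in unfolding locally_finite_def by blast
    then show "finite T" unfolding T_def using S(1) S'(1) by blast
    show "T \<subseteq> Obj W" using S(2) S'(2) by (auto simp: T_def)
    fix w assume "w \<in> Obj W"
    moreover obtain x g x' where w: "w = (x, g, x')" by (metis surj_pair)
    ultimately have x: "x \<in> Obj X" "x' \<in> Obj X'" and g: "in_hom A g (FObj t x) (FObj s' x')" by simp_all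
    obtain y h k where y: "y \<in> S" and h: "in_hom X h x y" and k: "in_hom X k y x" and kh: "Cmp X k h = Ide X x"
      using S(3)[OF x(1)] by blast
    obtain y' h' k' where y': "y' \<in> S'" and h': "in_hom X' h' x' y'" and k': "in_hom X' k' y' x'"
      and kh': "Cmp X' k' h' = Ide X' x'"
      using S'(3)[OF x(2)] by blast
    have yo: "y \<in> Obj X" "y' \<in> Obj X'" using y y' S(2) S'(2) by auto
    note gk = t.D.cmp_hom[OF t.farr_hom[OF k] g]
    \<comment> \<open>Conjugating \<open>g\<close> makes both squares commute: the one for
      \<open>(h, h')\<close> by \<open>Cmp X k h = Ide X x\<close>, the one for
      \<open>(k, k')\<close> by \<open>Cmp X' k' h' = Ide X' x'\<close>.\<close>
    define g0 where "g0 = Cmp A (FArr s' h') (Cmp A g (FArr t k))"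
    have g0: "in_hom A g0 (FObj t y) (FObj s' y')"
      unfolding g0_def by (rule t.D.cmp_hom[OF gk s'.farr_hom[OF h']])
    have tkh: "Cmp A (FArr t k) (FArr t h) = Ide A (FObj t x)"
      using t.farr_cmp_hom[OF h k] kh t.farr_ide[OF x(1)] by simp
    have skh: "Cmp A (FArr s' k') (FArr s' h') = Ide A (FObj s' x')"
      using s'.farr_cmp_hom[OF h' k'] kh' s'.farr_ide[OF x(2)] by simp
    have "Cmp A g0 (FArr t h) = Cmp A (FArr s' h') (Cmp A (Cmp A g (FArr t k)) (FArr t h))"
      unfolding g0_def using t.D.assoc_hom[OF t.farr_hom[OF h] gk s'.farr_hom[OF h']] by simp
    also have "Cmp A (Cmp A g (FArr t k)) (FArr t h) = g"
      using t.D.assoc_hom[OF t.farr_hom[OF h] t.farr_hom[OF k] g] tkh t.D.ide_right_hom[OF g] by simp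
    finally have sq1: "Cmp A (FArr s' h') g = Cmp A g0 (FArr t h)" by simp
    have sq2: "Cmp A (FArr s' k') g0 = Cmp A g (FArr t k)"
      unfolding g0_def using t.D.assoc_hom[OF gk s'.farr_hom[OF h'] s'.farr_hom[OF k']] skh
        t.D.ide_left_hom[OF gk] by simp
    let ?w0 = "(y, g0, y')"
    have w0: "?w0 \<in> Obj W" "(x, g, x') \<in> Obj W" using yo g0 x g by simp_all
    have "?w0 \<in> T" using y y' g0 by (auto simp: T_def)
    moreover have "in_hom W (w, (h, h'), ?w0) w ?w0"
      unfolding w by (rule weak_pullback_homI[OF w0(2,1) h h' sq1])
    moreover have "in_hom W (?w0, (k, k'), w) ?w0 w"
      unfolding w by (rule weak_pullback_homI[OF w0 k k' sq2])
    moreover have "Cmp W (?w0, (k, k'), w) (w, (h, h'), ?w0) = Ide W w"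
      by (simp add: w kh kh')
    ultimately show "\<exists>w0\<in>T. \<exists>m n. in_hom W m w w0 \<and> in_hom W n w0 w \<and> Cmp W n m = Ide W w"
      by blast
  qed
qed

text \<open>If \<open>b\<close> is a retract of \<open>c\<close> through \<open>h\<close> and
  \<open>k\<close>, then \<open>h\<close> is an arrow from \<open>(b, g)\<close> to
  \<open>(c, Cmp A g (FArr f k))\<close>, since \<open>Cmp B k h\<close> is an identity. Finality in
  the full sense is not claimed: the arrows serve to bound dimensions.\<close>

lemma comma_category_finite_final:
  assumes f: "cat_functor B A f" and B: "retract_finite B" and A: "locally_finite A" and a: "a \<in> Obj A"
  obtains T where "finite T" "T \<subseteq> Obj (comma_category B A f a)"
    "\<And>p. p \<in> Obj (comma_category B A f a) \<Longrightarrow> \<exists>q\<in>T. \<exists>m. in_hom (comma_category B A f a) m p q"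
proof -
  interpret f: cat_functor B A f by fact
  obtain S where S: "finite S" "S \<subseteq> Obj B"
    "\<And>x. x \<in> Obj B \<Longrightarrow> \<exists>y\<in>S. \<exists>h k. in_hom B h x y \<and> in_hom B k y x \<and> Cmp B k h = Ide B x"
    by (rule retract_finiteE[OF B]) (rule that)
  define T where "T = (\<Union>b\<in>S. Pair b ` {g. in_hom A g (FObj f b) a})"
  show thesis
  proof (rule that[of T])
    have "finite {g. in_hom A g (FObj f b) a}" if "b \<in> S" for b
      using that A S(2) f.fobj_in a unfolding locally_finite_def by blast
    then show "finite T" unfolding T_def using S(1) by blast
    show "T \<subseteq> Obj (comma_category B A f a)" using S(2) by (auto simp: T_def)
    fix p assume "p \<in> Obj (comma_category B A f a)"
    moreover obtain b g where p: "p = (b, g)" by (cases p)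
    ultimately have b: "b \<in> Obj B" and g: "in_hom A g (FObj f b) a" by simp_all
    obtain c h k where c: "c \<in> S" and h: "in_hom B h b c" and k: "in_hom B k c b" and kh: "Cmp B k h = Ide B b"
      using S(3)[OF b] by blast
    note gk = f.D.cmp_hom[OF f.farr_hom[OF k] g]
    have "Cmp A (Cmp A g (FArr f k)) (FArr f h) = g"
      using f.D.assoc_hom[OF f.farr_hom[OF h] f.farr_hom[OF k] g] f.farr_cmp_hom[OF h k] kh
        f.farr_ide[OF b] f.D.ide_right_hom[OF g] by simp
    then have "in_hom (comma_category B A f a) ((b, g), h, (c, Cmp A g (FArr f k))) p (c, Cmp A g (FArr f k))"
      using h g gk b c S(2) by (auto simp: p comma_category_hom)
    moreover have "(c, Cmp A g (FArr f k)) \<in> T" using c gk by (auto simp: T_def)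
    ultimately show "\<exists>q\<in>T. \<exists>m. in_hom (comma_category B A f a) m p q" by blast
  qed
qed

lemma pushforward_Vect:
  assumes f: "cat_functor B A f" and B: "retract_finite B" and A: "locally_finite A"
  shows "pushforward B A f (Vect :: 'v vect_category)"
proof -
  interpret f: cat_functor B A f by fact
  interpret V: category "Vect :: 'v vect_category" by (rule category_Vect)
  show ?thesis
  proof
    fix G :: "(_, _, 'v vspace, 'v vspace \<times> ('v \<Rightarrow> 'v) \<times> 'v vspace) functor_data" and a
    assume G: "cat_functor B Vect G" and a: "a \<in> Obj A"
    obtain S where S: "finite S" "S \<subseteq> Obj (comma_category B A f a)"
      "\<And>p. p \<in> Obj (comma_category B A f a) \<Longrightarrow> \<exists>q\<in>S. \<exists>m. in_hom (comma_category B A f a) m p q"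
      by (rule comma_category_finite_final[OF f B A a]) (rule that)
    show "\<exists>L \<iota>. is_colimit (comma_category B A f a) Vect (functor_comp G comma_proj) L \<iota>"
      by (rule Vect_colimit[OF cat_functor_comp[OF comma_proj_functor[OF f] G] S])
  qed
qed

theorem theorem5p2p1:
  fixes A1 :: "('o1, 'm1) category" and A2 :: "('o2, 'm2) category" and A3 :: "('o3, 'm3) category"
    and X :: "('x, 'y) category" and X' :: "('x2, 'y2) category"
  assumes "groupoid_span A1 X A2 s t"
    and "groupoid_span A2 X' A3 s' t'"
  shows "\<exists>\<beta>. nat_iso
      (functor_category A1 (Vect :: 'v vect_category))
      (functor_category A3 (Vect :: 'v vect_category))
      (Lambda (weak_pullback X A2 X' t s') A3
        (functor_comp s weak_pullback_fst) (functor_comp t' weak_pullback_snd))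
      (functor_comp (Lambda X' A3 s' t') (Lambda X A2 s t))
      \<beta>"
proof -
  from assms have ess: "essentially_finite_groupoid X" "essentially_finite_groupoid X'"
    "essentially_finite_groupoid A2" "essentially_finite_groupoid A3"
    and s: "cat_functor X A1 s" and t: "cat_functor X A2 t"
    and s': "cat_functor X' A2 s'" and t': "cat_functor X' A3 t'"
    by (auto simp: groupoid_span_def)
  note rf = ess(1,2)[THEN essentially_finite_retract_finite]
    and lf = ess(3,4)[THEN essentially_finite_locally_finite]
  interpret cospan X A2 X' t s' using t s' by (rule cospan.intro)
  have fW: "cat_functor W A3 (functor_comp t' weak_pullback_snd)"
    by (rule cat_functor_comp[OF weak_pullback_snd_functor t'])
  \<comment> \<open>\<open>pushforward_Vect\<close> is applied to \<open>t\<close>, to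
    \<open>t'\<close> and to the projection from \<open>W\<close> followed by \<open>t'\<close>; the
    last case calls for the retract property of \<open>W\<close>.\<close>
  interpret base_change X A2 X' A3 t s' t' "Vect :: 'v vect_category"
    by (intro base_change.intro cospan_axioms pushforward_Vect t t' rf lf fW
        weak_pullback_retract_finite)
  let ?D = "Vect :: 'v vect_category"
  note iso = nat_iso_whisker[OF pullback_functor_functor[OF s category_Vect] base_change_iso]
  \<comment> \<open>On the target side composition of functor records is strictly associative, so
    the whiskered functor is literally the composite of the two \<open>Lambda\<close>.\<close>
  have "functor_comp (functor_comp (functor_comp (pushforward_functor X' A3 ?D t') (pullback_functor X' s'))
        (pushforward_functor X A2 ?D t)) (pullback_functor X s)
      = functor_comp (Lambda X' A3 s' t') (Lambda X A2 s t)"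
    by (simp add: Lambda_def functor_comp_def comp_assoc)
  note iso' = iso[unfolded this]
  show ?thesis
  \<comment> \<open>On the source side restriction along the composite leg must be exchanged for two
    successive restrictions, on objects and on arrows.\<close>
  proof (rule exI, rule nat_iso_cong[OF iso'])
    fix m F G assume "in_hom (functor_category A1 ?D) m F G"
    then obtain \<tau> where m: "m = (F, \<tau>, G)" by (auto simp: functor_category_hom)
    interpret fst: cat_functor W X fst_W by (rule weak_pullback_fst_functor)
    \<comment> \<open>The inner restriction to \<open>Obj X\<close> has no effect because the first
      projection sends \<open>Obj W\<close> into \<open>Obj X\<close>.\<close>
    have "(\<lambda>w\<in>Obj W. \<tau> (FObj s (FObj fst_W w))) = (\<lambda>w\<in>Obj W. (\<lambda>x\<in>Obj X. \<tau> (FObj s x)) (FObj fst_W w))"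
      by (auto simp: fst.fobj_in)
    then show "FArr (Lambda W A3 (functor_comp s weak_pullback_fst) (functor_comp t' weak_pullback_snd)) m =
      FArr (functor_comp (functor_comp (pushforward_functor W A3 ?D (functor_comp t' weak_pullback_snd))
        (pullback_functor W weak_pullback_fst)) (pullback_functor X s)) m"
      by (simp add: Lambda_def m precomp_functor_comp[OF weak_pullback_fst_functor])
  qed (simp add: Lambda_def precomp_functor_comp[OF weak_pullback_fst_functor])
qed

end
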